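(* If $t_0\in[-\pi,\pi]$ is not Schnorr random, then there is a computable function $f:[-\pi,\pi]\to\mathbb{C}$ whose Fourier series diverges at $t_0$; that is, the sequence $\{S_N(f)(t_0)\}_{N\in\mathbb{N}}$ does not converge.
   Context: For $n\in\mathbb{Z}$ let $e_n(t)=e^{int}$, and for $f\in L^1[-\pi,\pi]$ let $c_n(f)=\frac{1}{2\pi}\int_{-\pi}^{\pi}f(t)e^{-int}\,dt$ and $S_N(f)=\sum_{n=-N}^{N}c_n(f)e_n$. An open rational rectangle is a product of two open intervals with rational endpoints (a subset of the plane $\mathbb{C}$). A function $f$ with $\mathrm{dom}(f)\subseteq\mathbb{C}$ and values in $\mathbb{C}$ is computable if there is an algorithm $P$ such that: (Approximation) given an open rational rectangle as input, $P$ either does not halt or outputs an open rational rectangle; (Correctness) whenever $P$ halts on an open rational rectangle $R$, the output rectangle contains $f(z)$ for each $z\in R\cap\mathrm{dom}(f)$; (Convergence) whenever $U$ is a neighborhood of a point $z\in\mathrm{dom}(f)$ and $V$ is a neighborhood of $f(z)$, there is an open rational rectangle $R$ with $z\in R\subseteq U$ such that $P$ on input $R$ outputs a rational rectangle included in $V$. In particular computable functions are continuous. A real number $x$ is computable if there is an algorithm that, given $k\in\mathbb{N}$, outputs a rational $q$ with $|q-x|<2^{-k}$; a sequence of numbers is computable if its terms are computable uniformly in the index. An open set $U\subseteq\mathbb{R}$ is computably open if the set of closed intervals with rational endpoints included in $U$ is computably enumerable; a sequence $\{U_n\}_{n\in\mathbb{N}}$ of open sets is computable if $U_n$ is computably open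 uniformly in $n$. Let $\mu$ be Lebesgue measure. A Schnorr test is a computable sequence $\{V_n\}_{n\in\mathbb{N}}$ of open sets of reals such that $\mu(V_n)\le 2^{-n}$ for all $n$ and the sequence $\{\mu(V_n)\}_{n\in\mathbb{N}}$ is computable. A real $x$ is Schnorr random if $x\notin\bigcap_n V_n$ for every Schnorr test $\{V_n\}_{n\in\mathbb{N}}$. *)

theory Defs
  imports "HOL-Analysis.Analysis" "HOL-Library.Nat_Bijection"
begin

section \<open>Algorithms\<close>

text \<open>
  Unary presentation of the partial recursive functions: several arguments are passed as one
  number through the (primitive recursive) pairing function \<^const>\<open>prod_encode\<close>, and
  divergence is \<^const>\<open>None\<close>.
\<close>

primrec primitive_recursion ::
  "(nat \<Rightarrow> nat option) \<Rightarrow> (nat \<Rightarrow> nat option) \<Rightarrow> nat \<Rightarrow> nat \<Rightarrow> nat option" where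
  "primitive_recursion f g a 0 = f a"
| "primitive_recursion f g a (Suc n) =
     Option.bind (primitive_recursion f g a n) (\<lambda>r. g (prod_encode (a, prod_encode (n, r))))"

text \<open>The search diverges if some value is undefined before the first zero is reached.\<close>

definition minimization :: "(nat \<Rightarrow> nat option) \<Rightarrow> nat \<Rightarrow> nat option" where
  "minimization f a =
     (if \<exists>n. f (prod_encode (a, n)) = Some 0 \<and> (\<forall>m<n. f (prod_encode (a, m)) \<noteq> None)
      then Some (LEAST n. f (prod_encode (a, n)) = Some 0) else None)"

inductive partial_recursive :: "(nat \<Rightarrow> nat option) \<Rightarrow> bool" where
  zero: "partial_recursive (\<lambda>_. Some 0)"
| succ: "partial_recursive (\<lambda>n. Some (Suc n))"
| left: "partial_recursive (\<lambda>n. Some (fst (prod_decode n)))"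
| right: "partial_recursive (\<lambda>n. Some (snd (prod_decode n)))"
| pair: "partial_recursive f \<Longrightarrow> partial_recursive g \<Longrightarrow>
    partial_recursive (\<lambda>n. Option.bind (f n) (\<lambda>x. Option.bind (g n) (\<lambda>y. Some (prod_encode (x, y)))))"
| comp: "partial_recursive f \<Longrightarrow> partial_recursive g \<Longrightarrow>
    partial_recursive (\<lambda>n. Option.bind (g n) f)"
| prec: "partial_recursive f \<Longrightarrow> partial_recursive g \<Longrightarrow>
    partial_recursive (\<lambda>n. case prod_decode n of (a, k) \<Rightarrow> primitive_recursion f g a k)"
| mini: "partial_recursive f \<Longrightarrow> partial_recursive (minimization f)"

text \<open>
  Algorithms act on finite objects through injective encodings into \<^typ>\<open>nat\<close>. A rational is
  encoded by its reduced fraction with positive denominator, so that every object has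
  exactly one code and the output of an algorithm depends only on the object.
\<close>

definition rat_enc :: "rat \<Rightarrow> nat" where
  "rat_enc q = (case quotient_of q of (a, b) \<Rightarrow> prod_encode (int_encode a, nat b))"

definition prod_enc :: "('a \<Rightarrow> nat) \<Rightarrow> ('b \<Rightarrow> nat) \<Rightarrow> 'a \<times> 'b \<Rightarrow> nat" where
  "prod_enc e e' = (\<lambda>(x, y). prod_encode (e x, e' y))"

lemma inj_rat_enc: "inj rat_enc"
proof (rule injI)
  fix p q assume eq: "rat_enc p = rat_enc q"
  obtain a b c d where p: "quotient_of p = (a, b)" and q: "quotient_of q = (c, d)"
    by (meson surj_pair)
  have "a = c" "b = d"
    using eq quotient_of_denom_pos[OF p] quotient_of_denom_pos[OF q]
    by (auto simp: rat_enc_def p q inj_eq[OF inj_int_encode])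
  then show "p = q" using p q quotient_of_inject by simp
qed

lemma inj_prod_enc: "inj e \<Longrightarrow> inj e' \<Longrightarrow> inj (prod_enc e e')"
  by (auto simp: inj_on_def prod_enc_def)

definition computable_partial ::
  "('a \<Rightarrow> nat) \<Rightarrow> ('b \<Rightarrow> nat) \<Rightarrow> ('a \<Rightarrow> 'b option) \<Rightarrow> bool" where
  "computable_partial e e' g \<longleftrightarrow>
     (\<exists>P. partial_recursive P \<and> (\<forall>x. P (e x) = map_option e' (g x)))"

definition computably_enumerable :: "('a \<Rightarrow> nat) \<Rightarrow> 'a set \<Rightarrow> bool" where
  "computably_enumerable e A \<longleftrightarrow> (\<exists>P. partial_recursive P \<and> (\<forall>x. x \<in> A \<longleftrightarrow> P (e x) \<noteq> None))"


section \<open>Computable functions on the plane\<close>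

text \<open>\<open>(a, b, c, d)\<close> stands for the product of the intervals \<open>(a, b)\<close> and \<open>(c, d)\<close>.\<close>

type_synonym rectangle = "rat \<times> rat \<times> rat \<times> rat"

definition rectangle_enc :: "rectangle \<Rightarrow> nat" where
  "rectangle_enc = prod_enc rat_enc (prod_enc rat_enc (prod_enc rat_enc rat_enc))"

fun is_rectangle :: "rectangle \<Rightarrow> bool" where
  "is_rectangle (a, b, c, d) \<longleftrightarrow> a < b \<and> c < d"

fun rectangle_set :: "rectangle \<Rightarrow> complex set" where
  "rectangle_set (a, b, c, d) =
     {z. of_rat a < Re z \<and> Re z < of_rat b \<and> of_rat c < Im z \<and> Im z < of_rat d}"

text \<open>\<open>computable_on D f\<close>: the restriction of \<open>f\<close> to \<open>D\<close> is computable.\<close>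

definition computable_on :: "complex set \<Rightarrow> (complex \<Rightarrow> complex) \<Rightarrow> bool" where
  "computable_on D f \<longleftrightarrow>
     (\<exists>P :: rectangle \<Rightarrow> rectangle option. computable_partial rectangle_enc rectangle_enc P \<and>
        (\<forall>R R'. is_rectangle R \<longrightarrow> P R = Some R' \<longrightarrow> is_rectangle R') \<and>
        (\<forall>R R'. is_rectangle R \<longrightarrow> P R = Some R' \<longrightarrow>
           (\<forall>z \<in> rectangle_set R \<inter> D. f z \<in> rectangle_set R')) \<and>
        (\<forall>z \<in> D. \<forall>U V. open U \<longrightarrow> z \<in> U \<longrightarrow> open V \<longrightarrow> f z \<in> V \<longrightarrow>
           (\<exists>R R'. is_rectangle R \<and> z \<in> rectangle_set R \<and> rectangle_set R \<subseteq> U \<and>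
              P R = Some R' \<and> rectangle_set R' \<subseteq> V)))"


section \<open>Schnorr randomness\<close>

definition computable_real_sequence :: "(nat \<Rightarrow> real) \<Rightarrow> bool" where
  "computable_real_sequence x \<longleftrightarrow>
     (\<exists>q :: nat \<times> nat \<Rightarrow> rat. computable_partial prod_encode rat_enc (\<lambda>nk. Some (q nk)) \<and>
        (\<forall>n k. \<bar>of_rat (q (n, k)) - x n\<bar> < 1 / 2 ^ k))"

definition computable_open_sequence :: "(nat \<Rightarrow> real set) \<Rightarrow> bool" where
  "computable_open_sequence U \<longleftrightarrow> (\<forall>n. open (U n)) \<and>
     computably_enumerable (prod_enc id (prod_enc rat_enc rat_enc))
       {(n, a, b). a < b \<and> {of_rat a..of_rat b} \<subseteq> U n}"

text \<open>The bound uses \<^const>\<open>emeasure\<close> since \<^const>\<open>measure\<close> is 0 on sets of infinite measure.\<close>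

definition schnorr_test :: "(nat \<Rightarrow> real set) \<Rightarrow> bool" where
  "schnorr_test V \<longleftrightarrow> computable_open_sequence V \<and>
     (\<forall>n. emeasure lborel (V n) \<le> ennreal (1 / 2 ^ n)) \<and>
     computable_real_sequence (\<lambda>n. measure lborel (V n))"

definition schnorr_random :: "real \<Rightarrow> bool" where
  "schnorr_random x \<longleftrightarrow> (\<forall>V. schnorr_test V \<longrightarrow> x \<notin> (\<Inter>n. V n))"


section \<open>Fourier series\<close>

definition fourier_basis :: "int \<Rightarrow> real \<Rightarrow> complex" where
  "fourier_basis n t = exp (\<i> * of_int n * of_real t)"

definition fourier_coeff :: "(real \<Rightarrow> complex) \<Rightarrow> int \<Rightarrow> complex" where
  "fourier_coeff f n =
     1 / (2 * of_real pi) *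
       (LINT t:{-pi..pi}|lebesgue. f t * exp (- (\<i> * of_int n * of_real t)))"

definition fourier_sum :: "(real \<Rightarrow> complex) \<Rightarrow> nat \<Rightarrow> real \<Rightarrow> complex" where
  "fourier_sum f N t = (\<Sum>n\<in>{- int N..int N}. fourier_coeff f n * fourier_basis n t)"

end

theory Submission
  imports Defs "HOL-Complex_Analysis.Cauchy_Integral_Formula"
begin

text \<open>
  Let \<open>T\<close> be a finite set and \<open>l > 0\<close> with \<open>card T * l\<close> small. The average \<open>\<psi>\<close> of the functions
  \<open>1 / (1 + l - z e\<^sup>\<plusminus>\<^sup>i\<^sup>t)\<close> over \<open>t \<in> T\<close> has positive real part on the closed unit disc, at least
  \<open>1 / (8 * card T * l)\<close> near \<open>T\<close>. So \<open>log \<psi>\<close> has imaginary part at most \<open>\<pi> / 2\<close> and large real part near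
  \<open>T\<close>, and a section of its Taylor series yields a bounded sine polynomial \<open>B\<close> whose conjugate cosine
  polynomial is large there (Kahane and Katznelson). Multiplying \<open>B\<close> by \<open>e\<^sup>i\<^sup>N\<^sup>t\<close> puts all its frequencies
  on the positive side, with the negative half of \<open>B\<close> just below \<open>N\<close>; a block of Fourier terms ending at \<open>N\<close>
  then has the size of the conjugate.

  A Schnorr test is turned into a computable sequence of finite unions of dyadic intervals that contain
  \<open>t\<^sub>0\<close> infinitely often and whose measure, because the measures of the test are computable, decreases fast
  enough for the \<open>k\<close>th conjugate to exceed \<open>2 ^ k\<close>. The polynomials need not be constructed: rational
  coefficients with the required properties exist and the properties can be verified on a fine grid, so an
  unbounded search finds them. The function is the sum of the \<open>k\<close>th products weighted by
  \<open>2\<^sup>-\<^sup>k\<close>, with disjoint frequency blocks, and infinitely many blocks contribute at least \<open>1 / 2\<close> at \<open>t\<^sub>0\<close>.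
\<close>

section \<open>Recursive functions\<close>

text \<open>A polynomial can be made large only on finitely many intervals, while a component of the
  test is an infinite union revealed in stages. Block \<open>k\<close> therefore serves what is
  newly found of finitely many components between two stages, together with what is already known of
  one further component. The gain is logarithmic: intervals of total length \<delta> yield a
  conjugate of size about \<open>ln (1 / \<delta>)\<close>, so beating the weight
  \<open>2 ^ k\<close> needs a length of about \<open>exp (- (2 ^ k))\<close>. Hence only the
  components with index \<open>2 ^ (k + 5)\<close> are used. What a component still hides after a
  stage must be just as small, and the search for such a stage relies on the measures of the test
  being computable; an enumeration of the open sets alone would not tell when to stop. The final
  \<open>1 / 2\<close> is the one in the Euler formula for the sine: of the two exponentials of each
  sine term, only the one below \<open>N\<close> enters the block of Fourier terms.\<close>

definition recursive :: "(nat \<Rightarrow> nat) \<Rightarrow> bool" where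
  "recursive f \<longleftrightarrow> partial_recursive (\<lambda>n. Some (f n))"

definition decidable :: "(nat \<Rightarrow> bool) \<Rightarrow> bool" where
  "decidable P \<longleftrightarrow> recursive (\<lambda>n. of_bool (P n))"

abbreviation pfst :: "nat \<Rightarrow> nat" where "pfst n \<equiv> fst (prod_decode n)"
abbreviation psnd :: "nat \<Rightarrow> nat" where "psnd n \<equiv> snd (prod_decode n)"

named_theorems recursive_intros

lemma recursive_compose: "recursive g \<Longrightarrow> recursive f \<Longrightarrow> recursive (\<lambda>x. g (f x))"
  using partial_recursive.comp[of "\<lambda>n. Some (g n)" "\<lambda>n. Some (f n)"]
  by (simp add: recursive_def)

lemma decidable_compose: "decidable P \<Longrightarrow> recursive f \<Longrightarrow> decidable (\<lambda>x. P (f x))"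
  unfolding decidable_def by (rule recursive_compose)

lemma recursive_pair [recursive_intros]:
  "recursive f \<Longrightarrow> recursive g \<Longrightarrow> recursive (\<lambda>x. prod_encode (f x, g x))"
  using partial_recursive.pair[of "\<lambda>n. Some (f n)" "\<lambda>n. Some (g n)"]
  by (simp add: recursive_def)

lemma recursive_Suc [recursive_intros]: "recursive f \<Longrightarrow> recursive (\<lambda>x. Suc (f x))"
  using recursive_compose[of Suc f] partial_recursive.succ by (simp add: recursive_def)

lemma recursive_pfst [recursive_intros]: "recursive f \<Longrightarrow> recursive (\<lambda>x. pfst (f x))"
  using recursive_compose[of pfst f] partial_recursive.left by (simp add: recursive_def)

lemma recursive_psnd [recursive_intros]: "recursive f \<Longrightarrow> recursive (\<lambda>x. psnd (f x))"
  using recursive_compose[of psnd f] partial_recursive.right by (simp add: recursive_def)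

lemma recursive_id [recursive_intros]: "recursive (\<lambda>x. x)"
  using partial_recursive.pair[OF partial_recursive.left partial_recursive.right]
  by (simp add: recursive_def)

lemma recursive_const [recursive_intros]: "recursive (\<lambda>_. c)"
proof (induction c)
  case 0
  then show ?case using partial_recursive.zero by (simp add: recursive_def)
qed (rule recursive_Suc)

text \<open>Start value, step and bound may all depend on \<open>x\<close>. Functions defined by
  recursion below are brought into this form, so the encoding of arguments is handled only
  here.\<close>

lemma recursive_rec_nat:
  assumes "recursive f" "recursive (\<lambda>z. g (pfst z) (pfst (psnd z)) (psnd (psnd z)))" "recursive h"
  shows "recursive (\<lambda>x. rec_nat (f x) (g x) (h x))"
proof -
  let ?g = "\<lambda>z. g (pfst z) (pfst (psnd z)) (psnd (psnd z))"
  have *: "primitive_recursion (\<lambda>n. Some (f n)) (\<lambda>n. Some (?g n)) a k = Some (rec_nat (f a) (g a) k)" for a k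
    by (induction k) auto
  have "recursive (\<lambda>z. rec_nat (f (pfst z)) (g (pfst z)) (psnd z))"
    using partial_recursive.prec[OF assms(1,2)[unfolded recursive_def]]
    by (simp add: * recursive_def case_prod_beta)
  from recursive_compose[OF this recursive_pair[OF recursive_id assms(3)]] show ?thesis by simp
qed

lemma recursive_add [recursive_intros]:
  assumes "recursive f" "recursive g" shows "recursive (\<lambda>x. f x + g x)"
proof -
  have "recursive (\<lambda>x. rec_nat (f x) (\<lambda>i r. Suc r) (g x))"
    by (intro recursive_rec_nat recursive_intros assms)
  moreover have "rec_nat a (\<lambda>i r. Suc r) b = a + b" for a b by (induction b) auto
  ultimately show ?thesis by simp
qed

lemma recursive_sum [recursive_intros]:
  assumes "recursive (\<lambda>z. F (pfst z) (psnd z))" "recursive h"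
  shows "recursive (\<lambda>x. \<Sum>i<h x. F x i)"
proof -
  have F: "recursive (\<lambda>z. F (pfst z) (pfst (psnd z)))"
    using recursive_compose[OF assms(1), of "\<lambda>z. prod_encode (pfst z, pfst (psnd z))"]
    by (simp add: recursive_intros)
  have "recursive (\<lambda>x. rec_nat 0 (\<lambda>i r. r + F x i) (h x))"
    by (intro recursive_rec_nat recursive_intros assms F)
  moreover have "rec_nat 0 (\<lambda>i r. r + F x i) b = (\<Sum>i<b. F x i)" for x b by (induction b) auto
  ultimately show ?thesis by simp
qed

lemma recursive_mult [recursive_intros]:
  assumes "recursive f" "recursive g" shows "recursive (\<lambda>x. f x * g x)"
  using recursive_sum[of "\<lambda>x i. f x" g, OF recursive_compose[OF assms(1)] assms(2)]
  by (simp add: recursive_intros mult.commute)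

lemma recursive_prod [recursive_intros]:
  assumes "recursive (\<lambda>z. F (pfst z) (psnd z))" "recursive h"
  shows "recursive (\<lambda>x. \<Prod>i<h x. F x i)"
proof -
  have F: "recursive (\<lambda>z. F (pfst z) (pfst (psnd z)))"
    using recursive_compose[OF assms(1), of "\<lambda>z. prod_encode (pfst z, pfst (psnd z))"]
    by (simp add: recursive_intros)
  have "recursive (\<lambda>x. rec_nat 1 (\<lambda>i r. r * F x i) (h x))"
    by (intro recursive_rec_nat recursive_intros assms F)
  moreover have "rec_nat 1 (\<lambda>i r. r * F x i) b = (\<Prod>i<b. F x i)" for x b by (induction b) auto
  ultimately show ?thesis by simp
qed

lemma recursive_power [recursive_intros]:
  assumes "recursive f" "recursive g" shows "recursive (\<lambda>x. f x ^ g x)"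
  using recursive_prod[of "\<lambda>x i. f x" g, OF recursive_compose[OF assms(1)] assms(2)]
  by (simp add: recursive_intros)

lemma recursive_diff [recursive_intros]:
  assumes "recursive f" "recursive g" shows "recursive (\<lambda>x. f x - g x)"
proof -
  have "recursive (\<lambda>x. rec_nat 0 (\<lambda>i r. i) x)"
    by (intro recursive_rec_nat recursive_intros)
  moreover have "rec_nat 0 (\<lambda>i r. i) x = x - 1" for x by (cases x) auto
  ultimately have pred: "recursive (\<lambda>x. x - 1)" by simp
  have "recursive (\<lambda>x. rec_nat (f x) (\<lambda>i r. r - 1) (g x))"
    by (intro recursive_rec_nat recursive_compose[OF pred] recursive_intros assms)
  moreover have "rec_nat a (\<lambda>i r. r - 1) b = a - b" for a b :: nat by (induction b) auto
  ultimately show ?thesis by simp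
qed

lemma decidable_le [recursive_intros]:
  assumes "recursive f" "recursive g" shows "decidable (\<lambda>x. f x \<le> g x)"
proof -
  have "recursive (\<lambda>x. 1 - (f x - g x))" by (intro recursive_intros assms)
  moreover have "1 - (f x - g x) = of_bool (f x \<le> g x)" for x by auto
  ultimately show ?thesis by (simp add: decidable_def)
qed

lemma decidable_not [recursive_intros]:
  assumes "decidable P" shows "decidable (\<lambda>x. \<not> P x)"
proof -
  have "recursive (\<lambda>x. 1 - of_bool (P x))"
    using assms by (intro recursive_intros) (simp add: decidable_def)
  moreover have "1 - of_bool (P x) = (of_bool (\<not> P x) :: nat)" for x by auto
  ultimately show ?thesis by (simp add: decidable_def)
qed

lemma decidable_conj [recursive_intros]:
  assumes "decidable P" "decidable Q" shows "decidable (\<lambda>x. P x \<and> Q x)"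
  using recursive_mult[OF assms[unfolded decidable_def]]
  by (simp add: decidable_def of_bool_conj)

lemma decidable_disj [recursive_intros]:
  assumes "decidable P" "decidable Q" shows "decidable (\<lambda>x. P x \<or> Q x)"
proof -
  have "decidable (\<lambda>x. \<not> (\<not> P x \<and> \<not> Q x))" by (intro recursive_intros assms)
  then show ?thesis by simp
qed

lemma decidable_imp [recursive_intros]:
  assumes "decidable P" "decidable Q" shows "decidable (\<lambda>x. P x \<longrightarrow> Q x)"
proof -
  have "decidable (\<lambda>x. \<not> P x \<or> Q x)" by (intro recursive_intros assms)
  then show ?thesis by (simp only: imp_conv_disj)
qed

lemma decidable_less [recursive_intros]:
  assumes "recursive f" "recursive g" shows "decidable (\<lambda>x. f x < g x)"
proof -
  have "decidable (\<lambda>x. \<not> g x \<le> f x)" by (intro recursive_intros assms)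
  then show ?thesis by (simp add: not_le)
qed

lemma decidable_eq [recursive_intros]:
  assumes "recursive f" "recursive g" shows "decidable (\<lambda>x. f x = g x)"
proof -
  have "decidable (\<lambda>x. f x \<le> g x \<and> g x \<le> f x)" by (intro recursive_intros assms)
  then show ?thesis by (simp add: eq_iff)
qed

lemma recursive_of_bool [recursive_intros]: "decidable P \<Longrightarrow> recursive (\<lambda>x. of_bool (P x))"
  by (simp add: decidable_def)

lemma recursive_if [recursive_intros]:
  assumes "decidable P" "recursive f" "recursive g"
  shows "recursive (\<lambda>x. if P x then f x else g x)"
proof -
  have "recursive (\<lambda>x. of_bool (P x) * f x + of_bool (\<not> P x) * g x)"
    by (intro recursive_intros assms)
  moreover have "of_bool (P x) * f x + of_bool (\<not> P x) * g x = (if P x then f x else g x)" for x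
    by simp
  ultimately show ?thesis by simp
qed

lemma decidable_ex [recursive_intros]:
  assumes "decidable (\<lambda>z. P (pfst z) (psnd z))" "recursive h"
  shows "decidable (\<lambda>x. \<exists>i<h x. P x i)"
proof -
  have "decidable (\<lambda>x. 0 < (\<Sum>i<h x. of_bool (P x i) :: nat))"
    by (intro recursive_intros assms)
  moreover have "0 < (\<Sum>i<h x. of_bool (P x i) :: nat) \<longleftrightarrow> (\<exists>i<h x. P x i)" for x
    using sum_eq_0_iff[of "{..<h x}" "\<lambda>i. of_bool (P x i) :: nat"] 
    by (metis (no_types, lifting) bot_nat_0.not_eq_extremum finite_lessThan lessThan_iff of_bool_eq_0_iff)
  ultimately show ?thesis by simp
qed

lemma decidable_all [recursive_intros]:
  assumes "decidable (\<lambda>z. P (pfst z) (psnd z))" "recursive h"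
  shows "decidable (\<lambda>x. \<forall>i<h x. P x i)"
proof -
  have "decidable (\<lambda>x. \<not> (\<exists>i<h x. \<not> P x i))"
    by (intro recursive_intros assms)
  then show ?thesis by simp
qed

text \<open>The tested predicate is total and has a witness for every argument, so minimization
  never diverges. All unbounded searches that define total functions below go through this.\<close>

lemma recursive_Least:
  assumes "decidable (\<lambda>z. P (pfst z) (psnd z))" "\<And>x. \<exists>n. P x n"
  shows "recursive (\<lambda>x. LEAST n. P x n)"
proof -
  let ?f = "\<lambda>z. if P (pfst z) (psnd z) then 0 else 1 :: nat"
  have "recursive ?f" by (intro recursive_intros assms)
  then have "partial_recursive (minimization (\<lambda>z. Some (?f z)))"
    unfolding recursive_def by (rule partial_recursive.mini)
  moreover have "minimization (\<lambda>z. Some (?f z)) x = Some (LEAST n. P x n)" for x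
    using assms(2)[of x] by (auto simp: minimization_def)
  ultimately have "partial_recursive (\<lambda>x. Some (LEAST n. P x n))"
    by (metis (no_types, lifting) ext)
  then show ?thesis by (simp add: recursive_def)
qed

lemma recursive_div [recursive_intros]:
  assumes "recursive f" "recursive g" shows "recursive (\<lambda>x. f x div g x)"
proof -
  have f: "recursive (\<lambda>z. f (pfst z))" and g: "recursive (\<lambda>z. g (pfst z))"
    by (intro recursive_compose[OF assms(1)] recursive_compose[OF assms(2)] recursive_intros)+
  \<comment> \<open>The disjunct for a zero divisor stops the search at \<open>0\<close>, which is
    the value of division by zero.\<close>
  have "recursive (\<lambda>x. LEAST q. g x = 0 \<or> f x < Suc q * g x)"
  proof (intro recursive_Least recursive_intros f g)
    fix x
    show "\<exists>n. g x = 0 \<or> f x < Suc n * g x"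
    proof (cases "g x")
      case (Suc m)
      then show ?thesis by (intro exI[of _ "f x"]) auto
    qed auto
  qed
  moreover have "(LEAST q. b = 0 \<or> a < Suc q * b) = a div b" for a b :: nat
  proof (cases "b = 0")
    case False
    show ?thesis
    proof (rule Least_equality)
      show "b = 0 \<or> a < Suc (a div b) * b"
        using False by (metis dividend_less_div_times gr0I mult.commute mult_Suc_right mult_Suc)
      fix y assume "b = 0 \<or> a < Suc y * b"
      then show "a div b \<le> y" using False
        by (metis less_Suc_eq_le less_mult_imp_div_less)
    qed
  qed (auto intro: Least_equality)
  ultimately show ?thesis by simp
qed

lemma recursive_mod [recursive_intros]:
  assumes "recursive f" "recursive g" shows "recursive (\<lambda>x. f x mod g x)"
  using recursive_diff[OF assms(1) recursive_mult[OF assms(2) recursive_div[OF assms]]]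
  by (simp add: minus_mult_div_eq_mod)

lemma decidable_dvd [recursive_intros]:
  assumes "recursive f" "recursive g" shows "decidable (\<lambda>x. f x dvd g x)"
  using decidable_eq[OF recursive_mod[OF assms(2,1)] recursive_const[of 0]]
  by (simp add: dvd_eq_mod_eq_0)

lemma recursive_fact [recursive_intros]:
  assumes "recursive f" shows "recursive (\<lambda>x. fact (f x))"
proof -
  have "recursive (\<lambda>x. \<Prod>i<f x. Suc i)" by (intro recursive_intros assms)
  moreover have "(\<Prod>i<n. Suc i) = fact n" for n by (induction n) auto
  ultimately show ?thesis by simp
qed

section \<open>Recursive functions with rational values\<close>

text \<open>Fractions stay unreduced and numerators are differences of natural numbers, so that
  sums, products and comparisons reduce to arithmetic on natural numbers. The values are of type
  \<open>real\<close> in order to be compared directly with analytic quantities.\<close>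

definition recursive_real :: "(nat \<Rightarrow> real) \<Rightarrow> bool" where
  "recursive_real F \<longleftrightarrow> (\<exists>a b c. recursive a \<and> recursive b \<and> recursive c \<and> (\<forall>x. 0 < c x) \<and>
     (\<forall>x. F x = (real (a x) - real (b x)) / real (c x)))"

lemma recursive_realI:
  "recursive a \<Longrightarrow> recursive b \<Longrightarrow> recursive c \<Longrightarrow> (\<And>x. 0 < c x) \<Longrightarrow>
   (\<And>x. F x = (real (a x) - real (b x)) / real (c x)) \<Longrightarrow> recursive_real F"
  unfolding recursive_real_def by blast

lemma recursive_realE:
  assumes "recursive_real F"
  obtains a b c where "recursive a" "recursive b" "recursive c" "\<And>x. 0 < c x"
    "\<And>x. F x = (real (a x) - real (b x)) / real (c x)"
  using assms unfolding recursive_real_def by blast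

lemma recursive_real_compose:
  assumes "recursive_real F" "recursive f" shows "recursive_real (\<lambda>x. F (f x))"
proof -
  from assms(1) obtain a b c where "recursive a" "recursive b" "recursive c" "\<And>x. 0 < c x"
    "\<And>x. F x = (real (a x) - real (b x)) / real (c x)" by (rule recursive_realE) blast
  then show ?thesis
    by (intro recursive_realI[of "\<lambda>x. a (f x)" "\<lambda>x. b (f x)" "\<lambda>x. c (f x)"])
       (auto intro: recursive_compose assms(2))
qed

lemma recursive_real_of_nat [recursive_intros]: "recursive f \<Longrightarrow> recursive_real (\<lambda>x. real (f x))"
  by (rule recursive_realI[of f "\<lambda>_. 0" "\<lambda>_. 1"]) (auto intro: recursive_intros)

lemma recursive_real_numeral [recursive_intros]: "recursive_real (\<lambda>x. numeral n)"
  using recursive_real_of_nat[OF recursive_const, of "numeral n"] by simp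

lemma recursive_real_0 [recursive_intros]: "recursive_real (\<lambda>x. 0)"
  using recursive_real_of_nat[OF recursive_const, of 0] by simp

lemma recursive_real_1 [recursive_intros]: "recursive_real (\<lambda>x. 1)"
  using recursive_real_of_nat[OF recursive_const, of 1] by simp

lemma recursive_real_add [recursive_intros]:
  assumes "recursive_real F" "recursive_real G" shows "recursive_real (\<lambda>x. F x + G x)"
proof -
  from assms(1) obtain a b c where 1: "recursive a" "recursive b" "recursive c" "\<And>x. 0 < c x"
    "\<And>x. F x = (real (a x) - real (b x)) / real (c x)" by (rule recursive_realE) blast
  from assms(2) obtain a' b' c' where 2: "recursive a'" "recursive b'" "recursive c'" "\<And>x. 0 < c' x"
    "\<And>x. G x = (real (a' x) - real (b' x)) / real (c' x)" by (rule recursive_realE) blast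
  show ?thesis
  proof (rule recursive_realI)
    show "recursive (\<lambda>x. a x * c' x + a' x * c x)" "recursive (\<lambda>x. b x * c' x + b' x * c x)"
      "recursive (\<lambda>x. c x * c' x)" by (intro recursive_intros 1 2)+
    fix x show "0 < c x * c' x" using 1(4)[of x] 2(4)[of x] by simp
    show "F x + G x = (real (a x * c' x + a' x * c x) - real (b x * c' x + b' x * c x)) / real (c x * c' x)"
      using 1(4)[of x] 2(4)[of x] by (simp add: 1(5) 2(5) field_simps)
  qed
qed

lemma recursive_real_minus [recursive_intros]:
  assumes "recursive_real F" shows "recursive_real (\<lambda>x. - F x)"
proof -
  from assms(1) obtain a b c where 1: "recursive a" "recursive b" "recursive c" "\<And>x. 0 < c x"
    "\<And>x. F x = (real (a x) - real (b x)) / real (c x)" by (rule recursive_realE) blast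
  show ?thesis
    by (rule recursive_realI[of b a c]) (use 1 in \<open>auto simp: minus_divide_left\<close>)
qed

lemma recursive_real_diff [recursive_intros]:
  assumes "recursive_real F" "recursive_real G" shows "recursive_real (\<lambda>x. F x - G x)"
  using recursive_real_add[OF assms(1) recursive_real_minus[OF assms(2)]] by simp

lemma recursive_real_mult [recursive_intros]:
  assumes "recursive_real F" "recursive_real G" shows "recursive_real (\<lambda>x. F x * G x)"
proof -
  from assms(1) obtain a b c where 1: "recursive a" "recursive b" "recursive c" "\<And>x. 0 < c x"
    "\<And>x. F x = (real (a x) - real (b x)) / real (c x)" by (rule recursive_realE) blast
  from assms(2) obtain a' b' c' where 2: "recursive a'" "recursive b'" "recursive c'" "\<And>x. 0 < c' x"
    "\<And>x. G x = (real (a' x) - real (b' x)) / real (c' x)" by (rule recursive_realE) blast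
  show ?thesis
  proof (rule recursive_realI)
    show "recursive (\<lambda>x. a x * a' x + b x * b' x)" "recursive (\<lambda>x. a x * b' x + b x * a' x)"
      "recursive (\<lambda>x. c x * c' x)" by (intro recursive_intros 1 2)+
    fix x show "0 < c x * c' x" using 1(4)[of x] 2(4)[of x] by simp
    show "F x * G x = (real (a x * a' x + b x * b' x) - real (a x * b' x + b x * a' x)) / real (c x * c' x)"
      using 1(4)[of x] 2(4)[of x] by (simp add: 1(5) 2(5) field_simps)
  qed
qed

lemma recursive_real_divide_nat [recursive_intros]:
  assumes "recursive_real F" "recursive f" shows "recursive_real (\<lambda>x. F x / real (f x))"
proof -
  from assms(1) obtain a b c where 1: "recursive a" "recursive b" "recursive c" "\<And>x. 0 < c x"
    "\<And>x. F x = (real (a x) - real (b x)) / real (c x)" by (rule recursive_realE) blast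
  show ?thesis
  proof (rule recursive_realI)
    \<comment> \<open>Division by zero yields \<open>0\<close>, so the fraction \<open>0 / 1\<close>
      is substituted in that case.\<close>
    show "recursive (\<lambda>x. if f x = 0 then 0 else a x)" "recursive (\<lambda>x. if f x = 0 then 0 else b x)"
      "recursive (\<lambda>x. if f x = 0 then 1 else c x * f x)" by (intro recursive_intros 1 assms)+
    fix x show "0 < (if f x = 0 then 1 else c x * f x)" using 1(4)[of x] by simp
    show "F x / real (f x) = (real (if f x = 0 then 0 else a x) - real (if f x = 0 then 0 else b x)) /
      real (if f x = 0 then 1 else c x * f x)" by (simp add: 1(5))
  qed
qed

lemma recursive_real_divide_power [recursive_intros]:
  assumes "recursive_real F" "recursive f" shows "recursive_real (\<lambda>x. F x / numeral n ^ f x)"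
proof -
  have "recursive_real (\<lambda>x. F x / real (numeral n ^ f x))" by (intro recursive_intros assms)
  then show ?thesis by simp
qed

lemma recursive_real_divide_fact [recursive_intros]:
  assumes "recursive_real F" "recursive f" shows "recursive_real (\<lambda>x. F x / fact (f x))"
proof -
  have "recursive_real (\<lambda>x. F x / real (fact (f x)))" by (intro recursive_intros assms)
  then show ?thesis by simp
qed

lemma decidable_real_le [recursive_intros]:
  assumes "recursive_real F" "recursive_real G" shows "decidable (\<lambda>x. F x \<le> G x)"
proof -
  from recursive_real_diff[OF assms(2,1)] obtain a b c where
    1: "recursive a" "recursive b" "recursive c" "\<And>x. 0 < c x"
    "\<And>x. G x - F x = (real (a x) - real (b x)) / real (c x)" by (rule recursive_realE) blast
  have "decidable (\<lambda>x. b x \<le> a x)" by (intro recursive_intros 1)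
  moreover have "b x \<le> a x \<longleftrightarrow> F x \<le> G x" for x
  proof -
    have "b x \<le> a x \<longleftrightarrow> 0 \<le> (real (a x) - real (b x)) / real (c x)"
      using 1(4)[of x] by (simp add: zero_le_divide_iff)
    then show ?thesis unfolding 1(5)[symmetric] by simp
  qed
  ultimately show ?thesis by simp
qed

lemma decidable_real_less [recursive_intros]:
  assumes "recursive_real F" "recursive_real G" shows "decidable (\<lambda>x. F x < G x)"
  using decidable_not[OF decidable_real_le[OF assms(2,1)]] by (simp add: not_le)

lemma recursive_real_if [recursive_intros]:
  assumes "decidable P" "recursive_real F" "recursive_real G"
  shows "recursive_real (\<lambda>x. if P x then F x else G x)"
proof -
  have "recursive_real (\<lambda>x. real (of_bool (P x)) * F x + real (of_bool (\<not> P x)) * G x)"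
    by (intro recursive_intros assms)
  moreover have "real (of_bool (P x)) * F x + real (of_bool (\<not> P x)) * G x = (if P x then F x else G x)" for x
    by simp
  ultimately show ?thesis by simp
qed

lemma recursive_real_abs [recursive_intros]:
  assumes "recursive_real F" shows "recursive_real (\<lambda>x. \<bar>F x\<bar>)"
proof -
  have "recursive_real (\<lambda>x. if 0 \<le> F x then F x else - F x)" by (intro recursive_intros assms)
  moreover have "(if 0 \<le> F x then F x else - F x) = \<bar>F x\<bar>" for x by simp
  ultimately show ?thesis by simp
qed

lemma recursive_real_sum [recursive_intros]:
  assumes "recursive_real (\<lambda>z. F (pfst z) (psnd z))" "recursive h"
  shows "recursive_real (\<lambda>x. \<Sum>i<h x. F x i)"
proof -
  from assms(1) obtain a b c where 1: "recursive a" "recursive b" "recursive c" "\<And>x. 0 < c x"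
    "\<And>x. F (pfst x) (psnd x) = (real (a x) - real (b x)) / real (c x)" by (rule recursive_realE) blast
  have F: "F x i = (real (a (prod_encode (x, i))) - real (b (prod_encode (x, i)))) / real (c (prod_encode (x, i)))" for x i
    using 1(5)[of "prod_encode (x, i)"] by simp
  \<comment> \<open>A common denominator: each summand's own denominator divides it, so the
    numerators of the sum are finite sums of natural numbers.\<close>
  define p where "p x = (\<Prod>i<h x. c (prod_encode (x, i)))" for x
  have p: "recursive p" unfolding p_def
    by (intro recursive_intros assms recursive_compose[OF 1(3)])
  have p0: "0 < p x" for x unfolding p_def using 1(4) by (simp add: prod_pos)
  have pd: "real (p x div c (prod_encode (x, i))) = real (p x) / real (c (prod_encode (x, i)))"
    if "i < h x" for x i
    unfolding p_def using that by (intro real_of_nat_div dvd_prodI) auto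
  show ?thesis
  proof (rule recursive_realI)
    show "recursive (\<lambda>x. \<Sum>i<h x. a (prod_encode (x, i)) * (p x div c (prod_encode (x, i))))"
      "recursive (\<lambda>x. \<Sum>i<h x. b (prod_encode (x, i)) * (p x div c (prod_encode (x, i))))" "recursive p"
      by (intro recursive_intros assms recursive_compose[OF 1(1)] recursive_compose[OF 1(2)]
          recursive_compose[OF 1(3)] recursive_compose[OF p] p)+
    fix x show "0 < p x" by (rule p0)
    have "(\<Sum>i<h x. F x i) * real (p x) =
       (\<Sum>i<h x. (real (a (prod_encode (x, i))) - real (b (prod_encode (x, i)))) * real (p x div c (prod_encode (x, i))))"
      unfolding sum_distrib_right by (intro sum.cong refl) (simp add: pd F)
    also have "\<dots> = real (\<Sum>i<h x. a (prod_encode (x, i)) * (p x div c (prod_encode (x, i)))) -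
          real (\<Sum>i<h x. b (prod_encode (x, i)) * (p x div c (prod_encode (x, i))))"
      by (simp add: left_diff_distrib sum_subtractf)
    finally show "(\<Sum>i<h x. F x i) = (real (\<Sum>i<h x. a (prod_encode (x, i)) * (p x div c (prod_encode (x, i)))) -
          real (\<Sum>i<h x. b (prod_encode (x, i)) * (p x div c (prod_encode (x, i))))) / real (p x)"
      using p0[of x] by (simp add: nonzero_eq_divide_eq)
  qed
qed

lemma recursive_real_sin_coeff [recursive_intros]:
  assumes "recursive f" shows "recursive_real (\<lambda>x. sin_coeff (f x))"
proof -
  have "recursive_real (\<lambda>x. if even (f x) then 0 else
     (if even ((f x - 1) div 2) then 1 else - 1) / fact (f x))"
    by (intro recursive_intros assms)
  moreover have "(if even (f x) then 0 else (if even ((f x - 1) div 2) then 1 else - 1) / fact (f x)) =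
    sin_coeff (f x)" for x by (simp add: sin_coeff_def uminus_power_if)
  ultimately show ?thesis by simp
qed

lemma recursive_real_cos_coeff [recursive_intros]:
  assumes "recursive f" shows "recursive_real (\<lambda>x. cos_coeff (f x))"
proof -
  have "recursive_real (\<lambda>x. if even (f x) then (if even (f x div 2) then 1 else - 1) / fact (f x) else 0)"
    by (intro recursive_intros assms)
  moreover have "(if even (f x) then (if even (f x div 2) then 1 else - 1) / fact (f x) else 0) =
    cos_coeff (f x)" for x by (simp add: cos_coeff_def uminus_power_if)
  ultimately show ?thesis by simp
qed

section \<open>Canonical codes of fractions\<close>

text \<open>The reduced denominator is the least positive \<open>m\<close> for which
  \<open>m\<close> times the fraction is an integer, so a search replaces the computation of a gcd.
  With truncated subtraction, \<open>(a - b) + (b - a)\<close> is the absolute value of the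
  numerator; the conditional reproduces \<open>int_encode\<close> on its sign.\<close>

lemma rat_enc_fraction:
  fixes a b c :: nat
  assumes c: "0 < c"
  defines "m \<equiv> LEAST m. 0 < m \<and> c dvd ((a - b) + (b - a)) * m"
  shows "rat_enc (of_int (int a - int b) / of_int (int c)) = prod_encode
     (if a < b then Suc (2 * ((((a - b) + (b - a)) * m) div c - 1)) else 2 * ((((a - b) + (b - a)) * m) div c), m)"
proof -
  define r :: rat where "r = of_int (int a - int b) / of_int (int c)"
  define p where "p = int a - int b"
  define A where "A = (a - b) + (b - a)"
  have A: "int A = \<bar>p\<bar>" by (auto simp: A_def p_def)
  obtain n d where q: "quotient_of r = (n, d)" by (meson surj_pair)
  have d: "d > 0" and cop: "coprime n d" and r: "r = of_int n / of_int d"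
    using quotient_of_denom_pos[OF q] quotient_of_coprime[OF q] quotient_of_div[OF q] by auto
  have "(of_int p :: rat) * of_int d = of_int n * of_int c"
    using r c d unfolding r_def p_def by (simp add: field_simps)
  then have eq: "p * d = n * int c"
    by (metis of_int_eq_iff of_int_mult of_int_of_nat_eq)
  have eqA: "A * nat d = nat \<bar>n\<bar> * c"
  proof -
    have "int (A * nat d) = \<bar>p * d\<bar>" using A d by (simp add: abs_mult)
    also have "\<dots> = int (nat \<bar>n\<bar> * c)" unfolding eq by (simp add: abs_mult)
    finally show ?thesis using of_nat_eq_iff by blast
  qed
  have m: "m = nat d" unfolding m_def A_def[symmetric]
  proof (rule Least_equality)
    show "0 < nat d \<and> c dvd A * nat d" using d by (simp add: eqA)
    fix k assume k: "0 < k \<and> c dvd A * k"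
    have "int (A * k) = \<bar>p * int k\<bar>" by (simp add: A abs_mult)
    moreover have "int c dvd int (A * k)" using k by (simp only: int_dvd_int_iff)
    ultimately have "int c dvd p * int k" by (metis dvd_abs_iff)
    then obtain e where e: "p * int k = int c * e" by (auto elim: dvdE)
    have "int c * (n * int k) = int c * (e * d)"
      using eq e by (metis mult.assoc mult.commute)
    then have "n * int k = e * d" using c by simp
    then have "d dvd n * int k" by simp
    then have "d dvd int k" using cop by (simp add: coprime_commute coprime_dvd_mult_right_iff)
    then show "nat d \<le> k" using k d by (meson nat_le_iff of_nat_0_less_iff zdvd_imp_le)
  qed
  have "A * m div c = nat \<bar>n\<bar>" using eqA c m by simp
  moreover have "a < b \<longleftrightarrow> n < 0"
  proof -
    have "a < b \<longleftrightarrow> p * d < 0" using d by (simp add: p_def mult_less_0_iff)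
    also have "\<dots> \<longleftrightarrow> n < 0" unfolding eq using c by (simp add: mult_less_0_iff)
    finally show ?thesis .
  qed
  moreover have "rat_enc r = prod_encode (int_encode n, m)" by (simp add: rat_enc_def q m)
  ultimately have "rat_enc r = prod_encode
     (if a < b then Suc (2 * ((A * m) div c - 1)) else 2 * ((A * m) div c), m)"
    by (auto simp: int_encode_def sum_encode_def nat_diff_distrib)
  then show ?thesis unfolding r_def A_def .
qed

lemma recursive_real_rat_enc:
  assumes "recursive_real F"
  obtains G where "\<And>x. of_rat (G x) = F x" "recursive (\<lambda>x. rat_enc (G x))"
proof -
  from assms obtain a b c where 1: "recursive a" "recursive b" "recursive c" "\<And>x. 0 < c x"
    "\<And>x. F x = (real (a x) - real (b x)) / real (c x)" by (rule recursive_realE) blast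
  define G :: "nat \<Rightarrow> rat" where "G x = of_int (int (a x) - int (b x)) / of_int (int (c x))" for x
  define m where "m x = (LEAST m. 0 < m \<and> c x dvd ((a x - b x) + (b x - a x)) * m)" for x
  note cmp = recursive_compose[OF 1(1)] recursive_compose[OF 1(2)] recursive_compose[OF 1(3)]
  have m: "recursive m" unfolding m_def
  proof (intro recursive_Least recursive_intros cmp)
    show "\<exists>m>0. c x dvd ((a x - b x) + (b x - a x)) * m" for x
      using 1(4)[of x] by (intro exI[of _ "c x"]) auto
  qed
  have "recursive (\<lambda>x. rat_enc (G x))"
    unfolding G_def rat_enc_fraction[OF 1(4)] m_def[symmetric]
    by (intro recursive_intros 1 m)
  moreover have "of_rat (G x) = F x" for x
    by (simp add: G_def 1(5) of_rat_divide of_rat_diff)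
  ultimately show ?thesis by (rule that[rotated])
qed

text \<open>Serves to read the rational approximations of the measures that come with a Schnorr
  test.\<close>

lemma recursive_real_of_rat_enc:
  assumes "recursive (\<lambda>x. rat_enc (q x))"
  shows "recursive_real (\<lambda>x. of_rat (q x))"
proof -
  let ?n = "\<lambda>x. pfst (rat_enc (q x))" and ?d = "\<lambda>x. psnd (rat_enc (q x))"
  have n: "recursive ?n" and d: "recursive ?d" by (intro recursive_intros assms)+
  have "recursive_real (\<lambda>x. (if even (?n x) then real (?n x div 2) else - real (Suc (?n x div 2))) / real (?d x))"
    by (intro recursive_intros n d)
  moreover have "(if even (?n x) then real (?n x div 2) else - real (Suc (?n x div 2))) / real (?d x)
      = of_rat (q x)" for x
  proof -
    obtain n d where q: "quotient_of (q x) = (n, d)" by (meson surj_pair)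
    have d: "d > 0" and r: "q x = of_int n / of_int d"
      using quotient_of_denom_pos[OF q] quotient_of_div[OF q] by auto
    have "rat_enc (q x) = prod_encode (int_encode n, nat d)" by (simp add: rat_enc_def q)
    moreover have "of_rat (q x) = real_of_int n / real_of_int d" by (simp add: r of_rat_divide)
    ultimately show ?thesis using d
      by (auto simp: int_encode_def sum_encode_def)
  qed
  ultimately show ?thesis by simp
qed

section \<open>Semidecidable sets\<close>

text \<open>\<open>F (x, s)\<close> is \<open>0\<close> if \<open>P\<close> has not halted on \<open>x\<close> by stage \<open>s\<close>, and \<open>Suc\<close> of the output afterwards.\<close>

definition stage_function :: "(nat \<Rightarrow> nat) \<Rightarrow> (nat \<Rightarrow> nat option) \<Rightarrow> bool" where
  "stage_function F P \<longleftrightarrow> recursive F \<and>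
    (\<forall>x s s' y. F (prod_encode (x, s)) = Suc y \<longrightarrow> s \<le> s' \<longrightarrow> F (prod_encode (x, s')) = Suc y) \<and>
    (\<forall>x y. P x = Some y \<longleftrightarrow> (\<exists>s. F (prod_encode (x, s)) = Suc y))"

lemma stage_functionD:
  assumes "stage_function F P"
  shows "recursive F"
    "\<And>x s s' y. F (prod_encode (x, s)) = Suc y \<Longrightarrow> s \<le> s' \<Longrightarrow> F (prod_encode (x, s')) = Suc y"
    "\<And>x y. P x = Some y \<longleftrightarrow> (\<exists>s. F (prod_encode (x, s)) = Suc y)"
  using assms unfolding stage_function_def by blast+

text \<open>Dovetailing without a universal machine: by induction over the construction of
  \<open>P\<close>, all constituent computations are run up to one common stage. Found values
  persist, so computations that halt by stages \<open>s\<close> and \<open>t\<close> have both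
  halted by \<open>max s t\<close>.\<close>

lemma partial_recursive_stages:
  assumes "partial_recursive P"
  obtains F where "recursive F"
    "\<And>x s s' y. F (prod_encode (x, s)) = Suc y \<Longrightarrow> s \<le> s' \<Longrightarrow> F (prod_encode (x, s')) = Suc y"
    "\<And>x y. P x = Some y \<longleftrightarrow> (\<exists>s. F (prod_encode (x, s)) = Suc y)"
proof -
  have total: "\<exists>F. stage_function F (\<lambda>x. Some (g x))"
    if "recursive g" for g
    by (rule exI[of _ "\<lambda>z. Suc (g (pfst z))"])
      (auto simp: stage_function_def intro!: recursive_intros recursive_compose[OF that])
  from assms have "\<exists>F. stage_function F P"
  proof induction
    case zero
    show ?case by (rule total) (intro recursive_intros)
  next
    case succ
    show ?case by (rule total) (intro recursive_intros)
  next
    case left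
    show ?case by (rule total) (intro recursive_intros)
  next
    case right
    show ?case by (rule total) (intro recursive_intros)
  next
    case (pair f g)
    then obtain F G where FG: "stage_function F f" "stage_function G g" by blast
    note F = stage_functionD[OF FG(1)] and G = stage_functionD[OF FG(2)]
    define H where "H z = (if F z = 0 \<or> G z = 0 then 0 else Suc (prod_encode (F z - 1, G z - 1)))" for z
    have "recursive H" unfolding H_def by (intro recursive_intros F G)
    moreover have H: "H z = Suc y \<longleftrightarrow> (\<exists>a b. F z = Suc a \<and> G z = Suc b \<and> y = prod_encode (a, b))" for z y
      unfolding H_def by (cases "F z"; cases "G z") auto
    moreover have "(\<exists>s. H (prod_encode (x, s)) = Suc y) \<longleftrightarrow>
       (\<exists>a b. f x = Some a \<and> g x = Some b \<and> y = prod_encode (a, b))" for x y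
    proof
      assume "\<exists>s. H (prod_encode (x, s)) = Suc y"
      then show "\<exists>a b. f x = Some a \<and> g x = Some b \<and> y = prod_encode (a, b)"
        unfolding H F(3) G(3) by blast
    next
      assume "\<exists>a b. f x = Some a \<and> g x = Some b \<and> y = prod_encode (a, b)"
      then obtain a b s t where "F (prod_encode (x, s)) = Suc a" "G (prod_encode (x, t)) = Suc b"
        "y = prod_encode (a, b)" unfolding F(3) G(3) by blast
      then have "H (prod_encode (x, max s t)) = Suc y" unfolding H
        using F(2)[of x s a "max s t"] G(2)[of x t b "max s t"] by auto
      then show "\<exists>s. H (prod_encode (x, s)) = Suc y" ..
    qed
    moreover have "H (prod_encode (x, s)) = Suc y \<Longrightarrow> s \<le> s' \<Longrightarrow> H (prod_encode (x, s')) = Suc y" for x s s' y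
      unfolding H using F(2) G(2) by blast
    moreover have "Option.bind (f x) (\<lambda>u. Option.bind (g x) (\<lambda>v. Some (prod_encode (u, v)))) = Some y
       \<longleftrightarrow> (\<exists>a b. f x = Some a \<and> g x = Some b \<and> y = prod_encode (a, b))" for x y
      by (auto simp: bind_eq_Some_conv)
    ultimately show ?case unfolding stage_function_def by (intro exI[of _ H] conjI allI impI) simp_all
  next
    case (comp f g)
    then obtain F G where FG: "stage_function F f" "stage_function G g" by blast
    note F = stage_functionD[OF FG(1)] and G = stage_functionD[OF FG(2)]
    define H where "H z = (if G z = 0 then 0 else F (prod_encode (G z - 1, psnd z)))" for z
    have recH: "recursive H" unfolding H_def by (intro recursive_intros recursive_compose[OF F(1)] G)
    have H: "H (prod_encode (x, s)) = Suc y \<longleftrightarrow>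
       (\<exists>a. G (prod_encode (x, s)) = Suc a \<and> F (prod_encode (a, s)) = Suc y)" for x s y
      unfolding H_def by (cases "G (prod_encode (x, s))") auto
    have exH: "(\<exists>s. H (prod_encode (x, s)) = Suc y) \<longleftrightarrow> (\<exists>a. g x = Some a \<and> f a = Some y)" for x y
    proof
      assume "\<exists>s. H (prod_encode (x, s)) = Suc y"
      then show "\<exists>a. g x = Some a \<and> f a = Some y" unfolding H F(3) G(3) by blast
    next
      assume "\<exists>a. g x = Some a \<and> f a = Some y"
      then obtain a s t where "G (prod_encode (x, s)) = Suc a" "F (prod_encode (a, t)) = Suc y"
        unfolding F(3) G(3) by blast
      then have "H (prod_encode (x, max s t)) = Suc y" unfolding H
        using G(2)[of x s a "max s t"] F(2)[of a t y "max s t"] by auto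
      then show "\<exists>s. H (prod_encode (x, s)) = Suc y" ..
    qed
    have monoH: "H (prod_encode (x, s)) = Suc y \<Longrightarrow> s \<le> s' \<Longrightarrow> H (prod_encode (x, s')) = Suc y" for x s s' y
      unfolding H by (elim exE conjE, rule exI, rule conjI, erule (1) G(2), erule (1) F(2))
    have bind: "Option.bind (g x) f = Some y \<longleftrightarrow> (\<exists>a. g x = Some a \<and> f a = Some y)" for x y
      by (auto simp: bind_eq_Some_conv)
    show ?case unfolding stage_function_def bind exH[symmetric] using recH monoH
      by (intro exI[of _ H]) blast
  next
    case (prec f g)
    then obtain F G where FG: "stage_function F f" "stage_function G g" by blast
    note F = stage_functionD[OF FG(1)] and G = stage_functionD[OF FG(2)]
    \<comment> \<open>All steps of the recursion use the same stage \<open>s\<close>. The value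
      \<open>0\<close> marks a pending earlier step and is passed on; \<open>r - 1\<close> strips
      the \<open>Suc\<close> from a finished one.\<close>
    define h where "h a s = rec_nat (F (prod_encode (a, s)))
       (\<lambda>i r. if r = 0 then 0 else G (prod_encode (prod_encode (a, prod_encode (i, r - 1)), s)))" for a s
    define H where "H z = h (pfst (pfst z)) (psnd z) (psnd (pfst z))" for z
    have recH: "recursive H" unfolding H_def h_def
      by (intro recursive_rec_nat recursive_intros recursive_compose[OF F(1)] recursive_compose[OF G(1)])
    have h0: "h a s 0 = F (prod_encode (a, s))" for a s by (simp add: h_def)
    have hS: "h a s (Suc k) = Suc y \<longleftrightarrow>
        (\<exists>r. h a s k = Suc r \<and> G (prod_encode (prod_encode (a, prod_encode (k, r)), s)) = Suc y)" for a s k y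
      unfolding h_def by (cases "h a s k") (auto simp: h_def)
    have mono: "h a s k = Suc y \<Longrightarrow> s \<le> s' \<Longrightarrow> h a s' k = Suc y" for a s s' k y
    proof (induction k arbitrary: y)
      case 0 then show ?case unfolding h0 by (rule F(2))
    next
      case (Suc k)
      from Suc.prems show ?case unfolding hS
        by (elim exE conjE) (rule exI, rule conjI, erule (1) Suc.IH, erule (1) G(2))
    qed
    have prim: "primitive_recursion f g a k = Some y \<longleftrightarrow> (\<exists>s. h a s k = Suc y)" for a k y
    proof (induction k arbitrary: y)
      case 0 then show ?case by (simp add: h0 F(3))
    next
      case (Suc k)
      have "primitive_recursion f g a (Suc k) = Some y \<longleftrightarrow>
        (\<exists>r s t. h a s k = Suc r \<and> G (prod_encode (prod_encode (a, prod_encode (k, r)), t)) = Suc y)"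
        by (auto simp: bind_eq_Some_conv Suc.IH G(3))
      also have "\<dots> \<longleftrightarrow> (\<exists>s. h a s (Suc k) = Suc y)" (is "?L \<longleftrightarrow> ?R")
      proof
        assume ?L
        then obtain r s t where st: "h a s k = Suc r"
          "G (prod_encode (prod_encode (a, prod_encode (k, r)), t)) = Suc y" by blast
        have "h a (max s t) (Suc k) = Suc y" unfolding hS
          by (intro exI[of _ r] conjI mono[OF st(1)] G(2)[OF st(2)]) simp_all
        then show ?R ..
      qed (auto simp: hS)
      finally show ?case .
    qed
    have H: "H (prod_encode (x, s)) = h (pfst x) s (psnd x)" for x s by (simp add: H_def)
    show ?case unfolding stage_function_def H
      by (intro exI[of _ H] conjI recH allI impI, unfold H)
         (erule (1) mono, simp only: case_prod_beta prim)
  next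
    case (mini f)
    then obtain F where "stage_function F f" by blast
    note F = stage_functionD[OF this]
    \<comment> \<open>The value \<open>1\<close> stands for the output \<open>0\<close>, and larger
      values stand for positive outputs. So by stage \<open>s\<close> the number \<open>n\<close> is
      known to be the first zero, with no earlier value pending.\<close>
    define C where "C a s n \<longleftrightarrow> F (prod_encode (prod_encode (a, n), s)) = 1 \<and>
       (\<forall>m<n. 1 < F (prod_encode (prod_encode (a, m), s)))" for a s n
    \<comment> \<open>At most one \<open>n\<close> satisfies \<open>C\<close>, so the sum is
      \<open>Suc n\<close> for this \<open>n\<close>, or \<open>0\<close>. Bounding \<open>n\<close>
      by the stage keeps the search finite.\<close>
    define H where "H z = (\<Sum>n<psnd z. of_bool (C (pfst z) (psnd z) n) * Suc n)" for z
    have recH: "recursive H" unfolding H_def C_def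
      by (intro recursive_intros recursive_compose[OF F(1)])
    have H: "H (prod_encode (a, s)) = Suc y \<longleftrightarrow> y < s \<and> C a s y" for a s y
    proof -
      have uniq: "n = n'" if "C a s n" "C a s n'" for n n'
        using that unfolding C_def by (metis less_irrefl linorder_neqE_nat)
      have val: "H (prod_encode (a, s)) = Suc n" if "n < s" "C a s n" for n
      proof -
        have "of_bool (C a s m) * Suc m = (if m = n then Suc n else 0)" for m
          using that(2) uniq[of m n] by (cases "C a s m") auto
        then have "H (prod_encode (a, s)) = (\<Sum>m<s. if m = n then Suc n else 0)"
          unfolding H_def by simp
        then show ?thesis using that by simp
      qed
      have "\<exists>n<s. C a s n" if "H (prod_encode (a, s)) \<noteq> 0"
        using that unfolding H_def by (auto simp: sum.neutral)
      then show ?thesis using val by (metis nat.inject nat.simps(3))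
    qed
    have mono: "C a s y \<Longrightarrow> s \<le> s' \<Longrightarrow> C a s' y" for a s s' y
    proof -
      assume C: "C a s y" and le: "s \<le> s'"
      have keep: "F (prod_encode (x, s')) = F (prod_encode (x, s))" if "0 < F (prod_encode (x, s))" for x
      proof -
        from that obtain v where v: "F (prod_encode (x, s)) = Suc v" by (auto simp: gr0_conv_Suc)
        show ?thesis using F(2)[OF v le] v by simp
      qed
      have "F (prod_encode (prod_encode (a, y), s')) = 1" using C keep[of "prod_encode (a, y)"] by (simp add: C_def)
      moreover have "1 < F (prod_encode (prod_encode (a, m), s'))" if "m < y" for m
        using C keep[of "prod_encode (a, m)"] that by (auto simp: C_def)
      ultimately show ?thesis by (simp add: C_def)
    qed
    have mini: "minimization f a = Some y \<longleftrightarrow> (\<exists>s. y < s \<and> C a s y)" for a y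
    proof -
      have *: "minimization f a = Some y \<longleftrightarrow>
         f (prod_encode (a, y)) = Some 0 \<and> (\<forall>m<y. \<exists>v. f (prod_encode (a, m)) = Some (Suc v))" (is "_ \<longleftrightarrow> ?R")
      proof
        assume "minimization f a = Some y"
        then have ex: "\<exists>n. f (prod_encode (a, n)) = Some 0 \<and> (\<forall>m<n. f (prod_encode (a, m)) \<noteq> None)"
          and y: "y = (LEAST n. f (prod_encode (a, n)) = Some 0)"
          by (auto simp: minimization_def split: if_splits)
        from ex obtain n where n: "f (prod_encode (a, n)) = Some 0" "\<forall>m<n. f (prod_encode (a, m)) \<noteq> None" by blast
        have "f (prod_encode (a, y)) = Some 0" unfolding y using n(1) by (rule LeastI)
        moreover have "y \<le> n" unfolding y using n(1) by (rule Least_le)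
        moreover have "\<forall>m<y. f (prod_encode (a, m)) \<noteq> Some 0" unfolding y using not_less_Least by blast
        ultimately show ?R using n(2) by (metis not0_implies_Suc option.exhaust order_less_le_trans)
      next
        assume R: ?R
        have "(LEAST n. f (prod_encode (a, n)) = Some 0) = y"
        proof (rule Least_equality)
          fix n assume n: "f (prod_encode (a, n)) = Some 0"
          show "y \<le> n"
          proof (rule ccontr)
            assume "\<not> y \<le> n"
            then have "n < y" by simp
            with R n show False by fastforce
          qed
        qed (use R in auto)
        moreover have "\<forall>m<y. f (prod_encode (a, m)) \<noteq> None" using R by auto
        ultimately show "minimization f a = Some y" using R unfolding minimization_def by auto
      qed
      show ?thesis
      proof
        assume "minimization f a = Some y"
        then have R: ?R using * by blast
        then obtain s0 where s0: "F (prod_encode (prod_encode (a, y), s0)) = Suc 0" using F(3) by blast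
        from R have "\<forall>m<y. \<exists>s v. F (prod_encode (prod_encode (a, m), s)) = Suc (Suc v)" using F(3) by blast
        then obtain sf vf where sf: "\<And>m. m < y \<Longrightarrow> F (prod_encode (prod_encode (a, m), sf m)) = Suc (Suc (vf m))" by metis
        \<comment> \<open>A stage by which all the computations for arguments up to \<open>y\<close>
          have halted; the last summand makes it exceed \<open>y\<close>.\<close>
        define s where "s = s0 + (\<Sum>m<y. sf m) + Suc y"
        have "sf m \<le> s" if "m < y" for m
          using member_le_sum[of m "{..<y}" sf] that unfolding s_def by simp
        then have "F (prod_encode (prod_encode (a, m), s)) = Suc (Suc (vf m))" if "m < y" for m
          using F(2)[OF sf] that by blast
        moreover have "F (prod_encode (prod_encode (a, y), s)) = Suc 0"
          by (rule F(2)[OF s0]) (simp add: s_def)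
        ultimately have "C a s y" unfolding C_def by simp
        then show "\<exists>s. y < s \<and> C a s y" by (intro exI[of _ s]) (simp add: s_def)
      next
        assume "\<exists>s. y < s \<and> C a s y"
        then obtain s where C: "C a s y" by blast
        have "\<exists>v. f (prod_encode (a, m)) = Some (Suc v)" if "m < y" for m
        proof -
          have "1 < F (prod_encode (prod_encode (a, m), s))" using C that by (auto simp: C_def)
          then have "F (prod_encode (prod_encode (a, m), s)) = Suc (Suc (F (prod_encode (prod_encode (a, m), s)) - 2))" by simp
          then show ?thesis using F(3) by blast
        qed
        moreover have "f (prod_encode (a, y)) = Some 0" using C F(3) by (auto simp: C_def)
        ultimately show "minimization f a = Some y" using * by blast
      qed
    qed
    show ?case unfolding stage_function_def
      by (intro exI[of _ H] conjI recH allI impI, unfold H)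
         (elim conjE, rule conjI, erule (1) less_le_trans, erule (1) mono, simp only: mini)
  qed
  then obtain F where "stage_function F P" ..
  from that[OF stage_functionD[OF this]] show ?thesis .
qed

lemma computably_enumerable_stages:
  assumes "computably_enumerable e A"
  obtains T where "decidable T"
    "\<And>x s s'. T (prod_encode (x, s)) \<Longrightarrow> s \<le> s' \<Longrightarrow> T (prod_encode (x, s'))"
    "\<And>x. x \<in> A \<longleftrightarrow> (\<exists>s. T (prod_encode (e x, s)))"
proof -
  from assms obtain P where P: "partial_recursive P" "\<And>x. x \<in> A \<longleftrightarrow> P (e x) \<noteq> None"
    unfolding computably_enumerable_def by blast
  from P(1) obtain F where F: "recursive F"
    "\<And>x s s' y. F (prod_encode (x, s)) = Suc y \<Longrightarrow> s \<le> s' \<Longrightarrow> F (prod_encode (x, s')) = Suc y"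
    "\<And>x y. P x = Some y \<longleftrightarrow> (\<exists>s. F (prod_encode (x, s)) = Suc y)"
    by (rule partial_recursive_stages) blast
  show ?thesis
  proof
    show "decidable (\<lambda>z. 0 < F z)" by (intro recursive_intros F)
    show "0 < F (prod_encode (x, s')) " if "0 < F (prod_encode (x, s))" "s \<le> s'" for x s s'
    proof -
      from that(1) obtain v where "F (prod_encode (x, s)) = Suc v" by (auto simp: gr0_conv_Suc)
      from F(2)[OF this that(2)] show ?thesis by simp
    qed
    show "x \<in> A \<longleftrightarrow> (\<exists>s. 0 < F (prod_encode (e x, s)))" for x
      unfolding P(2) by (metis F(3) gr0_conv_Suc not_None_eq)
  qed
qed

section \<open>Computable functions from enumerated rectangles\<close>

lemma rectangle_set_subset_ball:
  assumes "z \<in> rectangle_set (a, b, c, d)" "of_rat b - of_rat a < e / 2" "of_rat d - of_rat c < e / 2"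
  shows "rectangle_set (a, b, c, d) \<subseteq> ball z e"
proof
  fix y assume "y \<in> rectangle_set (a, b, c, d)"
  then have "\<bar>Re (z - y)\<bar> < e / 2" "\<bar>Im (z - y)\<bar> < e / 2"
    unfolding abs_less_iff using assms by auto
  then show "y \<in> ball z e" using cmod_le[of "z - y"] by (simp add: dist_norm)
qed

text \<open>
  The algorithm searches for the index of its input in the first sequence and answers with the second.
  Injectivity of \<open>d\<close> makes this index unique.
\<close>

lemma computable_onI:
  fixes a b c d a' b' c' d' :: "nat \<Rightarrow> real"
  assumes rec: "recursive_real a" "recursive_real b" "recursive_real c" "recursive_real d"
      "recursive_real a'" "recursive_real b'" "recursive_real c'" "recursive_real d'"
    and less: "\<And>w. a w < b w" "\<And>w. c w < d w" "\<And>w. a' w < b' w" "\<And>w. c' w < d' w"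
    and inj: "inj d"
    and correct: "\<And>w z. z \<in> D \<Longrightarrow> Re z \<in> {a w<..<b w} \<Longrightarrow> Im z \<in> {c w<..<d w} \<Longrightarrow>
        Re (f z) \<in> {a' w<..<b' w} \<and> Im (f z) \<in> {c' w<..<d' w}"
    and convergence: "\<And>z e. z \<in> D \<Longrightarrow> 0 < e \<Longrightarrow> \<exists>w. Re z \<in> {a w<..<b w} \<and> Im z \<in> {c w<..<d w} \<and>
        b w - a w < e \<and> d w - c w < e \<and> b' w - a' w < e \<and> d' w - c' w < e"
  shows "computable_on D f"
proof -
  obtain A where A: "\<And>w. of_rat (A w) = a w" "recursive (\<lambda>w. rat_enc (A w))" using rec(1) by (rule recursive_real_rat_enc) blast
  obtain B where B: "\<And>w. of_rat (B w) = b w" "recursive (\<lambda>w. rat_enc (B w))" using rec(2) by (rule recursive_real_rat_enc) blast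
  obtain C where C: "\<And>w. of_rat (C w) = c w" "recursive (\<lambda>w. rat_enc (C w))" using rec(3) by (rule recursive_real_rat_enc) blast
  obtain E where E: "\<And>w. of_rat (E w) = d w" "recursive (\<lambda>w. rat_enc (E w))" using rec(4) by (rule recursive_real_rat_enc) blast
  obtain A' where A': "\<And>w. of_rat (A' w) = a' w" "recursive (\<lambda>w. rat_enc (A' w))" using rec(5) by (rule recursive_real_rat_enc) blast
  obtain B' where B': "\<And>w. of_rat (B' w) = b' w" "recursive (\<lambda>w. rat_enc (B' w))" using rec(6) by (rule recursive_real_rat_enc) blast
  obtain C' where C': "\<And>w. of_rat (C' w) = c' w" "recursive (\<lambda>w. rat_enc (C' w))" using rec(7) by (rule recursive_real_rat_enc) blast
  obtain E' where E': "\<And>w. of_rat (E' w) = d' w" "recursive (\<lambda>w. rat_enc (E' w))" using rec(8) by (rule recursive_real_rat_enc) blast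
  define R where "R w = (A w, B w, C w, E w)" for w
  define R' where "R' w = (A' w, B' w, C' w, E' w)" for w
  have encR: "recursive (\<lambda>w. rectangle_enc (R w))"
    unfolding rectangle_enc_def R_def prod_enc_def by (simp add: A B C E recursive_intros)
  have encR': "recursive (\<lambda>w. rectangle_enc (R' w))"
    unfolding rectangle_enc_def R'_def prod_enc_def by (simp add: A' B' C' E' recursive_intros)
  have inj_enc: "inj rectangle_enc"
    unfolding rectangle_enc_def by (intro inj_prod_enc inj_rat_enc)
  have injR: "R w = R v \<Longrightarrow> w = v" for w v
    using inj E(1) unfolding R_def inj_def by (metis prod.inject)
  have R: "z \<in> rectangle_set (R w) \<longleftrightarrow> Re z \<in> {a w<..<b w} \<and> Im z \<in> {c w<..<d w}" for z w
    by (auto simp: R_def A B C E)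
  have R': "z \<in> rectangle_set (R' w) \<longleftrightarrow> Re z \<in> {a' w<..<b' w} \<and> Im z \<in> {c' w<..<d' w}" for z w
    by (auto simp: R'_def A' B' C' E')
  have rectR: "is_rectangle (R w)" for w
  proof -
    have "real_of_rat (A w) < of_rat (B w)" "real_of_rat (C w) < of_rat (E w)"
      using less(1,2)[of w] by (simp_all add: A B C E)
    then show ?thesis by (simp add: R_def of_rat_less)
  qed
  have rectR': "is_rectangle (R' w)" for w
  proof -
    have "real_of_rat (A' w) < of_rat (B' w)" "real_of_rat (C' w) < of_rat (E' w)"
      using less(3,4)[of w] by (simp_all add: A' B' C' E')
    then show ?thesis by (simp add: R'_def of_rat_less)
  qed
  define P where "P r = (if \<exists>w. R w = r then Some (R' (THE w. R w = r)) else None)" for r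
  have P: "P r = Some r' \<longleftrightarrow> (\<exists>w. r = R w \<and> r' = R' w)" for r r'
  proof -
    have "(THE w. R w = R v) = v" for v by (rule the_equality) (auto intro: injR)
    then show ?thesis by (auto simp: P_def)
  qed
  have computable: "computable_partial rectangle_enc rectangle_enc P"
    unfolding computable_partial_def
  proof (intro exI conjI allI)
    let ?t = "\<lambda>z. if rectangle_enc (R (psnd z)) = pfst z then 0 else 1 :: nat"
    let ?S = "\<lambda>x. Option.bind (minimization (\<lambda>z. Some (?t z)) x) (\<lambda>w. Some (rectangle_enc (R' w)))"
    have "recursive ?t" by (intro recursive_intros recursive_compose[OF encR])
    then show "partial_recursive ?S"
      using encR' unfolding recursive_def by (intro partial_recursive.comp partial_recursive.mini)
    fix r
    have eq: "rectangle_enc (R w) = rectangle_enc r \<longleftrightarrow> R w = r" for w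
      using inj_enc by (simp add: inj_eq)
    have min: "minimization (\<lambda>z. Some (?t z)) (rectangle_enc r) =
       (if \<exists>w. R w = r then Some (LEAST w. R w = r) else None)"
      by (simp add: minimization_def eq)
    show "?S (rectangle_enc r) = map_option rectangle_enc (P r)"
    proof (cases "\<exists>w. R w = r")
      case True
      then obtain w where w: "R w = r" by blast
      have "(LEAST w. R w = r) = w"
        by (rule Least_equality) (use w injR in auto)
      moreover have "(THE w. R w = r) = w" by (rule the_equality) (use w injR in auto)
      ultimately show ?thesis using w by (simp add: min P_def)
    qed (simp add: min P_def)
  qed
  have near: "\<exists>r r'. is_rectangle r \<and> z \<in> rectangle_set r \<and> rectangle_set r \<subseteq> U \<and>
              P r = Some r' \<and> rectangle_set r' \<subseteq> V"
    if z: "z \<in> D" and UV: "open U" "z \<in> U" "open V" "f z \<in> V" for z U V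
  proof -
    obtain e1 where e1: "e1 > 0" "ball z e1 \<subseteq> U" using UV open_contains_ball by blast
    obtain e2 where e2: "e2 > 0" "ball (f z) e2 \<subseteq> V" using UV open_contains_ball by blast
    obtain w where w: "Re z \<in> {a w<..<b w}" "Im z \<in> {c w<..<d w}"
        "b w - a w < min e1 e2 / 2" "d w - c w < min e1 e2 / 2"
        "b' w - a' w < min e1 e2 / 2" "d' w - c' w < min e1 e2 / 2"
      using convergence[OF z, of "min e1 e2 / 2"] e1 e2 by auto
    have zR: "z \<in> rectangle_set (R w)" and fR: "f z \<in> rectangle_set (R' w)"
      unfolding R R' using w(1,2) correct[OF z w(1,2)] by blast+
    have "rectangle_set (R w) \<subseteq> ball z e1"
      using zR w(3,4) unfolding R_def
      by (intro rectangle_set_subset_ball) (auto simp: A B C E)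
    moreover have "rectangle_set (R' w) \<subseteq> ball (f z) e2"
      using fR w(5,6) unfolding R'_def
      by (intro rectangle_set_subset_ball) (auto simp: A' B' C' E')
    ultimately show ?thesis using e1 e2 rectR zR
      by (intro exI[of _ "R w"] exI[of _ "R' w"]) (auto simp: P)
  qed
  have corr: "f z \<in> rectangle_set r'" if "P r = Some r'" "z \<in> rectangle_set r \<inter> D" for r r' z
    using that correct by (auto simp: P R R')
  have rect: "is_rectangle r'" if "P r = Some r'" for r r'
    using that rectR' by (auto simp: P)
  show ?thesis
    unfolding computable_on_def
    by (intro exI[of _ P] conjI allI ballI impI computable)
       (erule rect, erule (1) corr, erule (4) near)
qed

section \<open>Trigonometric polynomials with a large conjugate\<close>

text \<open>The estimate depends on the majorant only, which makes the truncation errors below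
  uniform in the real variable.\<close>

lemma sums_partial_bound:
  fixes f :: "nat \<Rightarrow> 'a :: banach" and g :: "nat \<Rightarrow> real"
  assumes "f sums s" "summable g" "\<And>n. norm (f n) \<le> g n"
  shows "norm (s - (\<Sum>n<d. f n)) \<le> (\<Sum>n. g (n + d))"
proof -
  have g: "summable (\<lambda>n. g (n + d))" using assms(2) by (rule summable_ignore_initial_segment)
  have "(\<lambda>n. f (n + d)) sums (s - (\<Sum>n<d. f n))" using assms(1) by (simp add: sums_iff_shift)
  then have "s - (\<Sum>n<d. f n) = (\<Sum>n. f (n + d))" by (simp add: sums_iff)
  then show ?thesis using norm_suminf_le[of "\<lambda>n. f (n + d)" "\<lambda>n. g (n + d)"] assms(3) g by simp
qed

text \<open>Since \<open>Re (1 / w)\<close> equals \<open>Re w / cmod w ^ 2\<close>, the worst case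
  is \<open>l / (2 * l) ^ 2\<close>. It will be applied to the denominators of \<open>\<psi>\<close>
  at points within \<open>l\<close> of \<open>T\<close>.\<close>

lemma Re_inverse_ge:
  fixes w :: complex
  assumes "l \<le> Re w" "cmod w \<le> 2 * l" "0 < l"
  shows "1 / (4 * l) \<le> Re (1 / w)"
proof -
  have w: "cmod w > 0" using assms by auto
  have "1 / (4 * l) = l / (2 * l)\<^sup>2" using assms by (simp add: power2_eq_square)
  also have "\<dots> \<le> Re w / (cmod w)\<^sup>2"
    using assms w by (intro frac_le power_mono zero_less_power) linarith+
  also have "\<dots> = Re (1 / w)"
    by (simp add: Re_divide cmod_power2)
  finally show ?thesis .
qed

lemma conjugate_large_on_intervals:
  fixes T :: "real set" and l \<delta> e :: real
  assumes T: "finite T" and l: "0 < l" "l \<le> 1" and \<delta>: "real (card T) * l \<le> \<delta>" and e: "0 < e"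
  shows "\<exists>(c :: nat \<Rightarrow> real) d.
    (\<forall>u. \<bar>\<Sum>n<d. c n * sin (real (Suc n) * u)\<bar> \<le> pi / 2 + e) \<and>
    (\<forall>t\<in>T. \<forall>u. \<bar>u - t\<bar> \<le> l \<longrightarrow> - ln (8 * \<delta>) - e \<le> (\<Sum>n<d. c n * cos (real (Suc n) * u)))"
proof (cases "T = {}")
  case True
  \<comment> \<open>The average over \<open>T\<close> would divide by zero here; the zero polynomial
    serves, as there is no point at which its conjugate must be large.\<close>
  then show ?thesis using e by (intro exI[of _ "\<lambda>_. 0"] exI[of _ 0]) (simp add: add_nonneg_nonneg)
next
  case False
  define K where "K = real (card T)"
  have K: "K > 0" using False T by (simp add: K_def card_gt_0_iff)
  \<comment> \<open>The zeros of \<open>den t\<close> lie on the circle of radius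
    \<open>1 + l\<close>, so the unit circle is inside the domain of holomorphy of
    \<open>h\<close>.\<close>
  define den where "den t z = of_real (1 + l) - z * cis t" for t z
  define \<psi> where "\<psi> z = of_real (1 / (2 * K)) * (\<Sum>t\<in>T. 1 / den (- t) z + 1 / den t z)" for z
  define h where "h z = Ln (\<psi> z)" for z
  have den_pos: "Re (den t z) > 0" if "cmod z < 1 + l" for t z
  proof -
    have "Re (z * cis t) \<le> cmod (z * cis t)" by (rule complex_Re_le_cmod)
    also have "\<dots> < 1 + l" using that by (simp add: norm_mult)
    finally show ?thesis by (simp add: den_def)
  qed
  have inv_pos: "Re (1 / w) > 0" if "Re w > 0" for w
    using that by (auto simp: Re_divide power2_eq_square intro!: divide_pos_pos add_pos_nonneg)
  have \<psi>_Re: "Re (\<psi> z) = 1 / (2 * K) * (\<Sum>t\<in>T. Re (1 / den (- t) z) + Re (1 / den t z))" for z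
    unfolding \<psi>_def by (simp only: scaleR_conv_of_real[symmetric] scaleR_complex.sel Re_sum plus_complex.sel)
  have \<psi>_pos: "Re (\<psi> z) > 0" if "cmod z < 1 + l" for z
    unfolding \<psi>_Re using K False T den_pos[OF that] inv_pos
    by (intro mult_pos_pos sum_pos add_pos_pos) auto
  have hol: "h holomorphic_on ball 0 (1 + l)"
    unfolding h_def
  proof (rule holomorphic_on_Ln')
    have "den t z \<noteq> 0" if "z \<in> ball 0 (1 + l)" for t z
      using den_pos[of z t] that by auto
    moreover have "(\<lambda>z. den t z) holomorphic_on ball 0 (1 + l)" for t
      unfolding den_def by (intro holomorphic_intros)
    ultimately show "\<psi> holomorphic_on ball 0 (1 + l)"
      unfolding \<psi>_def by (intro holomorphic_intros) auto
    show "\<psi> z \<notin> \<real>\<^sub>\<le>\<^sub>0" if "z \<in> ball 0 (1 + l)" for z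
      using \<psi>_pos[of z] that by (auto simp: complex_nonpos_Reals_iff)
  qed
  have h_Im: "\<bar>Im (h z)\<bar> \<le> pi / 2" if "cmod z < 1 + l" for z
    using \<psi>_pos[OF that] Re_Ln_pos_lt[of "\<psi> z"] unfolding h_def by force
  have h_large: "- ln (8 * \<delta>) \<le> Re (h (cis u))" if t: "t \<in> T" "\<bar>u - t\<bar> \<le> l \<or> \<bar>- u - t\<bar> \<le> l" for t u
  proof -
    have small: "1 / (4 * l) \<le> Re (1 / den s (cis u))" if "\<bar>u + s\<bar> \<le> l" for s
    proof (rule Re_inverse_ge[OF _ _ l(1)])
      show "l \<le> Re (den s (cis u))" by (simp add: den_def cis_mult)
      have "cmod (den s (cis u)) = cmod (of_real l + (1 - cis (u + s)))"
        by (simp add: den_def cis_mult algebra_simps)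
      also have "\<dots> \<le> l + cmod (1 - cis (u + s))" using l by (intro norm_triangle_le) simp
      also have "cmod (1 - cis (u + s)) \<le> \<bar>u + s\<bar>"
      proof -
        have "cmod (1 - cis (u + s)) = cmod (exp (\<i> * of_real (u + s)) - 1)"
          by (simp add: cis_conv_exp norm_minus_commute)
        also have "\<dots> = 2 * \<bar>sin ((u + s) / 2)\<bar>" using dist_exp_i_1[of "u + s"] by (simp add: norm_minus_commute mult.commute)
        also have "\<dots> \<le> \<bar>u + s\<bar>" using abs_sin_x_le_abs_x[of "(u + s) / 2"] by simp
        finally show ?thesis .
      qed
      finally show "cmod (den s (cis u)) \<le> 2 * l" using that by simp
    qed
    have c1: "cmod (cis u) < 1 + l" using l by simp
    note pos = inv_pos[OF den_pos[OF c1]]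
    have "1 / (4 * l) \<le> Re (1 / den (- t) (cis u)) + Re (1 / den t (cis u))"
      using t(2)
    proof
      assume "\<bar>u - t\<bar> \<le> l"
      then show ?thesis using small[of "- t"] pos[of t] by simp
    next
      assume "\<bar>- u - t\<bar> \<le> l"
      then have "\<bar>u + t\<bar> \<le> l" by linarith
      then show ?thesis using small[of t] pos[of "- t"] by simp
    qed
    \<comment> \<open>All summands have positive real part, so a single point of \<open>T\<close>
      close to \<open>u\<close> suffices. The average then costs a factor \<open>2 * K\<close>,
      which combines with \<open>4 * l\<close> to the bound
      \<open>1 / (8 * (K * l))\<close>.\<close>
    also have "\<dots> \<le> (\<Sum>t\<in>T. Re (1 / den (- t) (cis u)) + Re (1 / den t (cis u)))"
      using pos by (intro member_le_sum T t add_nonneg_nonneg less_imp_le)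
    finally have "1 / (2 * K) * (1 / (4 * l)) \<le> Re (\<psi> (cis u))"
      unfolding \<psi>_Re using K by (intro mult_left_mono) auto
    then have "1 / (8 * (K * l)) \<le> Re (\<psi> (cis u))" by (simp add: field_simps)
    also have "\<dots> \<le> cmod (\<psi> (cis u))" by (rule complex_Re_le_cmod)
    finally have *: "1 / (8 * (K * l)) \<le> cmod (\<psi> (cis u))" .
    have pos1: "0 < 8 * (K * l)" using K l by simp
    have "- ln (8 * \<delta>) \<le> - ln (8 * (K * l))"
      using pos1 \<delta>[folded K_def] by (simp add: ln_mono)
    also have "\<dots> = ln (1 / (8 * (K * l)))" using K l by (simp add: ln_div)
    also have "\<dots> \<le> ln (cmod (\<psi> (cis u)))"
      using * pos1 by (intro ln_mono) (auto intro: less_le_trans[OF _ *])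
    also have "\<dots> = Re (h (cis u))"
      unfolding h_def using \<psi>_pos[OF c1] by (subst Re_Ln) auto
    finally show ?thesis .
  qed
  define a where "a n = (deriv ^^ n) h 0 / fact n" for n
  have taylor: "(\<lambda>n. a n * z ^ n) sums h z" if "cmod z < 1 + l" for z
    using holomorphic_power_series[OF hol, of z] that unfolding a_def by simp
  \<comment> \<open>Convergence at a radius above \<open>1\<close> gives absolute convergence at
    \<open>1\<close>, so one section of the series works for all points of the circle at
    once.\<close>
  have "summable (\<lambda>n. a n * of_real (1 + l / 2) ^ n)"
    using taylor[of "of_real (1 + l / 2)"] l by (intro sums_summable) (auto simp del: of_real_add)
  from powser_insidea[OF this, of 1] have suma: "summable (\<lambda>n. cmod (a n))"
    using l by (simp del: of_real_add)
  \<comment> \<open>The polynomials omit the constant coefficient. Since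
    \<open>\<psi> 0 = 1 / (1 + l)\<close>, leaving out its logarithm can only raise the cosine
    sum.\<close>
  have a0: "Re (a 0) \<le> 0"
  proof -
    have den0: "den t 0 = of_real (1 + l)" for t by (simp add: den_def)
    have "\<psi> 0 = of_real (1 / (2 * K)) * (of_nat (card T) * (2 / of_real (1 + l)))"
      unfolding \<psi>_def den0 by simp
    also have "\<dots> = of_real (1 / (1 + l))"
      using K l by (simp add: K_def field_simps)
    finally have "Re (a 0) = Re (Ln (of_real (1 / (1 + l))))" by (simp add: a_def h_def)
    also have "\<dots> = ln (1 / (1 + l))" using l by (subst Ln_of_real) auto
    also have "\<dots> \<le> 0" using l by simp
    finally show ?thesis .
  qed
  \<comment> \<open>Taking real parts amounts to averaging over \<open>u\<close> and \<open>- u\<close>; the factors for \<open>- t\<close> in \<open>\<psi>\<close> make it large at both.\<close>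
  define c where "c n = Re (a (Suc n))" for n
  have sumc: "summable (\<lambda>n. \<bar>c n\<bar>)"
  proof (rule summable_comparison_test)
    show "summable (\<lambda>n. cmod (a (Suc n)))" using suma by (subst summable_Suc_iff)
    show "\<exists>N. \<forall>n\<ge>N. norm \<bar>c n\<bar> \<le> cmod (a (Suc n))" unfolding c_def using abs_Re_le_cmod by auto
  qed
  have c1: "cmod (cis u) < 1 + l" for u using l by simp
  have series: "(\<lambda>n. a n * cis (real n * u)) sums h (cis u)" for u
    using taylor[OF c1] by (simp add: Complex.DeMoivre)
  have sin_sums: "(\<lambda>n. c n * sin (real (Suc n) * u)) sums ((Im (h (cis u)) - Im (h (cis (- u)))) / 2)" for u
  proof -
    have "(\<lambda>n. (Im (a n * cis (real n * u)) - Im (a n * cis (real n * - u))) / 2) sums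
        ((Im (h (cis u)) - Im (h (cis (- u)))) / 2)"
      by (intro sums_divide sums_diff sums_Im series)
    moreover have "(Im (a n * cis (real n * u)) - Im (a n * cis (real n * - u))) / 2 = Re (a n) * sin (real n * u)" for n
      by simp
    ultimately have "(\<lambda>n. Re (a n) * sin (real n * u)) sums ((Im (h (cis u)) - Im (h (cis (- u)))) / 2)"
      by (simp only:)
    then show ?thesis using sums_Suc_iff[of "\<lambda>n. Re (a n) * sin (real n * u)"] unfolding c_def by simp
  qed
  have cos_sums: "(\<lambda>n. c n * cos (real (Suc n) * u)) sums ((Re (h (cis u)) + Re (h (cis (- u)))) / 2 - Re (a 0))" for u
  proof -
    have "(\<lambda>n. (Re (a n * cis (real n * u)) + Re (a n * cis (real n * - u))) / 2) sums
        ((Re (h (cis u)) + Re (h (cis (- u)))) / 2)"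
      by (intro sums_divide sums_add sums_Re series)
    moreover have "(Re (a n * cis (real n * u)) + Re (a n * cis (real n * - u))) / 2 = Re (a n) * cos (real n * u)" for n
      by simp
    ultimately have "(\<lambda>n. Re (a n) * cos (real n * u)) sums ((Re (h (cis u)) + Re (h (cis (- u)))) / 2)"
      by (simp only:)
    then show ?thesis using sums_Suc_iff[of "\<lambda>n. Re (a n) * cos (real n * u)"] unfolding c_def by simp
  qed
  from suminf_exist_split[OF e sumc] obtain d where "norm (\<Sum>i. \<bar>c (i + d)\<bar>) < e" by blast
  then have d: "(\<Sum>i. \<bar>c (i + d)\<bar>) \<le> e" by simp
  have "\<bar>\<Sum>n<d. c n * sin (real (Suc n) * u)\<bar> \<le> pi / 2 + e" for u
  proof -
    have "\<bar>(Im (h (cis u)) - Im (h (cis (- u)))) / 2 - (\<Sum>n<d. c n * sin (real (Suc n) * u))\<bar> \<le> (\<Sum>i. \<bar>c (i + d)\<bar>)"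
      by (rule sums_partial_bound[OF sin_sums sumc, unfolded real_norm_def]) (simp add: abs_mult mult_left_le)
    moreover have "\<bar>s\<bar> \<le> p + e" if "\<bar>(x - y) / 2 - s\<bar> \<le> r" "r \<le> e" "\<bar>x\<bar> \<le> p" "\<bar>y\<bar> \<le> p" for x y s r p :: real
      using that unfolding abs_le_iff by (simp add: field_simps)
    ultimately show ?thesis using d h_Im[OF c1] by blast
  qed
  moreover have "- ln (8 * \<delta>) - e \<le> (\<Sum>n<d. c n * cos (real (Suc n) * u))"
    if "t \<in> T" "\<bar>u - t\<bar> \<le> l" for t u
  proof -
    have "\<bar>(Re (h (cis u)) + Re (h (cis (- u)))) / 2 - Re (a 0) - (\<Sum>n<d. c n * cos (real (Suc n) * u))\<bar> \<le> (\<Sum>i. \<bar>c (i + d)\<bar>)"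
      by (rule sums_partial_bound[OF cos_sums sumc, unfolded real_norm_def]) (simp add: abs_mult mult_left_le)
    moreover have "m - e \<le> s" if "\<bar>(x + y) / 2 - b - s\<bar> \<le> r" "r \<le> e" "b \<le> 0" "m \<le> x" "m \<le> y" for x y s r m b :: real
      using that unfolding abs_le_iff by (simp add: field_simps)
    moreover have "- ln (8 * \<delta>) \<le> Re (h (cis u))" "- ln (8 * \<delta>) \<le> Re (h (cis (- u)))"
      using h_large[OF that(1), of u] h_large[OF that(1), of "- u"] that(2) by auto
    ultimately show ?thesis using d a0 by blast
  qed
  ultimately show ?thesis by blast
qed

section \<open>Rational evaluation of trigonometric sums\<close>

text \<open>Taylor sections with \<open>J\<close> terms at \<open>p * (j / 2 ^ m)\<close>, with frequency \<open>p\<close> and argument \<open>j / 2 ^ m\<close>.\<close>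

definition sin_taylor :: "nat \<Rightarrow> nat \<Rightarrow> nat \<Rightarrow> nat \<Rightarrow> real" where
  "sin_taylor J p j m = (\<Sum>i<J. sin_coeff i * real ((p * j) ^ i) / 2 ^ (m * i))"

definition cos_taylor :: "nat \<Rightarrow> nat \<Rightarrow> nat \<Rightarrow> nat \<Rightarrow> real" where
  "cos_taylor J p j m = (\<Sum>i<J. cos_coeff i * real ((p * j) ^ i) / 2 ^ (m * i))"

text \<open>Bounds the error of both for frequencies up to \<open>F\<close> at points of \<open>{0..9}\<close> known up to \<open>1 / 2 ^ m\<close>.\<close>

definition trig_error :: "nat \<Rightarrow> nat \<Rightarrow> nat \<Rightarrow> real" where
  "trig_error F J m = real ((9 * F) ^ J) / fact J + real F / 2 ^ m"

lemma recursive_trig_approx [recursive_intros]: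
  assumes "recursive J" "recursive p" "recursive j" "recursive m"
  shows "recursive_real (\<lambda>x. sin_taylor (J x) (p x) (j x) (m x))"
    "recursive_real (\<lambda>x. cos_taylor (J x) (p x) (j x) (m x))"
proof -
  note cmp = recursive_compose[OF assms(1)] recursive_compose[OF assms(2)]
    recursive_compose[OF assms(3)] recursive_compose[OF assms(4)]
  show "recursive_real (\<lambda>x. sin_taylor (J x) (p x) (j x) (m x))"
    unfolding sin_taylor_def by (intro recursive_intros cmp assms)
  show "recursive_real (\<lambda>x. cos_taylor (J x) (p x) (j x) (m x))"
    unfolding cos_taylor_def by (intro recursive_intros cmp assms)
qed

lemma recursive_trig_error [recursive_intros]:
  "recursive p \<Longrightarrow> recursive J \<Longrightarrow> recursive m \<Longrightarrow> recursive_real (\<lambda>x. trig_error (p x) (J x) (m x))"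
  unfolding trig_error_def by (intro recursive_intros)

lemma trig_error_nonneg: "0 \<le> trig_error F J m"
  by (simp add: trig_error_def)

lemma taylor_argument: "c * real ((p * j) ^ i) / 2 ^ (m * i) = c * (real p * (real j / 2 ^ m)) ^ i"
  by (simp add: power_mult power_mult_distrib power_divide)

lemma taylor_remainder_le:
  assumes "p \<le> F" "j \<le> 9 * 2 ^ m"
  shows "\<bar>real p * (real j / 2 ^ m)\<bar> ^ J / fact J \<le> real ((9 * F) ^ J) / fact J"
proof -
  have "real j \<le> real (9 * 2 ^ m)" using assms(2) by (simp only: of_nat_le_iff)
  then have "real j \<le> 9 * 2 ^ m" by simp
  then have "real j / 2 ^ m \<le> 9" by (simp add: divide_le_eq)
  then have "real p * (real j / 2 ^ m) \<le> real F * 9" using assms(1) by (intro mult_mono) auto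
  then have "\<bar>real p * (real j / 2 ^ m)\<bar> ^ J \<le> (9 * real F) ^ J"
    by (intro power_mono) (auto simp: mult.commute)
  then show ?thesis by (simp add: divide_right_mono)
qed

lemma frequency_error_le:
  assumes "p \<le> F" "\<bar>u - real j / 2 ^ m\<bar> \<le> 1 / 2 ^ m"
  shows "\<bar>real p * u - real p * (real j / 2 ^ m)\<bar> \<le> real F / 2 ^ m"
proof -
  have "\<bar>real p * u - real p * (real j / 2 ^ m)\<bar> = real p * \<bar>u - real j / 2 ^ m\<bar>"
    by (simp only: right_diff_distrib[symmetric] abs_mult abs_of_nat)
  also have "\<dots> \<le> real F * (1 / 2 ^ m)" using assms by (intro mult_mono) auto
  finally show ?thesis by simp
qed

lemma abs_sin_diff_le: "\<bar>sin x - sin y\<bar> \<le> \<bar>x - y\<bar>" for x y :: real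
proof -
  have "\<bar>sin x - sin y\<bar> = 2 * \<bar>sin ((x - y) / 2)\<bar> * \<bar>cos ((x + y) / 2)\<bar>"
    by (simp add: sin_diff_sin abs_mult)
  also have "\<dots> \<le> 2 * \<bar>(x - y) / 2\<bar> * 1"
    by (intro mult_mono abs_sin_x_le_abs_x) auto
  finally show ?thesis by simp
qed

lemma abs_cos_diff_le: "\<bar>cos x - cos y\<bar> \<le> \<bar>x - y\<bar>" for x y :: real
  using abs_sin_diff_le[of "pi / 2 - x" "pi / 2 - y"] by (simp add: sin_diff abs_minus_commute)

text \<open>The two terms of \<open>trig_error\<close> are the Taylor remainder at the grid point
  and, the sine being 1-Lipschitz, the frequency times the distance from the grid point.\<close>

lemma sin_taylor_error:
  assumes "p \<le> F" "j \<le> 9 * 2 ^ m" "\<bar>u - real j / 2 ^ m\<bar> \<le> 1 / 2 ^ m"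
  shows "\<bar>sin (real p * u) - sin_taylor J p j m\<bar> \<le> trig_error F J m"
proof -
  let ?x = "real p * (real j / 2 ^ m)"
  have "\<bar>sin ?x - (\<Sum>i<J. sin_coeff i * ?x ^ i)\<bar> \<le> \<bar>?x\<bar> ^ J / fact J"
    using Maclaurin_sin_bound[of ?x J] by (simp add: divide_inverse mult.commute)
  moreover have "sin_taylor J p j m = (\<Sum>i<J. sin_coeff i * ?x ^ i)"
    unfolding sin_taylor_def taylor_argument ..
  ultimately show ?thesis
    using abs_sin_diff_le[of "real p * u" ?x] frequency_error_le[OF assms(1,3)] taylor_remainder_le[OF assms(1,2), of J]
    unfolding trig_error_def by linarith
qed

lemma cos_taylor_error:
  assumes "p \<le> F" "j \<le> 9 * 2 ^ m" "\<bar>u - real j / 2 ^ m\<bar> \<le> 1 / 2 ^ m"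
  shows "\<bar>cos (real p * u) - cos_taylor J p j m\<bar> \<le> trig_error F J m"
proof -
  let ?x = "real p * (real j / 2 ^ m)"
  obtain t where t: "cos ?x = (\<Sum>i<J. cos_coeff i * ?x ^ i) + cos (t + 1 / 2 * real J * pi) / fact J * ?x ^ J"
    using Maclaurin_cos_expansion[of ?x J] by blast
  have "\<bar>cos (t + 1 / 2 * real J * pi) / fact J * ?x ^ J\<bar> = \<bar>cos (t + 1 / 2 * real J * pi)\<bar> * (\<bar>?x\<bar> ^ J / fact J)"
    by (simp add: abs_mult power_abs)
  also have "\<dots> \<le> 1 * (\<bar>?x\<bar> ^ J / fact J)" by (intro mult_right_mono) auto
  finally have "\<bar>cos ?x - (\<Sum>i<J. cos_coeff i * ?x ^ i)\<bar> \<le> \<bar>?x\<bar> ^ J / fact J"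
    using t by simp
  moreover have "cos_taylor J p j m = (\<Sum>i<J. cos_coeff i * ?x ^ i)"
    unfolding cos_taylor_def taylor_argument ..
  ultimately show ?thesis
    using abs_cos_diff_le[of "real p * u" ?x] frequency_error_le[OF assms(1,3)] taylor_remainder_le[OF assms(1,2), of J]
    unfolding trig_error_def by linarith
qed

lemma eventually_half_power_less:
  assumes "0 < e" shows "\<forall>\<^sub>F K in sequentially. C * (1 / 2 :: real) ^ K < e"
proof -
  have "(\<lambda>K. C * (1 / 2 :: real) ^ K) \<longlonglongrightarrow> C * 0"
    by (intro tendsto_intros LIMSEQ_power_zero) simp
  then show ?thesis using assms by (simp add: order_tendstoD(2))
qed

lemma trig_error_small:
  assumes "0 < e"
  obtains m J where "M \<le> m" "trig_error F J m < e"
proof -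
  have "(\<lambda>J. real ((9 * F) ^ J) / fact J) \<longlonglongrightarrow> 0"
    using summable_LIMSEQ_zero[OF summable_exp[of "9 * real F"]] by (simp add: divide_inverse mult.commute)
  then have "\<forall>\<^sub>F J in sequentially. real ((9 * F) ^ J) / fact J < e / 2"
    using assms by (intro order_tendstoD) auto
  then obtain J where J: "real ((9 * F) ^ J) / fact J < e / 2" by (auto simp: eventually_sequentially)
  have "\<forall>\<^sub>F m in sequentially. real F * (1 / 2) ^ m < e / 2"
    using assms by (intro eventually_half_power_less) simp
  then have "\<forall>\<^sub>F m in sequentially. M \<le> m \<and> real F * (1 / 2) ^ m < e / 2"
    using eventually_ge_at_top by (rule eventually_elim2) blast
  then obtain m where m: "M \<le> m" "real F * (1 / 2) ^ m < e / 2" by (auto simp: eventually_sequentially)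
  have "real F * (1 / 2) ^ m = real F / 2 ^ m" by (simp add: power_divide)
  then have "trig_error F J m < e" unfolding trig_error_def using J m(2) by linarith
  with m(1) show ?thesis by (rule that)
qed

lemma sum_error_le:
  fixes c f g :: "nat \<Rightarrow> real"
  assumes "\<And>n. n < d \<Longrightarrow> \<bar>f n - g n\<bar> \<le> e"
  shows "\<bar>(\<Sum>n<d. c n * f n) - (\<Sum>n<d. c n * g n)\<bar> \<le> (\<Sum>n<d. \<bar>c n\<bar>) * e"
proof -
  have "(\<Sum>n<d. c n * f n) - (\<Sum>n<d. c n * g n) = (\<Sum>n<d. c n * (f n - g n))"
    by (simp add: right_diff_distrib sum_subtractf)
  also have "\<bar>\<dots>\<bar> \<le> (\<Sum>n<d. \<bar>c n * (f n - g n)\<bar>)" by (rule sum_abs)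
  also have "\<dots> \<le> (\<Sum>n<d. \<bar>c n\<bar> * e)"
    using assms by (intro sum_mono) (auto simp: abs_mult intro!: mult_left_mono)
  finally show ?thesis by (simp add: sum_distrib_right)
qed

section \<open>Dyadic grids and codes of finite sequences\<close>

text \<open>Passing to the enclosing coarser dyadic interval is integer division of the index,
  because \<open>\<lfloor>\<lfloor>y\<rfloor> / D\<rfloor> = \<lfloor>y / D\<rfloor>\<close> for
  positive integers \<open>D\<close>.\<close>

lemma floor_dyadic_div:
  fixes x :: real
  assumes "s \<le> s'"
  shows "\<lfloor>x * 2 ^ s'\<rfloor> div 2 ^ (s' - s) = \<lfloor>x * 2 ^ s\<rfloor>"
proof -
  have "(2 :: real) ^ s' = 2 ^ s * 2 ^ (s' - s)"
    using assms by (simp only: power_add[symmetric] le_add_diff_inverse)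
  then have "x * 2 ^ s = x * 2 ^ s' / 2 ^ (s' - s)" by simp
  then show ?thesis using floor_divide_real_eq_div[of "2 ^ (s' - s)" "x * 2 ^ s'"] by simp
qed

lemma dyadic_floor:
  fixes u :: real
  assumes "0 \<le> u" "u < 8" and j: "j = nat \<lfloor>u * 2 ^ m\<rfloor>"
  shows "j < 8 * 2 ^ m" "\<bar>u - real j / 2 ^ m\<bar> \<le> 1 / 2 ^ m"
proof -
  have "0 \<le> u * 2 ^ m" using assms by simp
  then have 1: "real j \<le> u * 2 ^ m" "u * 2 ^ m < real j + 1" unfolding j by linarith+
  have "u * 2 ^ m < real (8 * 2 ^ m)" using assms(2) by simp
  with 1(1) have "real j < real (8 * 2 ^ m)" by (rule le_less_trans)
  then show "j < 8 * 2 ^ m" by (simp only: of_nat_less_iff)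
  have "real j / 2 ^ m \<le> u" "u \<le> real j / 2 ^ m + 1 / 2 ^ m" using 1 by (simp_all add: field_simps)
  then show "\<bar>u - real j / 2 ^ m\<bar> \<le> 1 / 2 ^ m" by simp
qed

text \<open>A number is read as a pair of head and tail over and over, so every number codes an
  infinite sequence and no length has to be stored.\<close>

definition seq_nth :: "nat \<Rightarrow> nat \<Rightarrow> nat" where
  "seq_nth v n = pfst (rec_nat v (\<lambda>_. psnd) n)"

lemma recursive_seq_nth [recursive_intros]:
  assumes "recursive f" "recursive g" shows "recursive (\<lambda>x. seq_nth (f x) (g x))"
  unfolding seq_nth_def by (intro recursive_intros recursive_rec_nat assms)

lemma seq_nth_surj: "\<exists>v. \<forall>n<d. seq_nth v n = f n"
proof (induction d arbitrary: f)
  case (Suc d)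
  from Suc[of "\<lambda>n. f (Suc n)"] obtain v where v: "\<forall>n<d. seq_nth v n = f (Suc n)" by blast
  have "rec_nat (prod_encode (f 0, v)) (\<lambda>_. psnd) (Suc n) = rec_nat v (\<lambda>_. psnd) n" for n
    by (induction n) auto
  then have "seq_nth (prod_encode (f 0, v)) n = (case n of 0 \<Rightarrow> f 0 | Suc k \<Rightarrow> seq_nth v k)" for n
    by (cases n) (simp_all add: seq_nth_def)
  then show ?case using v by (intro exI[of _ "prod_encode (f 0, v)"]) (auto split: nat.split)
qed auto

section \<open>Searching for a trigonometric polynomial\<close>

text \<open>The first component of \<open>v\<close> gives a common denominator, the second codes the
  numerators as differences of natural numbers. Every number is a valid code, so a search may run
  through all of them.\<close>

definition code_coeff :: "nat \<Rightarrow> nat \<Rightarrow> real" where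
  "code_coeff v n = (real (pfst (seq_nth (psnd v) n)) - real (psnd (seq_nth (psnd v) n))) / real (Suc (pfst v))"

lemma recursive_code_coeff [recursive_intros]:
  assumes "recursive f" "recursive g" shows "recursive_real (\<lambda>x. code_coeff (f x) (g x))"
  unfolding code_coeff_def by (intro recursive_intros assms)

lemma code_coeff_dense:
  fixes c :: "nat \<Rightarrow> real"
  shows "\<exists>v. \<forall>n<d. \<bar>code_coeff v n - c n\<bar> \<le> 1 / real (Suc z)"
proof -
  define i where "i n = \<lfloor>c n * real (Suc z)\<rfloor>" for n
  obtain s where s: "\<forall>n<d. seq_nth s n = prod_encode (nat (i n), nat (- i n))"
    using seq_nth_surj[of d "\<lambda>n. prod_encode (nat (i n), nat (- i n))"] by blast
  have "\<bar>code_coeff (prod_encode (z, s)) n - c n\<bar> \<le> 1 / real (Suc z)" if "n < d" for n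
  proof -
    have "code_coeff (prod_encode (z, s)) n = of_int (i n) / real (Suc z)"
      using s that by (simp add: code_coeff_def)
    moreover have "\<bar>of_int (i n) - c n * real (Suc z)\<bar> \<le> 1" unfolding i_def by linarith
    then have "\<bar>of_int (i n) - c n * real (Suc z)\<bar> / real (Suc z) \<le> 1 / real (Suc z)"
      by (rule divide_right_mono) simp
    then have "\<bar>(of_int (i n) - c n * real (Suc z)) / real (Suc z)\<bar> \<le> 1 / real (Suc z)"
      by (simp only: abs_divide abs_of_nat)
    moreover have "(of_int (i n) - c n * real (Suc z)) / real (Suc z) = of_int (i n) / real (Suc z) - c n"
      by (simp add: diff_divide_distrib)
    ultimately show ?thesis by (simp only:)
  qed
  then show ?thesis by blast
qed

text \<open>The searched property \<open>ok\<close> asks for the inequalities at grid points with a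
  margin \<open>er\<close> that covers everything between them; hence passing the test proves the
  bounds for all \<open>u\<close>. The search ends because the polynomial of
  \<open>conjugate_large_on_intervals\<close>, rounded to rational coefficients, leaves enough room
  for the margin: errors of \<open>1 / 10\<close> each fit between \<open>pi / 2\<close> and
  \<open>3\<close>, and into the extra \<open>2\<close> in the exponent of the measure
  bound.\<close>

lemma recursive_conjugate_large:
  fixes L :: "nat \<Rightarrow> nat" and g :: "nat \<Rightarrow> nat \<Rightarrow> bool"
  assumes L: "recursive L" and g: "decidable (\<lambda>z. g (pfst z) (psnd z))"
    and small: "\<And>k. real (card {y. y < 8 * 2 ^ L k \<and> g k y}) / 2 ^ L k \<le> exp (- (2 ^ k + 2)) / 8"
  obtains d c where "recursive d" "recursive_real (\<lambda>z. c (pfst z) (psnd z))"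
    "\<And>k u. \<bar>\<Sum>n<d k. c k n * sin (real (Suc n) * u)\<bar> \<le> 3"
    "\<And>k u. 0 \<le> u \<Longrightarrow> u < 8 \<Longrightarrow> g k (nat \<lfloor>u * 2 ^ L k\<rfloor>) \<Longrightarrow> 2 ^ k \<le> (\<Sum>n<d k. c k n * cos (real (Suc n) * u))"
proof -
  \<comment> \<open>A candidate \<open>w\<close> lists the grid level, the number of Taylor terms,
    the number of coefficients and the code of the coefficients.\<close>
  define dg where "dg w = pfst (psnd (psnd w))" for w
  define cf where "cf w n = code_coeff (psnd (psnd (psnd w))) n" for w n
  define er where "er w = (\<Sum>n<dg w. \<bar>cf w n\<bar>) * trig_error (dg w) (pfst (psnd w)) (pfst w)" for w
  \<comment> \<open>The test grid is at least as fine as the intervals marked by \<open>g k\<close>;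
    \<open>j div 2 ^ (pfst w - L k)\<close> is the index of the interval that contains the grid
    point.\<close>
  define ok where "ok k w \<longleftrightarrow> L k \<le> pfst w \<and>
     (\<forall>j<8 * 2 ^ pfst w. \<bar>\<Sum>n<dg w. cf w n * sin_taylor (pfst (psnd w)) (Suc n) j (pfst w)\<bar> + er w \<le> 3) \<and>
     (\<forall>j<8 * 2 ^ pfst w. g k (j div 2 ^ (pfst w - L k)) \<longrightarrow>
        real (2 ^ k) \<le> (\<Sum>n<dg w. cf w n * cos_taylor (pfst (psnd w)) (Suc n) j (pfst w)) - er w)" for k w
  have dec: "decidable (\<lambda>z. ok (pfst z) (psnd z))"
  proof -
    have *: "decidable (\<lambda>x. g (a x) (b x))" if "recursive a" "recursive b" for a b
      using decidable_compose[OF g recursive_pair[OF that]] by simp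
    show ?thesis unfolding ok_def er_def dg_def cf_def
      by (intro recursive_intros * recursive_compose[OF L])
  qed
  have grid: "\<bar>(\<Sum>n<dg w. cf w n * sin (real (Suc n) * u)) -
        (\<Sum>n<dg w. cf w n * sin_taylor (pfst (psnd w)) (Suc n) j (pfst w))\<bar> \<le> er w"
      "\<bar>(\<Sum>n<dg w. cf w n * cos (real (Suc n) * u)) -
        (\<Sum>n<dg w. cf w n * cos_taylor (pfst (psnd w)) (Suc n) j (pfst w))\<bar> \<le> er w"
    if "j < 8 * 2 ^ pfst w" "\<bar>u - real j / 2 ^ pfst w\<bar> \<le> 1 / 2 ^ pfst w" for w j u
  proof -
    have "j \<le> 9 * 2 ^ pfst w" using that(1) by simp
    then show "\<bar>(\<Sum>n<dg w. cf w n * sin (real (Suc n) * u)) -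
        (\<Sum>n<dg w. cf w n * sin_taylor (pfst (psnd w)) (Suc n) j (pfst w))\<bar> \<le> er w"
      "\<bar>(\<Sum>n<dg w. cf w n * cos (real (Suc n) * u)) -
        (\<Sum>n<dg w. cf w n * cos_taylor (pfst (psnd w)) (Suc n) j (pfst w))\<bar> \<le> er w"
      unfolding er_def using that(2)
      by (intro sum_error_le sin_taylor_error cos_taylor_error; simp)+
  qed
  have sound1: "\<bar>\<Sum>n<dg w. cf w n * sin (real (Suc n) * u)\<bar> \<le> 3" if ok: "ok k w" for k w u
  proof -
    \<comment> \<open>By periodicity it suffices to control one period, which the grid covers since
      \<open>2 * pi < 8\<close>.\<close>
    define i where "i = \<lfloor>u / (2 * pi)\<rfloor>"
    define v where "v = u - of_int i * (2 * pi)"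
    have "of_int i \<le> u / (2 * pi)" "u / (2 * pi) < of_int i + 1" unfolding i_def by linarith+
    then have v: "0 \<le> v" "v < 2 * pi" unfolding v_def by (simp_all add: field_simps)
    have v8: "v < 8" using v pi_less_4 by linarith
    have "sin (real (Suc n) * u) = sin (real (Suc n) * v)" for n
    proof -
      have "real (Suc n) * v = real (Suc n) * u - of_int (int (Suc n) * i) * (2 * pi)"
        unfolding v_def by (simp add: algebra_simps)
      then show ?thesis using sin_int_2pin[of "int (Suc n) * i"] cos_int_2pin[of "int (Suc n) * i"]
        by (simp add: sin_diff mult.commute)
    qed
    then have eq: "(\<Sum>n<dg w. cf w n * sin (real (Suc n) * u)) = (\<Sum>n<dg w. cf w n * sin (real (Suc n) * v))"
      by simp
    note j = dyadic_floor[OF v(1) v8 refl, of "pfst w"]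
    show ?thesis using grid(1)[OF j] ok j(1) unfolding ok_def eq by fastforce
  qed
  have sound2: "2 ^ k \<le> (\<Sum>n<dg w. cf w n * cos (real (Suc n) * u))"
    if ok: "ok k w" and u: "0 \<le> u" "u < 8" and gk: "g k (nat \<lfloor>u * 2 ^ L k\<rfloor>)" for k w u
  proof -
    let ?j = "nat \<lfloor>u * 2 ^ pfst w\<rfloor>"
    note j = dyadic_floor[OF u refl, of "pfst w"]
    have le: "L k \<le> pfst w" using ok by (simp add: ok_def)
    have "nat \<lfloor>u * 2 ^ L k\<rfloor> = ?j div 2 ^ (pfst w - L k)"
    proof -
      have "\<lfloor>u * 2 ^ L k\<rfloor> = \<lfloor>u * 2 ^ pfst w\<rfloor> div 2 ^ (pfst w - L k)"
        by (rule floor_dyadic_div[OF le, symmetric])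
      then show ?thesis using u by (simp add: nat_div_distrib nat_power_eq)
    qed
    then have "real (2 ^ k) \<le> (\<Sum>n<dg w. cf w n * cos_taylor (pfst (psnd w)) (Suc n) ?j (pfst w)) - er w"
      using ok j(1) gk unfolding ok_def by simp
    then show ?thesis using grid(2)[OF j] by simp
  qed
  have complete: "\<exists>w. ok k w" for k
  proof -
    \<comment> \<open>Left end points of the marked intervals. With \<open>l\<close> equal to the
      length of an interval, the neighbourhoods in \<open>conjugate_large_on_intervals\<close>
      contain the intervals themselves.\<close>
    define T where "T = (\<lambda>y. real y / 2 ^ L k) ` {y. y < 8 * 2 ^ L k \<and> g k y}"
    define \<delta> :: real where "\<delta> = exp (- (2 ^ k + 2)) / 8"
    have "card T = card {y. y < 8 * 2 ^ L k \<and> g k y}"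
      unfolding T_def by (rule card_image) (auto simp: inj_on_def)
    then have "real (card T) * (1 / 2 ^ L k) \<le> \<delta>" using small[of k] by (simp add: \<delta>_def)
    moreover have "finite T" unfolding T_def by simp
    ultimately have "\<exists>(c :: nat \<Rightarrow> real) d.
      (\<forall>u. \<bar>\<Sum>n<d. c n * sin (real (Suc n) * u)\<bar> \<le> pi / 2 + 1 / 10) \<and>
      (\<forall>t\<in>T. \<forall>u. \<bar>u - t\<bar> \<le> 1 / 2 ^ L k \<longrightarrow>
        - ln (8 * \<delta>) - 1 / 10 \<le> (\<Sum>n<d. c n * cos (real (Suc n) * u)))"
      by (intro conjugate_large_on_intervals) auto
    then obtain c0 d where
      c1: "\<And>u. \<bar>\<Sum>n<d. c0 n * sin (real (Suc n) * u)\<bar> \<le> pi / 2 + 1 / 10" and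
      c2: "\<And>t u. t \<in> T \<Longrightarrow> \<bar>u - t\<bar> \<le> 1 / 2 ^ L k \<Longrightarrow>
             - ln (8 * \<delta>) - 1 / 10 \<le> (\<Sum>n<d. c0 n * cos (real (Suc n) * u))"
      by blast
    have ln\<delta>: "- ln (8 * \<delta>) = 2 ^ k + 2" by (simp add: \<delta>_def)
    \<comment> \<open>Each of the \<open>d\<close> coefficients is off by at most
      \<open>1 / (10 * d + 1)\<close>, so the rounding changes the sums by at most
      \<open>1 / 10\<close>.\<close>
    obtain v where v: "\<forall>n<d. \<bar>code_coeff v n - c0 n\<bar> \<le> 1 / real (Suc (10 * d))"
      using code_coeff_dense by blast
    have v_error: "\<bar>(\<Sum>n<d. code_coeff v n * f n) - (\<Sum>n<d. c0 n * f n)\<bar> \<le> 1 / 10"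
      if "\<And>n. \<bar>f n\<bar> \<le> 1" for f :: "nat \<Rightarrow> real"
    proof -
      have "\<bar>(\<Sum>n<d. f n * code_coeff v n) - (\<Sum>n<d. f n * c0 n)\<bar> \<le> (\<Sum>n<d. \<bar>f n\<bar>) * (1 / real (Suc (10 * d)))"
        using v by (intro sum_error_le) auto
      also have "\<dots> \<le> (\<Sum>n<d. 1) * (1 / real (Suc (10 * d)))"
        using that by (intro mult_right_mono sum_mono) auto
      also have "\<dots> \<le> 1 / 10" by (simp add: field_simps)
      finally show ?thesis by (simp only: mult.commute)
    qed
    define W where "W = (\<Sum>n<d. \<bar>code_coeff v n\<bar>)"
    have W: "W \<ge> 0" unfolding W_def by (simp add: sum_nonneg)
    obtain m J where m: "L k \<le> m" "trig_error d J m < 1 / (10 * (W + 1))"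
      using trig_error_small[of "1 / (10 * (W + 1))" "L k" d] W by auto
    define w where "w = prod_encode (m, prod_encode (J, prod_encode (d, v)))"
    have w: "pfst w = m" "pfst (psnd w) = J" "dg w = d" "cf w = code_coeff v"
      by (simp_all add: w_def dg_def cf_def fun_eq_iff)
    have er: "er w \<le> 1 / 10"
    proof -
      have "er w = W * trig_error d J m" by (simp add: er_def w W_def)
      also have "\<dots> \<le> (W + 1) * (1 / (10 * (W + 1)))"
        using W m trig_error_nonneg by (intro mult_mono) auto
      also have "\<dots> = 1 / 10" using W by simp
      finally show ?thesis .
    qed
    have "ok k w" unfolding ok_def
    proof (intro conjI allI impI)
      show "L k \<le> pfst w" using m w by simp
    next
      fix j :: nat assume j: "j < 8 * 2 ^ pfst w"
      have "\<bar>(\<Sum>n<dg w. cf w n * sin (real (Suc n) * (real j / 2 ^ pfst w))) -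
        (\<Sum>n<dg w. cf w n * sin_taylor (pfst (psnd w)) (Suc n) j (pfst w))\<bar> \<le> er w"
        by (rule grid(1)[OF j]) simp
      moreover have "\<bar>(\<Sum>n<d. code_coeff v n * sin (real (Suc n) * (real j / 2 ^ pfst w))) -
          (\<Sum>n<d. c0 n * sin (real (Suc n) * (real j / 2 ^ pfst w)))\<bar> \<le> 1 / 10"
        by (rule v_error) simp
      moreover have "pi / 2 < 2" using pi_less_4 by simp
      ultimately show "\<bar>\<Sum>n<dg w. cf w n * sin_taylor (pfst (psnd w)) (Suc n) j (pfst w)\<bar> + er w \<le> 3"
        using er c1[of "real j / 2 ^ pfst w"] unfolding w(3,4) by linarith
    next
      fix j :: nat assume j: "j < 8 * 2 ^ pfst w" and gj: "g k (j div 2 ^ (pfst w - L k))"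
      define y where "y = j div 2 ^ (pfst w - L k)"
      have "2 ^ pfst w = 2 ^ L k * (2 :: nat) ^ (pfst w - L k)"
        using m(1) by (simp add: w power_add[symmetric])
      then have y: "y < 8 * 2 ^ L k"
        using j unfolding y_def by (simp add: less_mult_imp_div_less mult.assoc)
      have "\<bar>real j / 2 ^ pfst w - real y / 2 ^ L k\<bar> \<le> 1 / 2 ^ L k"
      proof -
        define D :: nat where "D = 2 ^ (pfst w - L k)"
        have D: "(2 :: real) ^ pfst w = 2 ^ L k * real D" "0 < D"
          using m(1) by (simp_all add: w D_def power_add[symmetric])
        have yD: "y = j div D" by (simp add: y_def D_def)
        have "j mod D < D" using D by simp
        then have "y * D \<le> j" "j \<le> (y + 1) * D"
          unfolding yD using div_mult_mod_eq[of j D] by (simp_all only: distrib_right mult_1)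
        then have "real (y * D) \<le> real j" "real j \<le> real ((y + 1) * D)"
          by (simp_all only: of_nat_le_iff)
        then have "real y / 2 ^ L k \<le> real j / 2 ^ pfst w" "real j / 2 ^ pfst w \<le> real (y + 1) / 2 ^ L k"
          unfolding D(1) using D(2) by (simp_all add: field_simps)
        then show ?thesis by (simp add: add_divide_distrib)
      qed
      moreover have "real y / 2 ^ L k \<in> T" unfolding T_def using y gj by (auto simp: y_def)
      ultimately have "2 ^ k + 2 - 1 / 10 \<le> (\<Sum>n<d. c0 n * cos (real (Suc n) * (real j / 2 ^ pfst w)))"
        using c2 ln\<delta> by metis
      moreover have "\<bar>(\<Sum>n<dg w. cf w n * cos (real (Suc n) * (real j / 2 ^ pfst w))) -
        (\<Sum>n<dg w. cf w n * cos_taylor (pfst (psnd w)) (Suc n) j (pfst w))\<bar> \<le> er w"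
        by (rule grid(2)[OF j]) simp
      moreover have "\<bar>(\<Sum>n<d. code_coeff v n * cos (real (Suc n) * (real j / 2 ^ pfst w))) -
          (\<Sum>n<d. c0 n * cos (real (Suc n) * (real j / 2 ^ pfst w)))\<bar> \<le> 1 / 10"
        by (rule v_error) simp
      ultimately show "real (2 ^ k) \<le> (\<Sum>n<dg w. cf w n * cos_taylor (pfst (psnd w)) (Suc n) j (pfst w)) - er w"
        using er unfolding w(3,4) of_nat_power of_nat_numeral by linarith
    qed
    then show ?thesis ..
  qed
  define S where "S k = (LEAST w. ok k w)" for k
  have S: "recursive S" unfolding S_def by (rule recursive_Least[OF dec complete])
  have okS: "ok k (S k)" for k unfolding S_def using complete by (rule LeastI_ex)
  show ?thesis
  proof (rule that[of "\<lambda>k. dg (S k)" "\<lambda>k. cf (S k)"])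
    show "recursive (\<lambda>k. dg (S k))" unfolding dg_def by (intro recursive_intros S)
    show "recursive_real (\<lambda>z. cf (S (pfst z)) (psnd z))"
      unfolding cf_def by (intro recursive_intros recursive_compose[OF S])
  qed (use sound1[OF okS] sound2[OF okS] in auto)
qed

section \<open>Fourier partial sums\<close>

lemma fourier_coeff_eq_integral:
  assumes "continuous_on {-pi..pi} f"
  shows "fourier_coeff f n = 1 / (2 * of_real pi) *
    integral {-pi..pi} (\<lambda>t. f t * exp (- (\<i> * of_int n * of_real t)))"
proof -
  have "(\<lambda>t. f t * exp (- (\<i> * of_int n * of_real t))) absolutely_integrable_on {-pi..pi}"
    by (intro absolutely_integrable_continuous_real continuous_intros assms)
  from set_lebesgue_integral_eq_integral(2)[OF this] show ?thesis by (simp add: fourier_coeff_def)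
qed

lemma norm_fourier_coeff_diff_le:
  assumes "continuous_on {-pi..pi} f" "continuous_on {-pi..pi} g"
    and "\<And>t. t \<in> {-pi..pi} \<Longrightarrow> norm (f t - g t) \<le> e"
  shows "norm (fourier_coeff f n - fourier_coeff g n) \<le> e"
proof -
  let ?E = "\<lambda>t. exp (- (\<i> * of_int n * of_real t))"
  have int: "(\<lambda>t. f t * ?E t) integrable_on {-pi..pi}" "(\<lambda>t. g t * ?E t) integrable_on {-pi..pi}"
    by (intro integrable_continuous_real continuous_intros assms)+
  have cont: "continuous_on {-pi..pi} (\<lambda>t. f t * ?E t - g t * ?E t)"
    by (intro continuous_intros assms)
  have nE: "norm (?E t) = 1" for t by (simp add: norm_exp_eq_Re)
  have "norm (integral {-pi..pi} (\<lambda>t. f t * ?E t - g t * ?E t)) \<le> e * (pi - - pi)"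
  proof (rule integral_bound[OF _ cont])
    fix t assume "t \<in> {-pi..pi}"
    then show "norm (f t * ?E t - g t * ?E t) \<le> e"
      using assms(3)[of t] nE[of t] by (simp only: left_diff_distrib[symmetric] norm_mult mult_1_right)
  qed simp
  moreover have "fourier_coeff f n - fourier_coeff g n =
      1 / (2 * of_real pi) * integral {-pi..pi} (\<lambda>t. f t * ?E t - g t * ?E t)"
    unfolding fourier_coeff_eq_integral[OF assms(1)] fourier_coeff_eq_integral[OF assms(2)]
      Henstock_Kurzweil_Integration.integral_diff[OF int] by (simp add: right_diff_distrib)
  ultimately have "norm (fourier_coeff f n - fourier_coeff g n) \<le> 1 / (2 * pi) * (e * (pi - - pi))"
    by (simp only: norm_mult norm_divide norm_of_real norm_one norm_numeral abs_of_pos[OF pi_gt_zero])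
       (intro mult_left_mono; simp)
  then show ?thesis by simp
qed

text \<open>The crude factor is harmless: it is applied with \<open>N\<close> fixed before
  \<open>e\<close> is made small by taking more blocks.\<close>

lemma norm_fourier_sum_diff_le:
  assumes "continuous_on {-pi..pi} f" "continuous_on {-pi..pi} g"
    and "\<And>t. t \<in> {-pi..pi} \<Longrightarrow> norm (f t - g t) \<le> e"
  shows "norm (fourier_sum f N t - fourier_sum g N t) \<le> (2 * real N + 1) * e"
proof -
  have "fourier_sum f N t - fourier_sum g N t =
      (\<Sum>n\<in>{- int N..int N}. (fourier_coeff f n - fourier_coeff g n) * fourier_basis n t)"
    unfolding fourier_sum_def by (simp add: sum_subtractf left_diff_distrib)
  also have "norm \<dots> \<le> (\<Sum>n\<in>{- int N..int N}. e)"
  proof (rule sum_norm_le)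
    fix n
    have "norm (fourier_basis n t) = 1" by (simp add: fourier_basis_def norm_exp_eq_Re)
    then show "norm ((fourier_coeff f n - fourier_coeff g n) * fourier_basis n t) \<le> e"
      using norm_fourier_coeff_diff_le[OF assms] by (simp add: norm_mult)
  qed
  finally show ?thesis by (simp add: algebra_simps)
qed

lemma fourier_basis_eq_cis: "fourier_basis n t = cis (of_int n * t)"
  by (simp add: fourier_basis_def cis_conv_exp mult.assoc)

lemma integral_cis_int: "integral {-pi..pi} (\<lambda>t. cis (of_int k * t)) = (if k = 0 then 2 * of_real pi else 0)"
proof (cases "k = 0")
  case False
  have "((\<lambda>t. cis (of_int k * t)) has_integral
     (cis (of_int k * pi) / (\<i> * of_int k) - cis (of_int k * - pi) / (\<i> * of_int k))) {-pi..pi}"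
  proof (rule fundamental_theorem_of_calculus)
    fix t assume "t \<in> {-pi..pi}"
    have "((\<lambda>z. exp (\<i> * of_int k * z) / (\<i> * of_int k)) has_field_derivative
      exp (\<i> * of_int k * of_real t)) (at (of_real t))"
      using False by (auto intro!: derivative_eq_intros)
    from has_vector_derivative_real_field[OF this]
    have "((\<lambda>t. exp (\<i> * of_int k * of_real t) / (\<i> * of_int k)) has_vector_derivative
      exp (\<i> * of_int k * of_real t)) (at t within {-pi..pi})" .
    then show "((\<lambda>t. cis (of_int k * t) / (\<i> * of_int k)) has_vector_derivative cis (of_int k * t)) (at t within {-pi..pi})"
      by (simp add: cis_conv_exp mult.assoc)
  qed simp
  moreover have "cis (of_int k * pi) = cis (of_int k * - pi)"
    using sin_npi_int[of k] by (simp add: complex_eq_iff mult.commute)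
  ultimately show ?thesis using False by (simp add: integral_unique)
qed (simp add: scaleR_conv_of_real)

text \<open>By orthogonality a partial sum selects terms. Indexing by terms instead of frequencies
  lets coinciding frequencies simply add up.\<close>

lemma fourier_sum_trigonometric:
  fixes p :: "'i \<Rightarrow> nat"
  assumes "finite I"
  shows "fourier_sum (\<lambda>t. \<Sum>i\<in>I. \<gamma> i * cis (real (p i) * t)) N t0 =
    (\<Sum>i\<in>I. if p i \<le> N then \<gamma> i * cis (real (p i) * t0) else 0)"
proof -
  have coeff: "fourier_coeff (\<lambda>t. \<Sum>i\<in>I. \<gamma> i * cis (real (p i) * t)) n =
     (\<Sum>i\<in>I. if n = int (p i) then \<gamma> i else 0)" for n
  proof -
    have cont: "continuous_on {-pi..pi} (\<lambda>t. \<Sum>i\<in>I. \<gamma> i * cis (real (p i) * t))"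
      by (intro continuous_intros)
    have eq: "(\<Sum>i\<in>I. \<gamma> i * cis (real (p i) * t)) * exp (- (\<i> * of_int n * of_real t)) =
        (\<Sum>i\<in>I. \<gamma> i * cis (of_int (int (p i) - n) * t))" for t
      unfolding sum_distrib_right
    proof (rule sum.cong[OF refl])
      fix i
      have "exp (- (\<i> * of_int n * of_real t)) = cis (- (of_int n * t))"
        by (simp add: cis_conv_exp mult.assoc)
      then show "\<gamma> i * cis (real (p i) * t) * exp (- (\<i> * of_int n * of_real t)) =
          \<gamma> i * cis (of_int (int (p i) - n) * t)"
        by (simp add: cis_mult mult.assoc left_diff_distrib)
    qed
    have int: "(\<lambda>t. \<gamma> i * cis (of_int (int (p i) - n) * t)) integrable_on {-pi..pi}" for i
      by (intro integrable_continuous_real continuous_intros)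
    have "integral {-pi..pi} (\<lambda>t. \<Sum>i\<in>I. \<gamma> i * cis (of_int (int (p i) - n) * t)) =
       (\<Sum>i\<in>I. \<gamma> i * integral {-pi..pi} (\<lambda>t. cis (of_int (int (p i) - n) * t)))"
      using assms int by (subst integral_sum) auto
    also have "\<dots> = (\<Sum>i\<in>I. (2 * of_real pi) * (if n = int (p i) then \<gamma> i else 0))"
      unfolding integral_cis_int by (intro sum.cong) auto
    finally show ?thesis
      unfolding fourier_coeff_eq_integral[OF cont] eq by (simp add: sum_distrib_left[symmetric])
  qed
  have "fourier_sum (\<lambda>t. \<Sum>i\<in>I. \<gamma> i * cis (real (p i) * t)) N t0 =
     (\<Sum>n\<in>{- int N..int N}. \<Sum>i\<in>I. if n = int (p i) then \<gamma> i * cis (of_int n * t0) else 0)"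
    unfolding fourier_sum_def coeff fourier_basis_eq_cis sum_distrib_right by (intro sum.cong) auto
  also have "\<dots> = (\<Sum>i\<in>I. \<Sum>n\<in>{- int N..int N}. if n = int (p i) then \<gamma> i * cis (of_int n * t0) else 0)"
    by (rule sum.swap)
  also have "\<dots> = (\<Sum>i\<in>I. if p i \<le> N then \<gamma> i * cis (real (p i) * t0) else 0)"
    by (intro sum.cong refl) (auto simp: sum.delta)
  finally show ?thesis .
qed

section \<open>A computable function with divergent Fourier series\<close>

lemma cis_times_sin: "cis x * of_real (sin y) = (cis (x + y) - cis (x - y)) / (2 * \<i>)"
  by (simp add: complex_eq_iff sin_add cos_add sin_diff cos_diff Re_divide Im_divide)

text \<open>The shift of \<open>t \<in> {-pi..pi}\<close> to \<open>t + 4 \<in> {0..8}\<close> allows all dyadic grids to have natural indices.\<close>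

lemma computable_divergent_fourier:
  fixes d :: "nat \<Rightarrow> nat" and c :: "nat \<Rightarrow> nat \<Rightarrow> real" and t0 :: real
  assumes d: "recursive d" and c: "recursive_real (\<lambda>z. c (pfst z) (psnd z))"
    and bound: "\<And>k u. \<bar>\<Sum>n<d k. c k n * sin (real (Suc n) * u)\<bar> \<le> 3"
    and large: "\<And>l. \<exists>k\<ge>l. 2 ^ k \<le> (\<Sum>n<d k. c k n * cos (real (Suc n) * (t0 + 4)))"
  shows "\<exists>f :: complex \<Rightarrow> complex. computable_on (complex_of_real ` {-pi..pi}) f \<and>
           \<not> convergent (\<lambda>N. fourier_sum (\<lambda>t. f (complex_of_real t)) N t0)"
proof -
  \<comment> \<open>Block \<open>k\<close> is centred at \<open>N k\<close> and lies within the
    frequencies \<open>M k + 1\<close> to \<open>M (Suc k)\<close>, which are disjoint ranges for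
    different \<open>k\<close>. The summand \<open>1\<close> makes \<open>M\<close> strictly
    increasing even if \<open>d j = 0\<close>, whence \<open>k \<le> M k\<close>.\<close>
  define M where "M k = (\<Sum>j<k. 2 * d j + 1)" for k
  define N where "N k = M k + d k + 1" for k
  have MS: "M (Suc k) = M k + 2 * d k + 1" for k by (simp add: M_def)
  have M_mono: "k \<le> l \<Longrightarrow> M k \<le> M l" for k l
    by (rule lift_Suc_mono_le[of M]) (simp_all add: MS)
  have M_ge: "k \<le> M k" for k by (induction k) (simp_all add: MS)
  have freq: "N k + Suc n \<le> M (Suc k)" "M k < N k - Suc n" "N k - Suc n \<le> N k" "N k < N k + Suc n"
    if "n < d k" for k n using that by (simp_all add: MS N_def)
  have freq_le: "N k + Suc n \<le> M K" "N k - Suc n \<le> M K" if "n < d k" "k < K" for k n K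
    using freq[OF that(1)] M_mono[of "Suc k" K] that(2) by simp_all

  define B where "B k u = (\<Sum>n<d k. c k n * sin (real (Suc n) * u))" for k u
  define block where "block k t = of_real (B k (t + 4) / 2 ^ k) * cis (real (N k) * (t + 4))" for k t
  define F where "F t = (\<Sum>k. block k t)" for t
  have block_le: "norm (block k t) \<le> 3 * (1 / 2) ^ k" for k t
    using bound[of k "t + 4"] unfolding block_def norm_mult norm_cis norm_of_real B_def[symmetric]
    by (simp add: power_divide divide_right_mono)
  have summ: "summable (\<lambda>k. 3 * (1 / 2 :: real) ^ k)" by (intro summable_mult summable_geometric) simp
  have "summable (\<lambda>k. block k t)" for t
    by (rule summable_comparison_test'[OF summ]) (rule block_le)
  then have F_sums: "(\<lambda>k. block k t) sums F t" for t unfolding F_def by (rule summable_sums)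
  have F_close: "norm (F t - (\<Sum>k<K. block k t)) \<le> 6 / 2 ^ K" for t K
  proof -
    have "(\<lambda>k. (3 * (1 / 2) ^ K) * (1 / 2 :: real) ^ k) sums ((3 * (1 / 2) ^ K) * (1 / (1 - 1 / 2)))"
      by (intro sums_mult geometric_sums) simp
    then have "(\<Sum>k. 3 * (1 / 2 :: real) ^ (k + K)) = 6 / 2 ^ K"
      by (simp add: sums_iff power_add mult_ac power_divide)
    then show ?thesis using sums_partial_bound[OF F_sums summ block_le, of t K] by simp
  qed

  \<comment> \<open>Each sine term splits into two exponentials, with \<open>True\<close> for the
    frequency above \<open>N k\<close> and \<open>False\<close> for the one below. The phase in
    \<open>\<gamma>\<close> undoes the shift of the variable by \<open>4\<close>.\<close>
  define idx where "idx K = (SIGMA k:{..<K}. {..<d k}) \<times> (UNIV :: bool set)" for K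
  define p where "p = (\<lambda>((k, n), b). if b then N k + Suc n else N k - Suc n)"
  define \<gamma> where "\<gamma> = (\<lambda>((k, n), b). (if b then 1 else - 1) * of_real (c k n / 2 ^ Suc k) / \<i> *
      cis (real (p ((k, n), b)) * 4))"
  have fin: "finite (idx K)" for K unfolding idx_def by auto
  have block_split: "block k t = (\<Sum>n<d k. \<gamma> ((k, n), True) * cis (real (p ((k, n), True)) * t) +
        \<gamma> ((k, n), False) * cis (real (p ((k, n), False)) * t))" for k t
  proof -
    have "block k t = (\<Sum>n<d k. of_real (c k n / 2 ^ k) *
        (cis (real (N k) * (t + 4)) * of_real (sin (real (Suc n) * (t + 4)))))"
      unfolding block_def B_def sum_divide_distrib of_real_sum sum_distrib_right
      by (intro sum.cong refl) simp
    also have "\<dots> = (\<Sum>n<d k. \<gamma> ((k, n), True) * cis (real (p ((k, n), True)) * t) +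
        \<gamma> ((k, n), False) * cis (real (p ((k, n), False)) * t))"
    proof (intro sum.cong refl)
      fix n assume "n \<in> {..<d k}"
      then have n: "Suc n \<le> N k" by (simp add: N_def)
      have 1: "cis (real (N k) * (t + 4) + real (Suc n) * (t + 4)) =
          cis (real (N k + Suc n) * 4) * cis (real (N k + Suc n) * t)"
        unfolding cis_mult by (rule arg_cong[of _ _ cis]) (simp add: algebra_simps)
      have 2: "cis (real (N k) * (t + 4) - real (Suc n) * (t + 4)) =
          cis (real (N k - Suc n) * 4) * cis (real (N k - Suc n) * t)"
        unfolding cis_mult by (rule arg_cong[of _ _ cis]) (use n in \<open>simp add: of_nat_diff algebra_simps\<close>)
      show "of_real (c k n / 2 ^ k) * (cis (real (N k) * (t + 4)) * of_real (sin (real (Suc n) * (t + 4)))) =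
        \<gamma> ((k, n), True) * cis (real (p ((k, n), True)) * t) +
        \<gamma> ((k, n), False) * cis (real (p ((k, n), False)) * t)"
        unfolding cis_times_sin 1 2 by (simp add: \<gamma>_def p_def field_simps)
    qed
    finally show ?thesis .
  qed
  have partial: "(\<Sum>k<K. block k t) = (\<Sum>i\<in>idx K. \<gamma> i * cis (real (p i) * t))" for K t
  proof -
    have "(\<Sum>i\<in>idx K. \<gamma> i * cis (real (p i) * t)) =
      (\<Sum>x\<in>(SIGMA k:{..<K}. {..<d k}). \<Sum>b\<in>UNIV. \<gamma> (x, b) * cis (real (p (x, b)) * t))"
      unfolding idx_def by (subst sum.cartesian_product) (simp add: case_prod_beta)
    also have "\<dots> = (\<Sum>k<K. \<Sum>n<d k. \<Sum>b\<in>UNIV. \<gamma> ((k, n), b) * cis (real (p ((k, n), b)) * t))"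
      by (subst sum.Sigma) (auto simp: case_prod_beta)
    also have "\<dots> = (\<Sum>k<K. block k t)" unfolding block_split by (simp add: UNIV_bool add.commute)
    finally show ?thesis ..
  qed
  have cont_partial: "continuous_on S (\<lambda>t. \<Sum>k<K. block k t)" for S K
    unfolding partial by (intro continuous_intros)
  have cont_F: "continuous_on S F" for S
  proof (rule uniform_limit_theorem)
    show "\<forall>\<^sub>F K in sequentially. continuous_on S (\<lambda>t. \<Sum>k<K. block k t)"
      using cont_partial by simp
    show "uniform_limit S (\<lambda>K t. \<Sum>k<K. block k t) F sequentially"
    proof (rule uniform_limitI)
      fix e :: real assume "0 < e"
      then have "\<forall>\<^sub>F K in sequentially. 6 * (1 / 2) ^ K < e" by (rule eventually_half_power_less)
      then show "\<forall>\<^sub>F K in sequentially. \<forall>t\<in>S. dist (\<Sum>k<K. block k t) (F t) < e"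
      proof (rule eventually_mono)
        fix K assume "6 * (1 / 2) ^ K < e"
        then have "6 / 2 ^ K < e" by (simp add: power_divide)
        then show "\<forall>t\<in>S. dist (\<Sum>k<K. block k t) (F t) < e"
          using F_close[of _ K] le_less_trans by (auto simp: dist_norm norm_minus_commute)
      qed
    qed
  qed simp

  \<comment> \<open>Between the partial sums at \<open>M k\<close> and \<open>N k\<close> exactly
    the lower half of block \<open>k\<close> enters: earlier blocks are contained in both sums,
    later blocks and the upper half in neither.\<close>
  have jump: "1 / 2 \<le> norm (fourier_sum (\<lambda>t. \<Sum>k<K. block k t) (N k) t0 - fourier_sum (\<lambda>t. \<Sum>k<K. block k t) (M k) t0)"
    if k: "k < K" and lk: "2 ^ k \<le> (\<Sum>n<d k. c k n * cos (real (Suc n) * (t0 + 4)))" for k K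
  proof -
    let ?g = "\<lambda>i. \<gamma> i * cis (real (p i) * t0)"
    have "fourier_sum (\<lambda>t. \<Sum>k<K. block k t) (N k) t0 - fourier_sum (\<lambda>t. \<Sum>k<K. block k t) (M k) t0 =
       (\<Sum>i\<in>idx K. (if p i \<le> N k then ?g i else 0) - (if p i \<le> M k then ?g i else 0))"
      unfolding partial fourier_sum_trigonometric[OF fin] sum_subtractf ..
    also have "\<dots> = (\<Sum>i\<in>idx K. if i \<in> ({k} \<times> {..<d k}) \<times> {False} then ?g i else 0)"
    proof (intro sum.cong refl)
      fix i assume "i \<in> idx K"
      then obtain k' n b where i: "i = ((k', n), b)" and n: "n < d k'" by (auto simp: idx_def)
      note fr = freq[OF n]
      consider "k' < k" | "k' = k" | "k < k'" by linarith
      then show "(if p i \<le> N k then ?g i else 0) - (if p i \<le> M k then ?g i else 0) =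
          (if i \<in> ({k} \<times> {..<d k}) \<times> {False} then ?g i else 0)"
      proof cases
        case 1
        have "p i \<le> M k" unfolding i p_def using freq_le[OF n 1] by simp
        moreover have "M k \<le> N k" by (simp add: N_def)
        ultimately show ?thesis using 1 by (simp add: i)
      next
        case 2
        have "M k \<le> N k" by (simp add: N_def)
        show ?thesis
        proof (cases b)
          case True
          then have "N k < p i" using fr(4) by (simp add: i p_def 2)
          then show ?thesis using True \<open>M k \<le> N k\<close> by (simp add: i)
        next
          case False
          then have "p i \<le> N k" "\<not> p i \<le> M k" using fr(2,3) unfolding i p_def 2 by simp_all
          then show ?thesis using False n 2 by (simp add: i)
        qed
      next
        case 3
        have "N k \<le> M (Suc k)" by (simp add: MS N_def)
        also have "M (Suc k) \<le> M k'" using 3 by (intro M_mono) simp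
        also have "M k' < p i" unfolding i p_def using fr by auto
        finally have "N k < p i" .
        moreover have "M k \<le> N k" by (simp add: N_def)
        ultimately show ?thesis using 3 by (simp add: i)
      qed
    qed
    also have "\<dots> = (\<Sum>i\<in>({k} \<times> {..<d k}) \<times> {False}. ?g i)"
    proof -
      have "idx K \<inter> ({k} \<times> {..<d k}) \<times> {False} = ({k} \<times> {..<d k}) \<times> {False}"
        using k by (auto simp: idx_def)
      then show ?thesis using sum.inter_restrict[OF fin, of ?g K "({k} \<times> {..<d k}) \<times> {False}"] by simp
    qed
    also have "\<dots> = (\<Sum>n<d k. ?g ((k, n), False))"
      by (rule sum.reindex_bij_witness[of _ "\<lambda>n. ((k, n), False)" "\<lambda>i. snd (fst i)"]) auto
    also have "\<dots> = (\<i> / 2 ^ Suc k * cis (real (N k) * (t0 + 4))) *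
        (\<Sum>n<d k. of_real (c k n) * cis (- (real (Suc n) * (t0 + 4))))"
      unfolding sum_distrib_left
    proof (intro sum.cong refl)
      fix n assume "n \<in> {..<d k}"
      then have n: "Suc n \<le> N k" by (simp add: N_def)
      have "cis (real (N k - Suc n) * 4) * cis (real (N k - Suc n) * t0) =
          cis (real (N k) * (t0 + 4)) * cis (- (real (Suc n) * (t0 + 4)))"
        unfolding cis_mult by (rule arg_cong[of _ _ cis]) (use n in \<open>simp add: of_nat_diff algebra_simps\<close>)
      then show "?g ((k, n), False) = (\<i> / 2 ^ Suc k * cis (real (N k) * (t0 + 4))) *
          (of_real (c k n) * cis (- (real (Suc n) * (t0 + 4))))"
        by (simp add: \<gamma>_def p_def mult.assoc)
    qed
    finally have eq: "fourier_sum (\<lambda>t. \<Sum>k<K. block k t) (N k) t0 - fourier_sum (\<lambda>t. \<Sum>k<K. block k t) (M k) t0 =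
      (\<i> / 2 ^ Suc k * cis (real (N k) * (t0 + 4))) *
        (\<Sum>n<d k. of_real (c k n) * cis (- (real (Suc n) * (t0 + 4))))" .
    \<comment> \<open>Without its mirror half, the sine polynomial becomes a sum of exponentials
      whose real part is the conjugate cosine polynomial; the factor in front has modulus
      \<open>1 / 2 ^ Suc k\<close>.\<close>
    have "2 ^ k \<le> Re (\<Sum>n<d k. of_real (c k n) * cis (- (real (Suc n) * (t0 + 4))))"
      using lk by (simp add: Re_sum)
    also have "\<dots> \<le> norm (\<Sum>n<d k. of_real (c k n) * cis (- (real (Suc n) * (t0 + 4))))"
      by (rule complex_Re_le_cmod)
    finally have "1 / 2 ^ Suc k * 2 ^ k \<le> 1 / 2 ^ Suc k * norm (\<Sum>n<d k. of_real (c k n) * cis (- (real (Suc n) * (t0 + 4))))"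
      by (intro mult_left_mono) auto
    then show ?thesis unfolding eq norm_mult norm_divide norm_power by simp
  qed

  have divergent: "\<not> convergent (\<lambda>N. fourier_sum F N t0)"
  proof
    assume "convergent (\<lambda>N. fourier_sum F N t0)"
    then have "Cauchy (\<lambda>N. fourier_sum F N t0)" by (rule convergent_Cauchy)
    then obtain l where l: "\<And>m n. m \<ge> l \<Longrightarrow> n \<ge> l \<Longrightarrow> norm (fourier_sum F m t0 - fourier_sum F n t0) < 1 / 4"
      unfolding Cauchy_def dist_norm by (metis zero_less_divide_1_iff zero_less_numeral)
    obtain k where k: "l \<le> k" "2 ^ k \<le> (\<Sum>n<d k. c k n * cos (real (Suc n) * (t0 + 4)))"
      using large by blast
    have lM: "l \<le> M k" using M_ge[of k] k(1) by simp
    have lN: "l \<le> N k" using lM by (simp add: N_def)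
    \<comment> \<open>With \<open>N k\<close> fixed, \<open>K\<close> is taken so large that
      replacing \<open>F\<close> by its first \<open>K\<close> blocks costs less than
      \<open>1 / 8\<close> in each partial sum. A Cauchy bound of \<open>1 / 4\<close> then
      contradicts the jump of \<open>1 / 2\<close>.\<close>
    have "\<forall>\<^sub>F K in sequentially. (2 * real (N k) + 1) * 6 * (1 / 2) ^ K < 1 / 8"
      by (rule eventually_half_power_less) simp
    then have "\<forall>\<^sub>F K in sequentially. k < K \<and> (2 * real (N k) + 1) * 6 * (1 / 2) ^ K < 1 / 8"
      using eventually_gt_at_top[of k] by eventually_elim simp
    then obtain K where K: "k < K" "(2 * real (N k) + 1) * 6 * (1 / 2) ^ K < 1 / 8"
      by (auto simp: eventually_sequentially)
    have near: "norm (fourier_sum F n t0 - fourier_sum (\<lambda>t. \<Sum>k<K. block k t) n t0) < 1 / 8"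
      if "n \<le> N k" for n
    proof -
      have "norm (fourier_sum F n t0 - fourier_sum (\<lambda>t. \<Sum>k<K. block k t) n t0) \<le> (2 * real n + 1) * (6 / 2 ^ K)"
        by (rule norm_fourier_sum_diff_le[OF cont_F cont_partial F_close])
      also have "\<dots> \<le> (2 * real (N k) + 1) * (6 / 2 ^ K)" using that by (intro mult_right_mono) auto
      also have "\<dots> = (2 * real (N k) + 1) * 6 * (1 / 2) ^ K" by (simp add: power_divide)
      finally show ?thesis using K(2) by simp
    qed
    have MN: "M k \<le> N k" by (simp add: N_def)
    have tri: "norm (x - y) \<le> norm (x' - x) + norm (x' - y') + norm (y' - y)" for x y x' y' :: complex
      using norm_triangle_ineq[of "x - x'" "(x' - y') + (y' - y)"] norm_triangle_ineq[of "x' - y'" "y' - y"]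
      by (simp add: norm_minus_commute)
    show False
      using tri[where x = "fourier_sum (\<lambda>t. \<Sum>k<K. block k t) (N k) t0" and
          y = "fourier_sum (\<lambda>t. \<Sum>k<K. block k t) (M k) t0" and
          x' = "fourier_sum F (N k) t0" and y' = "fourier_sum F (M k) t0"]
        jump[OF K(1) k(2)] near[OF order_refl] near[OF MN] l[OF lN lM] by linarith
  qed

  define W where "W K = (\<Sum>k<K. \<Sum>n<d k. \<bar>c k n\<bar>)" for K
  define A where "A K m J j = (\<Sum>k<K. \<Sum>n<d k. c k n / 2 ^ Suc k *
     (sin_taylor J (N k + Suc n) j m - sin_taylor J (N k - Suc n) j m))" for K m J j
  define C where "C K m J j = (\<Sum>k<K. \<Sum>n<d k. c k n / 2 ^ Suc k *
     (cos_taylor J (N k - Suc n) j m - cos_taylor J (N k + Suc n) j m))" for K m J j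
  \<comment> \<open>The tail of the series is at most \<open>6 / 2 ^ K\<close>; the constant
    \<open>7\<close> makes the inclusion in open intervals strict. The second term bounds the error
    of evaluating the first \<open>K\<close> blocks.\<close>
  define \<rho> where "\<rho> K m J = 7 / 2 ^ K + W K * trig_error (M K) J m" for K m J
  have W0: "0 \<le> W K" for K unfolding W_def by (intro sum_nonneg) auto
  have \<rho>0: "0 < \<rho> K m J" for K m J
    unfolding \<rho>_def using W0 trig_error_nonneg by (intro add_pos_nonneg mult_nonneg_nonneg) auto
  \<comment> \<open>The weight \<open>1 / 2 ^ Suc k\<close> is at most \<open>1 / 2\<close>, which
    absorbs the errors of the two trigonometric values in each term.\<close>
  have double_error: "\<bar>(\<Sum>k<K. \<Sum>n<d k. c k n / 2 ^ Suc k * (x k n - y k n)) -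
      (\<Sum>k<K. \<Sum>n<d k. c k n / 2 ^ Suc k * (x' k n - y' k n))\<bar> \<le> W K * e"
    if "\<And>k n. k < K \<Longrightarrow> n < d k \<Longrightarrow> \<bar>x k n - x' k n\<bar> \<le> e" "\<And>k n. k < K \<Longrightarrow> n < d k \<Longrightarrow> \<bar>y k n - y' k n\<bar> \<le> e"
    for K e and x y x' y' :: "nat \<Rightarrow> nat \<Rightarrow> real"
  proof -
    have "\<bar>(\<Sum>k<K. \<Sum>n<d k. c k n / 2 ^ Suc k * (x k n - y k n)) -
        (\<Sum>k<K. \<Sum>n<d k. c k n / 2 ^ Suc k * (x' k n - y' k n))\<bar> =
      \<bar>\<Sum>k<K. \<Sum>n<d k. c k n / 2 ^ Suc k * ((x k n - x' k n) - (y k n - y' k n))\<bar>"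
      unfolding sum_subtractf[symmetric] right_diff_distrib[symmetric] by (simp add: algebra_simps)
    also have "\<dots> \<le> (\<Sum>k<K. \<Sum>n<d k. \<bar>c k n\<bar> * e)"
    proof (rule order_trans[OF sum_abs], rule sum_mono, rule order_trans[OF sum_abs], rule sum_mono)
      fix k n assume "k \<in> {..<K}" "n \<in> {..<d k}"
      then have "\<bar>x k n - x' k n\<bar> \<le> e" "\<bar>y k n - y' k n\<bar> \<le> e" using that by auto
      then have e: "\<bar>(x k n - x' k n) - (y k n - y' k n)\<bar> \<le> 2 * e" by linarith
      have "\<bar>c k n / 2 ^ Suc k * ((x k n - x' k n) - (y k n - y' k n))\<bar> =
         \<bar>c k n\<bar> / 2 ^ Suc k * \<bar>(x k n - x' k n) - (y k n - y' k n)\<bar>" by (simp add: abs_mult)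
      also have "\<dots> \<le> \<bar>c k n\<bar> / 2 * (2 * e)"
      proof (rule mult_mono[OF _ e])
        have "(1 :: real) \<le> 2 ^ k" by simp
        then show "\<bar>c k n\<bar> / 2 ^ Suc k \<le> \<bar>c k n\<bar> / 2" by (intro divide_left_mono) auto
      qed auto
      finally show "\<bar>c k n / 2 ^ Suc k * ((x k n - x' k n) - (y k n - y' k n))\<bar> \<le> \<bar>c k n\<bar> * e" by simp
    qed
    also have "\<dots> = W K * e" by (simp add: W_def sum_distrib_right)
    finally show ?thesis .
  qed
  have accurate: "\<bar>Re (F t) - A K m J j\<bar> < \<rho> K m J" "\<bar>Im (F t) - C K m J j\<bar> < \<rho> K m J"
    if j: "j \<le> 9 * 2 ^ m" "\<bar>(t + 4) - real j / 2 ^ m\<bar> \<le> 1 / 2 ^ m" for t K m J j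
  proof -
    have Re_block: "Re (block k t) = (\<Sum>n<d k. c k n / 2 ^ Suc k *
        (sin (real (N k + Suc n) * (t + 4)) - sin (real (N k - Suc n) * (t + 4))))" (is ?R)
      and Im_block: "Im (block k t) = (\<Sum>n<d k. c k n / 2 ^ Suc k *
        (cos (real (N k - Suc n) * (t + 4)) - cos (real (N k + Suc n) * (t + 4))))" (is ?I) for k
    proof -
      have split: "real (N k + Suc n) * (t + 4) = real (N k) * (t + 4) + real (Suc n) * (t + 4)"
        "real (N k - Suc n) * (t + 4) = real (N k) * (t + 4) - real (Suc n) * (t + 4)" if "n < d k" for n
        using that by (simp_all add: N_def of_nat_diff algebra_simps)
      have "Re (block k t) = (\<Sum>n<d k. c k n * sin (real (Suc n) * (t + 4)) / 2 ^ k * cos (real (N k) * (t + 4)))"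
        unfolding block_def B_def by (simp add: sum_divide_distrib sum_distrib_right)
      also have "\<dots> = (\<Sum>n<d k. c k n / 2 ^ Suc k *
        (sin (real (N k + Suc n) * (t + 4)) - sin (real (N k - Suc n) * (t + 4))))"
      proof (intro sum.cong refl)
        fix n assume "n \<in> {..<d k}"
        then have n: "n < d k" by simp
        show "c k n * sin (real (Suc n) * (t + 4)) / 2 ^ k * cos (real (N k) * (t + 4)) = c k n / 2 ^ Suc k *
          (sin (real (N k + Suc n) * (t + 4)) - sin (real (N k - Suc n) * (t + 4)))"
          unfolding split[OF n] sin_add sin_diff by simp
      qed
      finally show ?R .
      have "Im (block k t) = (\<Sum>n<d k. c k n * sin (real (Suc n) * (t + 4)) / 2 ^ k * sin (real (N k) * (t + 4)))"
        unfolding block_def B_def by (simp add: sum_divide_distrib sum_distrib_right)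
      also have "\<dots> = (\<Sum>n<d k. c k n / 2 ^ Suc k *
        (cos (real (N k - Suc n) * (t + 4)) - cos (real (N k + Suc n) * (t + 4))))"
      proof (intro sum.cong refl)
        fix n assume "n \<in> {..<d k}"
        then have n: "n < d k" by simp
        show "c k n * sin (real (Suc n) * (t + 4)) / 2 ^ k * sin (real (N k) * (t + 4)) = c k n / 2 ^ Suc k *
          (cos (real (N k - Suc n) * (t + 4)) - cos (real (N k + Suc n) * (t + 4)))"
          unfolding split[OF n] cos_add cos_diff by simp
      qed
      finally show ?I .
    qed
    have "\<bar>Re (\<Sum>k<K. block k t) - A K m J j\<bar> \<le> W K * trig_error (M K) J m"
      unfolding A_def Re_sum Re_block
      by (intro double_error sin_taylor_error freq_le j) auto
    moreover have "\<bar>Im (\<Sum>k<K. block k t) - C K m J j\<bar> \<le> W K * trig_error (M K) J m"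
      unfolding C_def Im_sum Im_block
      by (intro double_error cos_taylor_error freq_le j) auto
    moreover have "\<bar>Re (F t) - Re (\<Sum>k<K. block k t)\<bar> \<le> 6 / 2 ^ K" "\<bar>Im (F t) - Im (\<Sum>k<K. block k t)\<bar> \<le> 6 / 2 ^ K"
      using order_trans[OF abs_Re_le_cmod F_close[of t K]] order_trans[OF abs_Im_le_cmod F_close[of t K]] by simp_all
    moreover have "6 / 2 ^ K < (7 / 2 ^ K :: real)" by (simp add: divide_strict_right_mono)
    ultimately show "\<bar>Re (F t) - A K m J j\<bar> < \<rho> K m J" "\<bar>Im (F t) - C K m J j\<bar> < \<rho> K m J"
      unfolding \<rho>_def by linarith+
  qed

  have recM: "recursive (\<lambda>x. M (g x))" if "recursive g" for g
    unfolding M_def by (intro recursive_intros recursive_compose[OF d] that)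
  have recN: "recursive (\<lambda>x. N (g x))" if "recursive g" for g
    unfolding N_def by (intro recursive_intros recM recursive_compose[OF d] that)
  have recc: "recursive_real (\<lambda>x. c (g x) (h x))" if "recursive g" "recursive h" for g h
    using recursive_real_compose[OF c recursive_pair[OF that]] by simp
  let ?K = "\<lambda>w. pfst w" and ?m = "\<lambda>w. pfst (psnd w)" and ?J = "\<lambda>w. pfst (psnd (psnd w))"
    and ?j = "\<lambda>w. psnd (psnd (psnd w))"
  have rec\<rho>: "recursive_real (\<lambda>w. \<rho> (?K w) (?m w) (?J w))"
    unfolding \<rho>_def W_def by (intro recursive_intros recM recc recursive_compose[OF d])
  have recA: "recursive_real (\<lambda>w. A (?K w) (?m w) (?J w) (?j w))"
    unfolding A_def by (intro recursive_intros recN recc recursive_compose[OF d])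
  have recC: "recursive_real (\<lambda>w. C (?K w) (?m w) (?J w) (?j w))"
    unfolding C_def by (intro recursive_intros recN recc recursive_compose[OF d])

  \<comment> \<open>An index \<open>w\<close> lists the number of blocks, the grid level, the number
    of Taylor terms and the grid point. The domain is real, so the imaginary side of the input
    rectangle is free; its length \<open>2 / real (Suc w)\<close> gives every index a rectangle of
    its own.\<close>
  have "computable_on (complex_of_real ` {-pi..pi}) (\<lambda>z. F (Re z))"
  proof (rule computable_onI[where
        a = "\<lambda>w. (real (?j w) - 1) / 2 ^ ?m w - 4" and b = "\<lambda>w. (real (?j w) + 1) / 2 ^ ?m w - 4" and
        c = "\<lambda>w. - (1 / real (Suc w))" and d = "\<lambda>w. 1 / real (Suc w)" and
        a' = "\<lambda>w. A (?K w) (?m w) (?J w) (?j w) - \<rho> (?K w) (?m w) (?J w)" and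
        b' = "\<lambda>w. A (?K w) (?m w) (?J w) (?j w) + \<rho> (?K w) (?m w) (?J w)" and
        c' = "\<lambda>w. C (?K w) (?m w) (?J w) (?j w) - \<rho> (?K w) (?m w) (?J w)" and
        d' = "\<lambda>w. C (?K w) (?m w) (?J w) (?j w) + \<rho> (?K w) (?m w) (?J w)"])
    show "inj (\<lambda>w. 1 / real (Suc w))" by (auto simp: inj_def)
  next
    fix w
    show "(real (?j w) - 1) / 2 ^ ?m w - 4 < (real (?j w) + 1) / 2 ^ ?m w - 4"
      by (simp add: divide_strict_right_mono)
    have "(0 :: real) < 1 / real (Suc w)" by simp
    then show "- (1 / real (Suc w)) < 1 / real (Suc w)" by linarith
    show "A (?K w) (?m w) (?J w) (?j w) - \<rho> (?K w) (?m w) (?J w) < A (?K w) (?m w) (?J w) (?j w) + \<rho> (?K w) (?m w) (?J w)"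
      "C (?K w) (?m w) (?J w) (?j w) - \<rho> (?K w) (?m w) (?J w) < C (?K w) (?m w) (?J w) (?j w) + \<rho> (?K w) (?m w) (?J w)"
      using \<rho>0[of "?K w" "?m w" "?J w"] by linarith+
  next
    fix w z
    assume z: "z \<in> complex_of_real ` {-pi..pi}"
      and R: "Re z \<in> {(real (?j w) - 1) / 2 ^ ?m w - 4<..<(real (?j w) + 1) / 2 ^ ?m w - 4}"
    have "Re z < 4" using z pi_less_4 by auto
    have "real (?j w) / 2 ^ ?m w - 1 / 2 ^ ?m w - 4 < Re z" "Re z < real (?j w) / 2 ^ ?m w + 1 / 2 ^ ?m w - 4"
      using R by (simp_all add: diff_divide_distrib add_divide_distrib)
    then have near: "\<bar>(Re z + 4) - real (?j w) / 2 ^ ?m w\<bar> \<le> 1 / 2 ^ ?m w" by linarith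
    \<comment> \<open>The input interval may reach past the domain by at most one grid step; this is
      why \<open>trig_error\<close> is set up for arguments up to \<open>9\<close> and not
      \<open>8\<close>.\<close>
    moreover have "(1 :: real) / 2 ^ ?m w \<le> 1" by simp
    ultimately have "real (?j w) / 2 ^ ?m w \<le> 9" using \<open>Re z < 4\<close> by linarith
    then have "real (?j w) \<le> real (9 * 2 ^ ?m w)" by (simp add: divide_le_eq)
    then have "?j w \<le> 9 * 2 ^ ?m w" by (simp only: of_nat_le_iff)
    from accurate[OF this near, of "?K w" "?J w"]
    show "Re (F (Re z)) \<in> {A (?K w) (?m w) (?J w) (?j w) - \<rho> (?K w) (?m w) (?J w)<..<
           A (?K w) (?m w) (?J w) (?j w) + \<rho> (?K w) (?m w) (?J w)} \<and>
         Im (F (Re z)) \<in> {C (?K w) (?m w) (?J w) (?j w) - \<rho> (?K w) (?m w) (?J w)<..<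
           C (?K w) (?m w) (?J w) (?j w) + \<rho> (?K w) (?m w) (?J w)}"
      unfolding greaterThanLessThan_iff by linarith
  next
    fix z and e :: real
    assume z: "z \<in> complex_of_real ` {-pi..pi}" and e: "0 < e"
    then have imz: "Im z = 0" and rez: "- 4 < Re z" "Re z < 4" using pi_less_4 by auto
    have "\<forall>\<^sub>F K in sequentially. 7 * (1 / 2) ^ K < e / 4"
      using e by (intro eventually_half_power_less) simp
    then obtain K where "7 * (1 / 2) ^ K < e / 4" by (auto simp: eventually_sequentially)
    then have K: "7 / 2 ^ K < e / 4" by (simp add: power_divide)
    obtain i where i: "2 / e < real i" using reals_Archimedean2 by blast
    have "0 < e / (4 * (W K + 1))" using e W0[of K] by simp
    from trig_error_small[OF this, where M = i and F = "M K"]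
    obtain m J where m: "i \<le> m" and J: "trig_error (M K) J m < e / (4 * (W K + 1))" by blast
    define j where "j = nat \<lfloor>(Re z + 4) * 2 ^ m\<rfloor>"
    define w where "w = prod_encode (K, prod_encode (m, prod_encode (J, j)))"
    have w: "?K w = K" "?m w = m" "?J w = J" "?j w = j" by (simp_all add: w_def)
    \<comment> \<open>Pairing does not decrease its components, so a fine grid level forces a large
      index and thereby a thin rectangle in the imaginary direction too.\<close>
    have "m \<le> w" unfolding w_def using le_prod_encode_1 le_prod_encode_2 order_trans by blast
    have small: "2 / real n < e" if "m < n" for n
    proof -
      have "2 / e < real n" using i m that by linarith
      then show ?thesis using e that by (simp add: field_simps)
    qed
    have "m < 2 ^ m" by (rule less_exp)
    from small[OF this] have small1: "2 / 2 ^ m < e" by simp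
    have small2: "2 / real (Suc w) < e" using \<open>m \<le> w\<close> by (intro small) simp
    have "0 \<le> (Re z + 4) * 2 ^ m" using rez by simp
    then have j: "real j \<le> (Re z + 4) * 2 ^ m" "(Re z + 4) * 2 ^ m < real j + 1" unfolding j_def by linarith+
    then have "(real j - 1) / 2 ^ m - 4 < Re z" "Re z < (real j + 1) / 2 ^ m - 4"
      by (simp_all add: field_simps)
    moreover have "\<rho> K m J < e / 2"
    proof -
      have "W K * trig_error (M K) J m \<le> (W K + 1) * (e / (4 * (W K + 1)))"
        using W0[of K] J trig_error_nonneg[of "M K" J m] by (intro mult_mono) auto
      also have "\<dots> = e / 4"
      proof -
        have "x * (e / (4 * x)) = e / 4" if "x \<noteq> 0" for x :: real using that by simp
        from this[of "W K + 1"] show ?thesis using W0[of K] by linarith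
      qed
      finally show ?thesis using K unfolding \<rho>_def by linarith
    qed
    moreover have "(real j + 1) / 2 ^ m - 4 - ((real j - 1) / 2 ^ m - 4) = 2 / 2 ^ m"
      by (simp add: diff_divide_distrib add_divide_distrib)
    ultimately show "\<exists>w. Re z \<in> {(real (?j w) - 1) / 2 ^ ?m w - 4<..<(real (?j w) + 1) / 2 ^ ?m w - 4} \<and>
       Im z \<in> {- (1 / real (Suc w))<..<1 / real (Suc w)} \<and>
       (real (?j w) + 1) / 2 ^ ?m w - 4 - ((real (?j w) - 1) / 2 ^ ?m w - 4) < e \<and>
       1 / real (Suc w) - - (1 / real (Suc w)) < e \<and>
       A (?K w) (?m w) (?J w) (?j w) + \<rho> (?K w) (?m w) (?J w) -
         (A (?K w) (?m w) (?J w) (?j w) - \<rho> (?K w) (?m w) (?J w)) < e \<and>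
       C (?K w) (?m w) (?J w) (?j w) + \<rho> (?K w) (?m w) (?J w) -
         (C (?K w) (?m w) (?J w) (?j w) - \<rho> (?K w) (?m w) (?J w)) < e"
      using small1 small2 by (intro exI[of _ w]) (unfold w imz, simp)
  qed (intro recursive_intros rec\<rho> recA recC)+
  then show ?thesis using divergent by (intro exI[of _ "\<lambda>z. F (Re z)"]) simp
qed

section \<open>Dyadic approximation of open sets\<close>

lemma dyadic_floor_set:
  "{x :: real. \<lfloor>x * 2 ^ s\<rfloor> = i} = {of_int i / 2 ^ s..<(of_int i + 1) / 2 ^ s}"
  by (auto simp: floor_eq_iff field_simps)

lemma emeasure_dyadic:
  assumes "finite Q"
  shows "emeasure lborel {x :: real. \<lfloor>x * 2 ^ s\<rfloor> \<in> Q} = ennreal (real (card Q) / 2 ^ s)"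
proof -
  have *: "emeasure lborel {x :: real. \<lfloor>x * 2 ^ s\<rfloor> = i} = ennreal (1 / 2 ^ s)" for i
    unfolding dyadic_floor_set by (subst emeasure_lborel_Ico) (auto simp: divide_right_mono add_divide_distrib)
  have "emeasure lborel (\<Union>i\<in>Q. {x :: real. \<lfloor>x * 2 ^ s\<rfloor> = i}) =
      (\<Sum>i\<in>Q. emeasure lborel {x :: real. \<lfloor>x * 2 ^ s\<rfloor> = i})"
  proof (rule sum_emeasure[symmetric])
    show "(\<lambda>i. {x :: real. \<lfloor>x * 2 ^ s\<rfloor> = i}) ` Q \<subseteq> sets lborel" by (auto simp: dyadic_floor_set)
    show "disjoint_family_on (\<lambda>i. {x :: real. \<lfloor>x * 2 ^ s\<rfloor> = i}) Q" by (auto simp: disjoint_family_on_def)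
  qed (rule assms)
  also have "\<dots> = ennreal (real (card Q) / 2 ^ s)"
    unfolding * by (simp add: ennreal_of_nat_eq_real_of_nat ennreal_mult[symmetric])
  also have "(\<Union>i\<in>Q. {x :: real. \<lfloor>x * 2 ^ s\<rfloor> = i}) = {x. \<lfloor>x * 2 ^ s\<rfloor> \<in> Q}" by auto
  finally show ?thesis .
qed

lemma dyadic_set_fmeasurable:
  assumes "finite Q" shows "{x :: real. \<lfloor>x * 2 ^ s\<rfloor> \<in> Q} \<in> fmeasurable lborel"
proof -
  have "{x :: real. \<lfloor>x * 2 ^ s\<rfloor> \<in> Q} = (\<Union>i\<in>Q. {x. \<lfloor>x * 2 ^ s\<rfloor> = i})" by auto
  also have "\<dots> \<in> sets lborel" unfolding dyadic_floor_set using assms by auto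
  finally show ?thesis using emeasure_dyadic[OF assms] by (auto simp: fmeasurable_def)
qed

lemma measure_dyadic:
  "finite Q \<Longrightarrow> measure lborel {x :: real. \<lfloor>x * 2 ^ s\<rfloor> \<in> Q} = real (card Q) / 2 ^ s"
  by (simp add: measure_def emeasure_dyadic)

text \<open>Shifting \<open>x\<close> by a large natural number makes it positive, so that the end
  points are described by natural numbers only, in the form coded by \<open>lo\<close> and
  \<open>hi\<close> below.\<close>

lemma rational_interval_between:
  fixes x e :: real
  assumes "0 < e"
  obtains a b d r :: nat where "real a / real (Suc d) - real r < x" "x < real b / real (Suc d) - real r"
    "x - e < real a / real (Suc d) - real r" "real b / real (Suc d) - real r < x + e"
proof -
  obtain d where d: "1 / real (Suc d) < e" using assms nat_approx_posE by blast
  obtain r :: nat where r: "\<bar>x\<bar> + 1 < real r" using reals_Archimedean2 by blast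
  define y where "y = (x + real r) * real (Suc d)"
  have "1 \<le> x + real r" using r by linarith
  then have "1 * 1 \<le> y" unfolding y_def by (intro mult_mono) auto
  then have y: "0 < y" by simp
  define a where "a = nat (\<lceil>y\<rceil> - 1)"
  define b where "b = nat (\<lfloor>y\<rfloor> + 1)"
  have ab: "real a < y" "y - 1 \<le> real a" "y < real b" "real b \<le> y + 1"
    unfolding a_def b_def using y by linarith+
  have yx: "y / real (Suc d) - real r = x" unfolding y_def by simp
  have "real a / real (Suc d) < y / real (Suc d)" "y / real (Suc d) < real b / real (Suc d)"
    "y / real (Suc d) - 1 / real (Suc d) \<le> real a / real (Suc d)" "real b / real (Suc d) \<le> y / real (Suc d) + 1 / real (Suc d)"
    unfolding diff_divide_distrib[symmetric] add_divide_distrib[symmetric]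
    using ab by (intro divide_strict_right_mono divide_right_mono; simp)+
  then show ?thesis using that[of a d r b] yx d by linarith
qed

section \<open>From a Schnorr test to finite unions of dyadic intervals\<close>

text \<open>The left side is the total length of the \<open>k\<close>th finite union below:
  \<open>k + 1\<close> increments and one entire component, each of measure at most
  \<open>1 / 2 ^ (2 ^ (k + 5))\<close>. Because \<open>exp (1 / 2) \<le> 2\<close>, the denominator
  is at least \<open>exp (16 * 2 ^ k)\<close>.\<close>

lemma exp_exponent_bound: "(real k + 2) / 2 ^ (2 ^ (k + 5)) \<le> exp (- (2 ^ k + 2)) / 8"
proof -
  define P :: real where "P = 2 ^ k"
  have P: "1 \<le> P" "real k \<le> P" unfolding P_def
    using less_imp_le[OF of_nat_less_two_power[of k, where 'a = real]] by simp_all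
  have "exp (1 / 2) \<le> (2 :: real)" by (rule exp_half_le2)
  then have big: "exp (1 / 2) ^ n \<le> (2 :: real) ^ n" for n by (intro power_mono) auto
  have "exp (16 * P) = exp (real (2 ^ (k + 5)) * (1 / 2))"
    by (rule arg_cong[of _ _ exp]) (simp add: P_def power_add)
  also have "\<dots> = exp (1 / 2) ^ (2 ^ (k + 5))" by (rule exp_of_nat_mult)
  also note big
  finally have big: "exp (16 * P) \<le> 2 ^ (2 ^ (k + 5))" .
  have "8 * (real k + 2) * exp (P + 2) \<le> exp 7 * exp (real k + 1) * exp (P + 2)"
    using exp_ge_add_one_self[of 7] exp_ge_add_one_self[of "real k + 1"]
    by (intro mult_mono) auto
  also have "\<dots> = exp (7 + (real k + 1) + (P + 2))" by (simp only: exp_add)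
  also have "\<dots> \<le> exp (16 * P)" using P by simp
  also note big
  finally have "8 * (real k + 2) * exp (P + 2) \<le> 2 ^ (2 ^ (k + 5))" .
  moreover have "x / B \<le> 1 / E / 8" if "8 * x * E \<le> B" "0 < B" "0 < E" for x B E :: real
    using that by (simp add: field_simps)
  ultimately show ?thesis unfolding P_def[symmetric] exp_minus inverse_eq_divide by simp
qed

text \<open>Let \<open>l\<close> be given; \<open>t0\<close> lies in the component
  \<open>V (h l)\<close>. If it has been found there by stage \<open>sk l\<close>, then the
  \<open>l\<close>th union contains it. Otherwise it is found between \<open>sk k\<close> and
  \<open>sk (Suc k)\<close> for some \<open>k \<ge> l\<close>, and the \<open>k\<close>th union,
  which takes up all increments of the components \<open>h 0\<close> to \<open>h k\<close>, contains
  it. The increments are small because \<open>\<sigma> k\<close> is a stage after which each of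
  these components hides at most \<open>1 / 2 ^ h k\<close>.\<close>

lemma schnorr_test_dyadic_cover:
  fixes V :: "nat \<Rightarrow> real set"
  assumes test: "schnorr_test V" and t0: "t0 \<in> (\<Inter>n. V n)" "t0 \<in> {-4..<4}"
  obtains L g where "recursive L" "decidable (\<lambda>z. g (pfst z) (psnd z))"
    "\<And>k. real (card {y. y < 8 * 2 ^ L k \<and> g k y}) / 2 ^ L k \<le> exp (- (2 ^ k + 2)) / 8"
    "\<And>l. \<exists>k\<ge>l. g k (nat \<lfloor>(t0 + 4) * 2 ^ L k\<rfloor>)"
proof -
  have open_V: "open (V n)" for n using test by (simp add: schnorr_test_def computable_open_sequence_def)
  have V_le: "emeasure lborel (V n) \<le> ennreal (1 / 2 ^ n)" for n using test by (simp add: schnorr_test_def)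
  then have V_fin: "V n \<in> fmeasurable lborel" for n
    using open_V[of n] le_less_trans[OF V_le[of n]] by (auto simp: fmeasurable_def)
  have V_measure: "measure lborel (V n) \<le> 1 / 2 ^ n" for n
    using enn2real_mono[OF V_le[of n]] by (simp add: measure_def)
  from test obtain q :: "nat \<times> nat \<Rightarrow> rat" where
    q_comp: "computable_partial prod_encode rat_enc (\<lambda>nk. Some (q nk))" and
    q: "\<And>n k. \<bar>of_rat (q (n, k)) - measure lborel (V n)\<bar> < 1 / 2 ^ k"
    unfolding schnorr_test_def computable_real_sequence_def by blast
  obtain Pq where Pq: "partial_recursive Pq" "\<And>x. Pq (prod_encode x) = Some (rat_enc (q x))"
    using q_comp unfolding computable_partial_def by auto
  have "Pq z = Some (rat_enc (q (prod_decode z)))" for z using Pq(2)[of "prod_decode z"] by simp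
  then have "Pq = (\<lambda>z. Some (rat_enc (q (prod_decode z))))" by (rule ext)
  with Pq(1) have "recursive (\<lambda>z. rat_enc (q (prod_decode z)))" by (simp add: recursive_def)
  from recursive_real_compose[OF recursive_real_of_rat_enc[OF this] recursive_pair]
  have rec_q: "recursive_real (\<lambda>x. of_rat (q (f x, f' x)))" if "recursive f" "recursive f'" for f f'
    using that by simp

  \<comment> \<open>Every number \<open>v\<close> codes two rational end points with a common
    denominator and a common shift to the left.\<close>
  define lo where "lo v = real (pfst (pfst v)) / real (Suc (pfst (psnd v))) - real (psnd (psnd v))" for v
  define hi where "hi v = real (psnd (pfst v)) / real (Suc (pfst (psnd v))) - real (psnd (psnd v))" for v
  have rec_lo: "recursive_real (\<lambda>x. lo (f x))" and rec_hi: "recursive_real (\<lambda>x. hi (f x))"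
    if "recursive f" for f
    unfolding lo_def hi_def by (intro recursive_intros that)+
  from rec_lo[OF recursive_id] obtain qlo where qlo: "\<And>v. of_rat (qlo v) = lo v" "recursive (\<lambda>v. rat_enc (qlo v))"
    by (rule recursive_real_rat_enc) blast
  from rec_hi[OF recursive_id] obtain qhi where qhi: "\<And>v. of_rat (qhi v) = hi v" "recursive (\<lambda>v. rat_enc (qhi v))"
    by (rule recursive_real_rat_enc) blast
  from test have "computably_enumerable (prod_enc id (prod_enc rat_enc rat_enc))
       {(n, a, b). a < b \<and> {of_rat a..of_rat b} \<subseteq> V n}"
    by (simp add: schnorr_test_def computable_open_sequence_def)
  then obtain T where T: "decidable T"
    "\<And>x s s'. T (prod_encode (x, s)) \<Longrightarrow> s \<le> s' \<Longrightarrow> T (prod_encode (x, s'))"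
    "\<And>x. x \<in> {(n, a, b). a < b \<and> {of_rat a..of_rat b} \<subseteq> V n} \<longleftrightarrow>
       (\<exists>s. T (prod_encode (prod_enc id (prod_enc rat_enc rat_enc) x, s)))"
    by (rule computably_enumerable_stages) blast
  define U where "U n v s \<longleftrightarrow>
    T (prod_encode (prod_encode (n, prod_encode (rat_enc (qlo v), rat_enc (qhi v))), s))" for n v s
  have dec_U: "decidable (\<lambda>x. U (f x) (f' x) (f'' x))"
    if "recursive f" "recursive f'" "recursive f''" for f f' f''
    unfolding U_def
    by (intro decidable_compose[OF T(1)] recursive_intros recursive_compose[OF qlo(2)] recursive_compose[OF qhi(2)] that)
  have U_mono: "U n v s \<Longrightarrow> s \<le> s' \<Longrightarrow> U n v s'" for n v s s' unfolding U_def by (rule T(2))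
  have U_iff: "(\<exists>s. U n v s) \<longleftrightarrow> lo v < hi v \<and> {lo v..hi v} \<subseteq> V n" for n v
    using T(3)[of "(n, qlo v, qhi v)"] unfolding U_def
    by (simp add: prod_enc_def qlo(1)[symmetric] qhi(1)[symmetric] of_rat_less)

  \<comment> \<open>The stage \<open>s\<close> plays three roles: bound on the codes of intervals,
    running time of the enumeration and dyadic level. This keeps the condition decidable and lets it
    persist in the subintervals at later stages.\<close>
  define \<tau> where "\<tau> n s i \<longleftrightarrow> (\<exists>v<s. U n v s \<and> lo v \<le> of_int i / 2 ^ s \<and> (of_int i + 1) / 2 ^ s \<le> hi v)"
    for n s and i :: int
  have dec_\<tau>: "decidable (\<lambda>x. \<tau> (n x) (s x) (int (a x) - int (b x)))"
    if rec: "recursive n" "recursive s" "recursive a" "recursive b" for n s a b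
  proof -
    have "decidable (\<lambda>x. \<exists>v<s x. U (n x) v (s x) \<and> lo v \<le> (real (a x) - real (b x)) / 2 ^ s x \<and>
        ((real (a x) - real (b x)) + 1) / 2 ^ s x \<le> hi v)"
      by (intro recursive_intros dec_U rec_lo rec_hi rec recursive_compose[OF rec(1)] recursive_compose[OF rec(2)]
          recursive_compose[OF rec(3)] recursive_compose[OF rec(4)])
    then show ?thesis by (simp add: \<tau>_def)
  qed
  have \<tau>_subset: "x \<in> V n" if "\<tau> n s \<lfloor>x * 2 ^ s\<rfloor>" for n s x
  proof -
    from that obtain v where v: "U n v s" "lo v \<le> of_int \<lfloor>x * 2 ^ s\<rfloor> / 2 ^ s" "(of_int \<lfloor>x * 2 ^ s\<rfloor> + 1) / 2 ^ s \<le> hi v"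
      unfolding \<tau>_def by blast
    have "x \<in> {x. \<lfloor>x * 2 ^ s\<rfloor> = \<lfloor>x * 2 ^ s\<rfloor>}" by simp
    then have "x \<in> {of_int \<lfloor>x * 2 ^ s\<rfloor> / 2 ^ s..<(of_int \<lfloor>x * 2 ^ s\<rfloor> + 1) / 2 ^ s}"
      using dyadic_floor_set[of s "\<lfloor>x * 2 ^ s\<rfloor>"] by blast
    then have "x \<in> {lo v..hi v}" using v by auto
    then show ?thesis using v(1) U_iff by blast
  qed
  have \<tau>_mono: "\<tau> n s' \<lfloor>x * 2 ^ s'\<rfloor>" if tau: "\<tau> n s \<lfloor>x * 2 ^ s\<rfloor>" and le: "s \<le> s'" for n s s' and x :: real
  proof -
    from tau obtain v where v: "v < s" "U n v s" "lo v \<le> of_int \<lfloor>x * 2 ^ s\<rfloor> / 2 ^ s" "(of_int \<lfloor>x * 2 ^ s\<rfloor> + 1) / 2 ^ s \<le> hi v"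
      unfolding \<tau>_def by blast
    define D :: int where "D = 2 ^ (s' - s)"
    define i where "i = \<lfloor>x * 2 ^ s'\<rfloor>"
    have D: "0 < D" "(2 :: real) ^ s' = 2 ^ s * of_int D"
      using le by (simp_all add: D_def power_add[symmetric])
    have iD: "\<lfloor>x * 2 ^ s\<rfloor> = i div D" using floor_dyadic_div[OF le, of x] by (simp add: i_def D_def)
    have "0 \<le> i mod D" "i mod D < D" using D(1) by simp_all
    then have "i div D * D \<le> i" "i + 1 \<le> (i div D + 1) * D"
      using div_mult_mod_eq[of i D] unfolding distrib_right mult_1 by linarith+
    then have "real_of_int (i div D * D) \<le> of_int i" "real_of_int (i + 1) \<le> of_int ((i div D + 1) * D)"
      by (simp_all only: of_int_le_iff)
    then have "of_int (i div D) / 2 ^ s \<le> real_of_int i / 2 ^ s'" "(real_of_int i + 1) / 2 ^ s' \<le> (of_int (i div D) + 1) / 2 ^ s"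
      unfolding D(2) divide_divide_eq_left[symmetric] mult.commute[of "2 ^ s"]
      using D(1) by (intro divide_right_mono; simp add: le_divide_eq divide_le_eq)+
    then show ?thesis using v U_mono[OF v(2) le] le unfolding \<tau>_def iD i_def[symmetric]
      by (intro exI[of _ v]) auto
  qed
  have \<tau>_eventually: "\<exists>s. \<tau> n s \<lfloor>x * 2 ^ s\<rfloor>" if x: "x \<in> V n" for n x
  proof -
    obtain e where e: "0 < e" "ball x e \<subseteq> V n" using open_V[of n] x open_contains_ball by blast
    obtain a b d r :: nat where ab: "real a / real (Suc d) - real r < x" "x < real b / real (Suc d) - real r"
      "x - e < real a / real (Suc d) - real r" "real b / real (Suc d) - real r < x + e"
      using e(1) by (rule rational_interval_between)
    define v where "v = prod_encode (prod_encode (a, b), prod_encode (d, r))"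
    have v: "lo v < x" "x < hi v" "x - e < lo v" "hi v < x + e" using ab by (simp_all add: v_def lo_def hi_def)
    have "{lo v..hi v} \<subseteq> ball x e" using v by (auto simp: dist_real_def)
    then obtain s0 where s0: "U n v s0" using U_iff[of n v] v e(2) by fastforce
    have "\<forall>\<^sub>F s in sequentially. 1 * (1 / 2) ^ s < min (x - lo v) (hi v - x)"
      using v by (intro eventually_half_power_less) simp
    then have "\<forall>\<^sub>F s in sequentially. v < s \<and> s0 \<le> s \<and> 1 * (1 / 2) ^ s < min (x - lo v) (hi v - x)"
      using eventually_gt_at_top[of v] eventually_ge_at_top[of s0] by eventually_elim simp
    then obtain s where s: "v < s" "s0 \<le> s" "1 * (1 / 2) ^ s < min (x - lo v) (hi v - x)"
      by (auto simp: eventually_sequentially)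
    have small: "1 / 2 ^ s < x - lo v" "1 / 2 ^ s < hi v - x" using s(3) by (simp_all add: power_divide)
    define i where "i = \<lfloor>x * 2 ^ s\<rfloor>"
    have "x \<in> {x. \<lfloor>x * 2 ^ s\<rfloor> = i}" by (simp add: i_def)
    then have "of_int i / 2 ^ s \<le> x" "x < (of_int i + 1) / 2 ^ s" unfolding dyadic_floor_set by simp_all
    then have "lo v \<le> of_int i / 2 ^ s" "(of_int i + 1) / 2 ^ s \<le> hi v"
      using small by (simp_all add: add_divide_distrib)
    then have "\<tau> n s i" unfolding \<tau>_def using s(1) U_mono[OF s0 s(2)] by blast
    then show ?thesis by (auto simp: i_def)
  qed

  \<comment> \<open>The window from \<open>- s\<close> to \<open>s\<close> keeps the number of
    intervals finite and exhausts the line as \<open>s\<close> grows.\<close>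
  define Q where "Q n s = {i. - int (s * 2 ^ s) \<le> i \<and> i < int (s * 2 ^ s) \<and> \<tau> n s i}" for n s
  define S where "S n s = {x :: real. \<lfloor>x * 2 ^ s\<rfloor> \<in> Q n s}" for n s
  have fin_Q: "finite (Q n s)" for n s
    by (rule finite_subset[of _ "{- int (s * 2 ^ s)..int (s * 2 ^ s)}"]) (auto simp: Q_def)
  have S_iff: "x \<in> S n s \<longleftrightarrow> - real s \<le> x \<and> x < real s \<and> \<tau> n s \<lfloor>x * 2 ^ s\<rfloor>" for x n s
  proof -
    have pos: "(0 :: real) < 2 ^ s" by simp
    have "- int (s * 2 ^ s) \<le> \<lfloor>x * 2 ^ s\<rfloor> \<longleftrightarrow> - real s \<le> x"
      using mult_le_cancel_right_pos[OF pos, of "- real s" x] by (simp add: le_floor_iff)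
    moreover have "\<lfloor>x * 2 ^ s\<rfloor> < int (s * 2 ^ s) \<longleftrightarrow> x < real s"
      using pos by (auto simp: floor_less_iff)
    ultimately show ?thesis unfolding S_def Q_def by simp
  qed
  have S_fm: "S n s \<in> fmeasurable lborel" for n s unfolding S_def by (rule dyadic_set_fmeasurable[OF fin_Q])
  have S_mono: "S n s \<subseteq> S n s'" if "s \<le> s'" for n s s'
    using that \<tau>_mono[of n s] by (auto simp: S_iff)
  have S_Union: "(\<Union>s. S n s) = V n" for n
  proof
    show "(\<Union>s. S n s) \<subseteq> V n" using \<tau>_subset by (auto simp: S_iff)
    show "V n \<subseteq> (\<Union>s. S n s)"
    proof
      fix x assume "x \<in> V n"
      then obtain s where s: "\<tau> n s \<lfloor>x * 2 ^ s\<rfloor>" using \<tau>_eventually by blast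
      obtain r :: nat where r: "\<bar>x\<bar> < real r" using reals_Archimedean2 by blast
      have "x \<in> S n (max s r)" unfolding S_iff using r \<tau>_mono[OF s, of "max s r"] by auto
      then show "x \<in> (\<Union>s. S n s)" by blast
    qed
  qed
  have S_lim: "(\<lambda>s. measure lborel (S n s)) \<longlonglongrightarrow> measure lborel (V n)" for n
  proof -
    have "(\<lambda>s. measure lborel (S n s)) \<longlonglongrightarrow> measure lborel (\<Union>s. S n s)"
    proof (rule Lim_measure_incseq)
      show "range (S n) \<subseteq> sets lborel" using S_fm by (auto simp: fmeasurable_def)
      show "incseq (S n)" using S_mono by (auto simp: incseq_def)
      show "emeasure lborel (\<Union>s. S n s) \<noteq> \<infinity>" unfolding S_Union using V_fin[of n] by (auto simp: fmeasurable_def)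
    qed
    then show ?thesis unfolding S_Union .
  qed
  have S_le_V: "measure lborel (S n s) \<le> measure lborel (V n)" for n s
    using S_Union[of n] by (intro measure_mono_fmeasurable V_fin fmeasurableD S_fm) blast

  \<comment> \<open>The indices are shifted into the natural numbers, so that the measure found at
    stage \<open>s\<close> is given by a recursive count.\<close>
  define cnt where "cnt n s = (\<Sum>x<2 * (s * 2 ^ s). of_bool (\<tau> n s (int x - int (s * 2 ^ s))) :: nat)" for n s
  have cnt: "real (cnt n s) / 2 ^ s = measure lborel (S n s)" for n s
  proof -
    have "bij_betw (\<lambda>x. int x - int R) {x. x < 2 * R \<and> \<tau> n s (int x - int R)}
        {i. - int R \<le> i \<and> i < int R \<and> \<tau> n s i}" for R
      by (rule bij_betw_byWitness[where f' = "\<lambda>i. nat (i + int R)"]) auto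
    from bij_betw_same_card[OF this[of "s * 2 ^ s"]]
    have "card (Q n s) = card {x. x < 2 * (s * 2 ^ s) \<and> \<tau> n s (int x - int (s * 2 ^ s))}"
      by (simp add: Q_def)
    also have "\<dots> = cnt n s"
      unfolding cnt_def by (simp add: sum.If_cases of_bool_def Collect_conj_eq lessThan_def)
    finally show ?thesis unfolding S_def using measure_dyadic[OF fin_Q, of s n s] by simp
  qed
  have rec_cnt: "recursive (\<lambda>x. cnt (f x) (f' x))" if "recursive f" "recursive f'" for f f'
    unfolding cnt_def
    by (intro recursive_intros dec_\<tau> recursive_compose[OF that(1)] recursive_compose[OF that(2)] that)

  define h :: "nat \<Rightarrow> nat" where "h k = 2 ^ (k + 5)" for k
  have rec_h: "recursive (\<lambda>x. h (f x))" if "recursive f" for f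
    unfolding h_def by (intro recursive_intros that)
  \<comment> \<open>As \<open>q\<close> is within \<open>1 / 2 ^ (h k + 2)\<close> of the measure,
    the threshold lies strictly below it and is passed at some stage. Passing it leaves at most
    \<open>3 / 2 ^ (h k + 2)\<close>, which is below \<open>1 / 2 ^ h k\<close>.\<close>
  define ok where "ok k s \<longleftrightarrow> (\<forall>n<Suc k. of_rat (q (h n, h k + 2)) - 2 / 2 ^ (h k + 2) < real (cnt (h n) s) / 2 ^ s)" for k s
  have dec_ok: "decidable (\<lambda>z. ok (pfst z) (psnd z))"
    unfolding ok_def by (intro recursive_intros rec_q rec_cnt rec_h)
  have ex_ok: "\<exists>s. ok k s" for k
  proof -
    have "\<forall>\<^sub>F s in sequentially. of_rat (q (h n, h k + 2)) - 2 / 2 ^ (h k + 2) < measure lborel (S (h n) s)" for n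
    proof (rule order_tendstoD(1)[OF S_lim])
      have "(0 :: real) < 1 / 2 ^ (h k + 2)" by simp
      then show "of_rat (q (h n, h k + 2)) - 2 / 2 ^ (h k + 2) < measure lborel (V (h n))"
        using q[of "h n" "h k + 2"] by linarith
    qed
    then have "\<forall>\<^sub>F s in sequentially. \<forall>n\<in>{..<Suc k}. of_rat (q (h n, h k + 2)) - 2 / 2 ^ (h k + 2) < measure lborel (S (h n) s)"
      by (intro eventually_ball_finite) auto
    then show ?thesis by (auto simp: eventually_sequentially ok_def cnt)
  qed
  define \<sigma> where "\<sigma> k = (LEAST s. ok k s)" for k
  have rec_\<sigma>: "recursive \<sigma>" unfolding \<sigma>_def by (rule recursive_Least[OF dec_ok ex_ok])
  have ok_\<sigma>: "ok k (\<sigma> k)" for k unfolding \<sigma>_def using ex_ok by (rule LeastI_ex)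
  have S_close: "measure lborel (V (h n)) - measure lborel (S (h n) s) \<le> 1 / 2 ^ h k"
    if "n \<le> k" "\<sigma> k \<le> s" for n k s
  proof -
    have "of_rat (q (h n, h k + 2)) - 2 / 2 ^ (h k + 2) < measure lborel (S (h n) (\<sigma> k))"
      using ok_\<sigma>[of k] that(1) unfolding ok_def cnt by simp
    also have "\<dots> \<le> measure lborel (S (h n) s)"
      by (intro measure_mono_fmeasurable S_mono that S_fm fmeasurableD)
    finally have "measure lborel (V (h n)) - measure lborel (S (h n) s) \<le> 3 * (1 / 2 ^ (h k + 2))"
      using q[of "h n" "h k + 2"] by linarith
    moreover have "(1 :: real) / 2 ^ (h k + 2) = 1 / 2 ^ h k / 4" "(0 :: real) \<le> 1 / 2 ^ h k"
      by (simp_all add: power_add)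
    moreover have "x \<le> a" if "x \<le> 3 * b" "b = a / 4" "0 \<le> a" for x a b :: real
      using that by linarith
    ultimately show ?thesis by blast
  qed

  \<comment> \<open>The sum makes the stages monotone and at least \<open>\<sigma> k\<close>, the
    \<open>4\<close> puts all of \<open>{-4..<4}\<close> into the window, and the last summand makes
    the stages unbounded.\<close>
  define sk where "sk k = (\<Sum>j<Suc k. \<sigma> j) + 4 + k" for k
  define L where "L k = sk (Suc k)" for k
  have rec_sk: "recursive (\<lambda>x. sk (f x))" if "recursive f" for f
    unfolding sk_def by (intro recursive_intros recursive_compose[OF rec_\<sigma>] that)
  have sk: "\<sigma> k \<le> sk k" "4 \<le> sk k" "k \<le> sk k" "sk k \<le> L k" for k
    by (simp_all add: sk_def L_def)
  define anc where "anc k y = y div 2 ^ (L k - sk k)" for k and y :: nat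
  \<comment> \<open>The part of the first \<open>k\<close> sets found between stages \<open>sk k\<close> and \<open>L k\<close>, and the \<open>k\<close>th set as known at stage \<open>sk k\<close>.\<close>
  define g where "g k y \<longleftrightarrow> (\<exists>n<Suc k. \<tau> (h n) (L k) (int y - int (4 * 2 ^ L k)) \<and>
       \<not> \<tau> (h n) (sk k) (int (anc k y) - int (4 * 2 ^ sk k))) \<or>
     \<tau> (h k) (sk k) (int (anc k y) - int (4 * 2 ^ sk k))" for k y
  have dec_g: "decidable (\<lambda>z. g (pfst z) (psnd z))"
    unfolding g_def anc_def L_def by (intro recursive_intros dec_\<tau> rec_h rec_sk)
  have grid: "\<lfloor>x * 2 ^ L k\<rfloor> = int y - int (4 * 2 ^ L k) \<Longrightarrow>
      \<lfloor>x * 2 ^ sk k\<rfloor> = int (anc k y) - int (4 * 2 ^ sk k)" for x :: real and k y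
  proof -
    assume "\<lfloor>x * 2 ^ L k\<rfloor> = int y - int (4 * 2 ^ L k)"
    then have "\<lfloor>x * 2 ^ sk k\<rfloor> = (int y - int (4 * 2 ^ L k)) div 2 ^ (L k - sk k)"
      using floor_dyadic_div[OF sk(4)[of k], of x] by simp
    also have "int (4 * 2 ^ L k) = (4 * 2 ^ sk k) * 2 ^ (L k - sk k)"
      using sk(4)[of k] by (simp add: power_add[symmetric])
    also have "(int y - (4 * 2 ^ sk k) * 2 ^ (L k - sk k)) div 2 ^ (L k - sk k) = int y div 2 ^ (L k - sk k) - 4 * 2 ^ sk k"
      using div_mult_self1[of "2 ^ (L k - sk k)" "int y" "- (4 * 2 ^ sk k)"] by simp
    also have "int y div 2 ^ (L k - sk k) = int (anc k y)" by (simp add: anc_def zdiv_int)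
    finally show "\<lfloor>x * 2 ^ sk k\<rfloor> = int (anc k y) - int (4 * 2 ^ sk k)" by simp
  qed
  have in_S: "x \<in> S n s \<longleftrightarrow> \<tau> n s \<lfloor>x * 2 ^ s\<rfloor>" if "x \<in> {-4..<4}" "4 \<le> s" for x n s
  proof -
    have "(4 :: real) \<le> real s" using that(2) by simp
    then show ?thesis unfolding S_iff using that(1) by auto
  qed

  have "real (card {y. y < 8 * 2 ^ L k \<and> g k y}) / 2 ^ L k \<le> exp (- (2 ^ k + 2)) / 8" for k
  proof -
    define Y where "Y = (\<lambda>y. int y - int (4 * 2 ^ L k)) ` {y. y < 8 * 2 ^ L k \<and> g k y}"
    define X where "X = {x :: real. \<lfloor>x * 2 ^ L k\<rfloor> \<in> Y}"
    have fin_Y: "finite Y" unfolding Y_def by auto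
    have "card Y = card {y. y < 8 * 2 ^ L k \<and> g k y}"
      unfolding Y_def by (rule card_image) (auto simp: inj_on_def)
    then have "real (card {y. y < 8 * 2 ^ L k \<and> g k y}) / 2 ^ L k = measure lborel X"
      unfolding X_def measure_dyadic[OF fin_Y] by simp
    also have "\<dots> \<le> measure lborel ((\<Union>n<Suc k. S (h n) (L k) - S (h n) (sk k)) \<union> S (h k) (sk k))"
    proof (rule measure_mono_fmeasurable)
      show "X \<in> sets lborel" unfolding X_def using dyadic_set_fmeasurable[OF fin_Y] by (rule fmeasurableD)
      show "(\<Union>n<Suc k. S (h n) (L k) - S (h n) (sk k)) \<union> S (h k) (sk k) \<in> fmeasurable lborel"
        by (intro fmeasurable.Un fmeasurable.finite_UN fmeasurable.Diff S_fm) auto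
      show "X \<subseteq> (\<Union>n<Suc k. S (h n) (L k) - S (h n) (sk k)) \<union> S (h k) (sk k)"
      proof
        fix x assume "x \<in> X"
        then obtain y where y: "y < 8 * 2 ^ L k" "g k y" "\<lfloor>x * 2 ^ L k\<rfloor> = int y - int (4 * 2 ^ L k)"
          by (auto simp: X_def Y_def)
        have "int y < int (8 * 2 ^ L k)" using y(1) by (simp only: of_nat_less_iff)
        then have "- int (4 * 2 ^ L k) \<le> \<lfloor>x * 2 ^ L k\<rfloor>" "\<lfloor>x * 2 ^ L k\<rfloor> < int (4 * 2 ^ L k)"
          unfolding y(3) by simp_all
        then have "- 4 * 2 ^ L k \<le> x * 2 ^ L k" "x * 2 ^ L k < 4 * 2 ^ L k"
          by (simp_all add: le_floor_iff floor_less_iff)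
        then have x: "x \<in> {-4..<4}" by (simp_all only: mult_le_cancel_right mult_less_cancel_right) simp
        have "4 \<le> L k" using sk(2,4) order_trans by blast
        note in_S[OF x this] in_S[OF x sk(2)]
        then show "x \<in> (\<Union>n<Suc k. S (h n) (L k) - S (h n) (sk k)) \<union> S (h k) (sk k)"
          using y(2) unfolding g_def y(3)[symmetric] grid[OF y(3), symmetric] by auto
      qed
    qed
    also have "\<dots> \<le> measure lborel (\<Union>n<Suc k. S (h n) (L k) - S (h n) (sk k)) + measure lborel (S (h k) (sk k))"
      by (intro measure_Un_le fmeasurableD fmeasurable.finite_UN fmeasurable.Diff S_fm) auto
    also have "measure lborel (\<Union>n<Suc k. S (h n) (L k) - S (h n) (sk k)) \<le>
        (\<Sum>n<Suc k. measure lborel (S (h n) (L k) - S (h n) (sk k)))"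
      by (intro measure_UNION_le fmeasurableD fmeasurable.Diff S_fm) auto
    also have "\<dots> \<le> (\<Sum>n<Suc k. 1 / 2 ^ h k)"
    proof (rule sum_mono)
      fix n assume "n \<in> {..<Suc k}"
      then have n: "n \<le> k" by simp
      have "measure lborel (S (h n) (L k) - S (h n) (sk k)) = measure lborel (S (h n) (L k)) - measure lborel (S (h n) (sk k))"
        using S_fm S_mono[OF sk(4)] by (intro measurable_measure_Diff fmeasurableD) auto
      also have "\<dots> \<le> 1 / 2 ^ h k"
        using S_close[OF n sk(1)] S_le_V[of "h n" "L k"] by linarith
      finally show "measure lborel (S (h n) (L k) - S (h n) (sk k)) \<le> 1 / 2 ^ h k" .
    qed
    also have "measure lborel (S (h k) (sk k)) \<le> 1 / 2 ^ h k"
      using S_le_V V_measure order_trans by blast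
    also have "(\<Sum>n<Suc k. 1 / 2 ^ h k) + 1 / 2 ^ h k = (real k + 2) / 2 ^ h k"
      by (simp add: field_simps)
    also have "\<dots> \<le> exp (- (2 ^ k + 2)) / 8" unfolding h_def by (rule exp_exponent_bound)
    finally show ?thesis by simp
  qed
  moreover have "\<exists>k\<ge>l. g k (nat \<lfloor>(t0 + 4) * 2 ^ L k\<rfloor>)" for l
  proof -
    have y: "\<lfloor>t0 * 2 ^ L k\<rfloor> = int (nat \<lfloor>(t0 + 4) * 2 ^ L k\<rfloor>) - int (4 * 2 ^ L k)" for k
    proof -
      have "(t0 + 4) * 2 ^ L k = t0 * 2 ^ L k + of_int (4 * 2 ^ L k)" by (simp add: distrib_right)
      then have "\<lfloor>(t0 + 4) * 2 ^ L k\<rfloor> = \<lfloor>t0 * 2 ^ L k\<rfloor> + 4 * 2 ^ L k" by (simp only: floor_add_int)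
      moreover have "0 \<le> \<lfloor>(t0 + 4) * 2 ^ L k\<rfloor>" using t0(2) by simp
      ultimately show ?thesis by simp
    qed
    have L4: "4 \<le> L k" for k using sk(2,4) order_trans by blast
    show ?thesis
    proof (cases "t0 \<in> S (h l) (sk l)")
      case True
      then have "\<tau> (h l) (sk l) \<lfloor>t0 * 2 ^ sk l\<rfloor>" using in_S[OF t0(2) sk(2)] by blast
      then have "g l (nat \<lfloor>(t0 + 4) * 2 ^ L l\<rfloor>)" unfolding g_def grid[OF y, symmetric] by blast
      then show ?thesis by blast
    next
      case False
      have "t0 \<in> (\<Union>s. S (h l) s)" using t0(1) unfolding S_Union by blast
      then obtain s where "t0 \<in> S (h l) s" by blast
      moreover have "s \<le> sk (l + s)" using sk(3)[of "l + s"] by linarith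
      ultimately have "t0 \<in> S (h l) (sk (l + s))" using S_mono by blast
      \<comment> \<open>The step at which \<open>t0\<close> is found for the first time; it cannot
        be step \<open>0\<close> because \<open>t0\<close> is not yet known at stage
        \<open>sk l\<close>.\<close>
      with False obtain i where i: "t0 \<notin> S (h l) (sk (l + i))" "t0 \<in> S (h l) (sk (l + Suc i))"
        using ex_least_nat_less[of "\<lambda>i. t0 \<in> S (h l) (sk (l + i))" s] by auto
      have "\<not> \<tau> (h l) (sk (l + i)) \<lfloor>t0 * 2 ^ sk (l + i)\<rfloor>" using i(1) in_S[OF t0(2) sk(2)] by blast
      moreover have "\<tau> (h l) (L (l + i)) \<lfloor>t0 * 2 ^ L (l + i)\<rfloor>"
        using i(2) in_S[OF t0(2) L4] unfolding L_def by simp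
      ultimately have "g (l + i) (nat \<lfloor>(t0 + 4) * 2 ^ L (l + i)\<rfloor>)"
        unfolding g_def grid[OF y, symmetric] y[symmetric] by (intro disjI1 exI[of _ l]) simp
      then show ?thesis by (intro exI[of _ "l + i"]) simp
    qed
  qed
  moreover have "recursive L" unfolding L_def by (intro recursive_intros rec_sk)
  ultimately show ?thesis using dec_g that by blast
qed

theorem theorem1p2:
  fixes t0 :: real
  assumes "t0 \<in> {-pi..pi}" and "\<not> schnorr_random t0"
  shows "\<exists>f :: complex \<Rightarrow> complex. computable_on (complex_of_real ` {-pi..pi}) f \<and>
           \<not> convergent (\<lambda>N. fourier_sum (\<lambda>t. f (complex_of_real t)) N t0)"
proof -
  have t0: "t0 \<in> {-4..<4}" using assms(1) pi_less_4 by auto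
  obtain V where V: "schnorr_test V" "t0 \<in> (\<Inter>n. V n)"
    using assms(2) by (auto simp: schnorr_random_def)
  obtain L g where L: "recursive L" and g: "decidable (\<lambda>z. g (pfst z) (psnd z))" and
    small: "\<And>k. real (card {y. y < 8 * 2 ^ L k \<and> g k y}) / 2 ^ L k \<le> exp (- (2 ^ k + 2)) / 8" and
    often: "\<And>l. \<exists>k\<ge>l. g k (nat \<lfloor>(t0 + 4) * 2 ^ L k\<rfloor>)"
    using schnorr_test_dyadic_cover[OF V t0] by blast
  obtain d c where d: "recursive d" and c: "recursive_real (\<lambda>z. c (pfst z) (psnd z))" and
    bound: "\<And>k u. \<bar>\<Sum>n<d k. c k n * sin (real (Suc n) * u)\<bar> \<le> 3" and
    large: "\<And>k u. 0 \<le> u \<Longrightarrow> u < 8 \<Longrightarrow> g k (nat \<lfloor>u * 2 ^ L k\<rfloor>) \<Longrightarrow> 2 ^ k \<le> (\<Sum>n<d k. c k n * cos (real (Suc n) * u))"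
    using recursive_conjugate_large[OF L g small] by blast
  have "\<exists>k\<ge>l. 2 ^ k \<le> (\<Sum>n<d k. c k n * cos (real (Suc n) * (t0 + 4)))" for l
    using often[of l] large[of "t0 + 4"] t0 by force
  with d c bound show ?thesis by (rule computable_divergent_fourier)
qed

end
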